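(* Let $N\ge5$, fix $o\in\mathbb{H}^N$ and let $r=\varrho(x,o)$ be the geodesic distance from $o$. For all $u\in C_c^\infty(\mathbb{H}^N)$, $$\int_{\mathbb{H}^N}|\Delta_{\mathbb{H}^N}u|^2dv_{\mathbb{H}^N}-\frac{(N-1)^4}{16}\int_{\mathbb{H}^N}u^2dv_{\mathbb{H}^N}\ge\frac{(N-1)^2}{8}\int_{\mathbb{H}^N}\frac{u^2}{r^2}dv_{\mathbb{H}^N}+\frac{9}{16}\int_{\mathbb{H}^N}\frac{u^2}{r^4}dv_{\mathbb{H}^N}+\frac{(N^2-1)(N-3)^2}{8}\int_{\mathbb{H}^N}\frac{u^2}{\sinh^2r}dv_{\mathbb{H}^N}+\frac{(N-1)(N-3)(N^2-4N-3)}{16}\int_{\mathbb{H}^N}\frac{u^2}{\sinh^4r}dv_{\mathbb{H}^N}.$$ The constant $\frac{(N-1)^4}{16}$ is sharp in the sense that the left-hand side can be negative if it is replaced by a larger constant. Furthermore, no inequality of the form $$\int_{\mathbb{H}^N}|\Delta_{\mathbb{H}^N}u|^2dv_{\mathbb{H}^N}-\frac{(N-1)^4}{16}\int_{\mathbb{H}^N}u^2dv_{\mathbb{H}^N}\ge c\int_{\mathbb{H}^N}\frac{u^2}{r^2}dv_{\mathbb{H}^N}$$ holds for all $u\in C_c^\infty(\mathbb{H}^N)$ when $c>\frac{(N-1)^2}{8}$.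
   Context: $\Delta_{\mathbb{H}^N}$ and $dv_{\mathbb{H}^N}$ denote the Laplace–Beltrami operator and Riemannian volume of the $N$-dimensional hyperbolic space $\mathbb{H}^N$. *)

theory Defs
  imports "HOL-Analysis.Analysis"
begin

text \<open>Hyperbolic space H^N is modelled by the Poincare ball model:
  the open unit ball of real^'n with N = CARD('n), metric (2/(1-|x|^2))^2 |dx|^2.\<close>

definition hball :: "(real^'n) set" where
  "hball = ball 0 1"

definition partial :: "'n \<Rightarrow> (real^'n \<Rightarrow> real) \<Rightarrow> real^'n \<Rightarrow> real" where
  "partial i f x = deriv (\<lambda>t. f (x + t *\<^sub>R axis i 1)) 0"

fun Ck_on :: "nat \<Rightarrow> (real^'n) set \<Rightarrow> (real^'n \<Rightarrow> real) \<Rightarrow> bool" where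
  "Ck_on 0 S f = continuous_on S f"
| "Ck_on (Suc k) S f = (f differentiable_on S \<and> (\<forall>i. Ck_on k S (partial i f)))"

definition smooth_on :: "(real^'n) set \<Rightarrow> (real^'n \<Rightarrow> real) \<Rightarrow> bool" where
  "smooth_on S f = (\<forall>k. Ck_on k S f)"

definition Cc_inf_H :: "(real^'n \<Rightarrow> real) set" where
  "Cc_inf_H = {u. smooth_on hball u \<and>
      (\<exists>K. compact K \<and> K \<subseteq> hball \<and> (\<forall>x. x \<notin> K \<longrightarrow> u x = 0))}"

definition eucl_laplacian :: "(real^'n \<Rightarrow> real) \<Rightarrow> real^'n \<Rightarrow> real" where
  "eucl_laplacian u x = (\<Sum>i\<in>UNIV. partial i (partial i u) x)"

definition hyp_laplacian :: "(real^'n \<Rightarrow> real) \<Rightarrow> real^'n \<Rightarrow> real" where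
  "hyp_laplacian u x =
     ((1 - (norm x)\<^sup>2) / 2)\<^sup>2 * eucl_laplacian u x
     + (real CARD('n) - 2) * ((1 - (norm x)\<^sup>2) / 2) * (\<Sum>i\<in>UNIV. x $ i * partial i u x)"

definition hyp_integral :: "(real^'n \<Rightarrow> real) \<Rightarrow> real" where
  "hyp_integral f = (LINT x : hball | lborel. (2 / (1 - (norm x)\<^sup>2)) ^ CARD('n) * f x)"

definition hyp_dist :: "real^'n \<Rightarrow> real^'n \<Rightarrow> real" where
  "hyp_dist x y = arcosh (1 + 2 * (norm (x - y))\<^sup>2 / ((1 - (norm x)\<^sup>2) * (1 - (norm y)\<^sup>2)))"

end

theory Submission
  imports Defs
begin

text \<open>Let \<open>r\<close> be the distance from the centre of the ball, \<open>\<rho> = |x|\<close>, \<open>E = \<Sum> x\<^sub>i \<partial>\<^sub>i = sinh r \<partial>\<^sub>r\<close> and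
  \<open>D\<^sub>i\<^sub>j = x\<^sub>i \<partial>\<^sub>j - x\<^sub>j \<partial>\<^sub>i\<close>. Then \<open>sinh\<^sup>2 r \<Delta> = P + Z\<close> with \<open>P = E\<^sup>2 + (N - 2) cosh r E\<close> and
  \<open>Z = (1/2) \<Sum> D\<^sub>i\<^sub>j\<^sup>2\<close>, and the hyperbolic volume is \<open>sinh\<^sup>N r \<rho>\<^sup>-\<^sup>N dx\<close>. Dropping \<open>(Z u)\<^sup>2 \<ge> 0\<close> leaves
  \<open>(P u)\<^sup>2 + 2 P u Z u\<close>. The fields \<open>D\<^sub>i\<^sub>j\<close> commute with \<open>E\<close> and kill radial weights, so the cross term
  becomes a sum of one-dimensional quadratic forms in \<open>D\<^sub>i\<^sub>j u\<close>, which are nonnegative; no spherical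
  harmonics are needed. For \<open>(P u)\<^sup>2\<close> put \<open>v = sinh\<^bsup>(N-1)/2\<^esup> r u\<close>: up to an exact radial derivative,
  the difference of the two sides is a sum of the squares that prove the Hardy and Rellich
  inequalities on the half-line, together with \<open>r \<le> sinh r\<close>. An arbitrary pole is moved to the centre by an inversion.

  Sharpness is tested on \<open>u = sinh\<^bsup>-(N-1)/2\<^esup> r \<surd>r \<phi>(ln r / R)\<close> with a fixed bump \<open>\<phi>\<close> and \<open>R \<rightarrow> \<infinity>\<close>: the support escapes
  to infinity, where the weights in \<open>1 / sinh r\<close> are negligible and \<open>\<surd>r\<close> is the virtual
  extremal of the one-dimensional Hardy inequality.\<close>

section \<open>Partial derivatives and smooth functions\<close>

text \<open>Origin of the constants: with \<open>n = (N - 1) / 2\<close> the radial Laplacian of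
  \<open>u\<close> is \<open>v'' - n\<^sup>2 v - n (n - 1) v / sinh\<^sup>2 r\<close> up to the
  factor \<open>sinh\<^sup>-\<^sup>n r\<close>. Its square yields \<open>n ^ 4\<close>; the cross
  term \<open>2 n\<^sup>2 v'\<^sup>2\<close> with Hardy's constant 1/4 yields
  \<open>n\<^sup>2 / 2 = (N - 1)\<^sup>2 / 8\<close>; and 9/16 is the one-dimensional Rellich
  constant, a factor 1/4 from \<open>v''\<close> to \<open>v' / r\<close> and 9/4 from
  \<open>v' / r\<close> to \<open>v / r\<^sup>2\<close>. The obstacle is the singularity at the
  centre. Unlike \<open>\<partial>\<^sub>r\<close>, the fields \<open>E\<close> and
  \<open>D\<^sub>i\<^sub>j\<close> are smooth on the whole ball, so after multiplication by
  \<open>sinh\<^sup>2 r\<close> every function stays in \<open>Cc_inf_H\<close>, and all singular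
  factors sit in weights \<open>sinh\<^sup>a r cosh\<^sup>b r / r\<^sup>d\<close> against
  \<open>dx / |x|\<^sup>N\<close>. Such a weight is integrable at the centre when
  \<open>a \<ge> d + 1\<close>; the smallest \<open>a - d\<close> that occurs is
  \<open>N - 4\<close>, whence \<open>N \<ge> 5\<close>. Polar coordinates never appear:
  \<open>E\<close> is integrated by parts through dilation invariance,
  \<open>D\<^sub>i\<^sub>j\<close> because it is divergence free.\<close>

lemma partial_has_derivative:
  fixes f :: "real^'n \<Rightarrow> real"
  assumes "(f has_derivative f') (at x)"
  shows "partial i f x = f' (axis i 1)"
proof -
  have "((\<lambda>t. x + t *\<^sub>R axis i 1) has_derivative (\<lambda>t. t *\<^sub>R axis i 1)) (at (0::real))"
    by (auto intro!: derivative_eq_intros)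
  moreover have "(f has_derivative f') (at (x + 0 *\<^sub>R axis i 1))"
    using assms by simp
  ultimately have "((\<lambda>t. f (x + t *\<^sub>R axis i 1)) has_derivative (\<lambda>t. f' (t *\<^sub>R axis i 1))) (at 0)"
    by (rule has_derivative_compose)
  moreover have "(\<lambda>t. f' (t *\<^sub>R axis i 1)) = (*) (f' (axis i 1))"
    using has_derivative_linear[OF assms] by (auto simp: linear_scale fun_eq_iff)
  ultimately have "((\<lambda>t. f (x + t *\<^sub>R axis i 1)) has_field_derivative f' (axis i 1)) (at 0)"
    by (simp add: has_field_derivative_def)
  then show ?thesis
    unfolding partial_def by (rule DERIV_imp_deriv)
qed

lemma has_derivative_partials:
  fixes f :: "real^'n \<Rightarrow> real"
  assumes "f differentiable (at x)"
  shows "(f has_derivative (\<lambda>h. \<Sum>i\<in>UNIV. h $ i * partial i f x)) (at x)"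
proof -
  obtain f' where f': "(f has_derivative f') (at x)"
    using assms by (auto simp: differentiable_def)
  have lin: "linear f'"
    by (rule has_derivative_linear[OF f'])
  have "f' = (\<lambda>h. \<Sum>i\<in>UNIV. h $ i * partial i f x)"
  proof
    fix h
    have "f' h = f' (\<Sum>i\<in>UNIV. (h $ i) *\<^sub>R axis i 1)"
      using basis_expansion[of h] by (simp add: scalar_mult_eq_scaleR)
    then show "f' h = (\<Sum>i\<in>UNIV. h $ i * partial i f x)"
      using lin by (simp add: linear_sum linear_scale partial_has_derivative[OF f'])
  qed
  then show ?thesis
    using f' by simp
qed

lemma sum_axis_mult: "(\<Sum>j\<in>UNIV. axis i (1::real) $ j * f j) = f (i::'n::finite)"
proof -
  have "(\<Sum>j\<in>UNIV. axis i 1 $ j * f j) = (\<Sum>j\<in>UNIV. if i = j then f j else 0)"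
    by (rule sum.cong) (auto simp: axis_def)
  then show ?thesis by simp
qed

lemma partial_cong_open:
  fixes f g :: "real^'n \<Rightarrow> real"
  assumes "open S" "x \<in> S" "\<And>y. y \<in> S \<Longrightarrow> f y = g y"
  shows "partial i f x = partial i g x"
proof -
  have "((\<lambda>t::real. x + t *\<^sub>R axis i 1) \<longlongrightarrow> x + 0 *\<^sub>R axis i 1) (nhds 0)"
    by (intro tendsto_intros filterlim_ident)
  then have "eventually (\<lambda>t. x + t *\<^sub>R axis i 1 \<in> S) (nhds (0::real))"
    using assms(1,2) by (auto simp: tendsto_def)
  then have "eventually (\<lambda>t. f (x + t *\<^sub>R axis i 1) = g (x + t *\<^sub>R axis i 1)) (nhds (0::real))"
    by eventually_elim (use assms(3) in auto)
  then show ?thesis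
    unfolding partial_def by (rule deriv_cong_ev) simp
qed

text \<open>On an open set every partial derivative is determined by the values in the set, so
  agreement passes down the recursion in \<open>k\<close>.\<close>

lemma Ck_on_cong:
  fixes f g :: "real^'n \<Rightarrow> real"
  assumes "open S" "\<And>x. x \<in> S \<Longrightarrow> f x = g x" "Ck_on k S f"
  shows "Ck_on k S g"
  using assms(2,3)
proof (induction k arbitrary: f g)
  case 0
  then show ?case by (simp cong: continuous_on_cong)
next
  case (Suc k)
  have "g differentiable_on S"
    unfolding differentiable_on_def
  proof
    fix x assume x: "x \<in> S"
    then obtain D where "(f has_derivative D) (at x within S)"
      using Suc.prems(2) by (auto simp: differentiable_on_def differentiable_def)
    then have "(g has_derivative D) (at x within S)"
      using has_derivative_transform[OF x, of g f] Suc.prems(1) by simp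
    then show "g differentiable at x within S"
      by (auto simp: differentiable_def)
  qed
  moreover have "Ck_on k S (partial i g)" for i
  proof (rule Suc.IH)
    show "partial i f x = partial i g x" if "x \<in> S" for x
      by (rule partial_cong_open[OF assms(1) that Suc.prems(1)])
    show "Ck_on k S (partial i f)"
      using Suc.prems(2) by simp
  qed
  ultimately show ?case by simp
qed

text \<open>Replaces the \<open>deriv\<close>-based \<open>partial\<close> by a derivative in closed
  form, evaluated on the basis vectors; \<open>sum_axis_mult\<close> then collapses the gradient
  sums.\<close>

lemma Ck_on_SucI:
  fixes f :: "real^'n \<Rightarrow> real"
  assumes "open S" "\<And>x. x \<in> S \<Longrightarrow> (f has_derivative f' x) (at x)"
    and "\<And>i. Ck_on k S (\<lambda>x. f' x (axis i 1))"
  shows "Ck_on (Suc k) S f"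
proof -
  have "f differentiable_on S"
    using assms(2) by (auto simp: differentiable_on_def differentiable_def intro: has_derivative_at_withinI)
  moreover have "Ck_on k S (partial i f)" for i
    by (rule Ck_on_cong[OF assms(1) _ assms(3)[of i]]) (simp add: partial_has_derivative[OF assms(2)])
  ultimately show ?thesis by simp
qed

lemma Ck_on_SucD: "Ck_on (Suc k) S f \<Longrightarrow> Ck_on k S f"
proof (induction k arbitrary: f)
  case 0
  then show ?case by (simp add: differentiable_imp_continuous_on)
next
  case (Suc k)
  then show ?case by simp
qed

lemma Ck_on_has_derivative:
  fixes f :: "real^'n \<Rightarrow> real"
  assumes "open S" "Ck_on (Suc k) S f" "x \<in> S"
  shows "(f has_derivative (\<lambda>h. \<Sum>i\<in>UNIV. h $ i * partial i f x)) (at x)"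
proof (rule has_derivative_partials)
  have "f differentiable_on S"
    using assms(2) by simp
  then show "f differentiable (at x)"
    using assms(3) at_within_open[OF assms(3,1)] unfolding differentiable_on_def by metis
qed

lemma Ck_on_const: "Ck_on k S (\<lambda>x. c)"
proof (induction k arbitrary: c)
  case 0
  then show ?case by (simp add: continuous_on_const)
next
  case (Suc k)
  have "partial i (\<lambda>x. c) = (\<lambda>x. 0)" for i :: 'a
    by (simp add: partial_def fun_eq_iff)
  then show ?case
    using Suc.IH[of 0] by (simp del: split_paired_All)
qed

lemma Ck_on_nth:
  assumes "open S"
  shows "Ck_on k S (\<lambda>x. x $ i)"
proof (cases k)
  case 0
  then show ?thesis by (auto intro!: continuous_intros)
next
  case (Suc m)
  have "Ck_on (Suc m) S (\<lambda>x. x $ i)"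
    by (rule Ck_on_SucI[OF assms, where f' = "\<lambda>_ h. h $ i"])
      (auto intro: bounded_linear_imp_has_derivative bounded_linear_vec_nth Ck_on_const)
  then show ?thesis using Suc by simp
qed

lemma Ck_on_add:
  assumes "open S" "Ck_on k S f" "Ck_on k S g"
  shows "Ck_on k S (\<lambda>x. f x + g x)"
  using assms(2,3)
proof (induction k arbitrary: f g)
  case 0
  then show ?case by (simp add: continuous_on_add)
next
  case (Suc k)
  show ?case
  proof (rule Ck_on_SucI[OF assms(1)])
    show "((\<lambda>x. f x + g x) has_derivative
        (\<lambda>h. (\<Sum>i\<in>UNIV. h $ i * partial i f x) + (\<Sum>i\<in>UNIV. h $ i * partial i g x))) (at x)"
      if "x \<in> S" for x
      using Suc.prems that by (intro has_derivative_add Ck_on_has_derivative[OF assms(1)])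
    show "Ck_on k S (\<lambda>x. (\<Sum>j\<in>UNIV. axis i 1 $ j * partial j f x) + (\<Sum>j\<in>UNIV. axis i 1 $ j * partial j g x))" for i
      using Suc by (simp add: sum_axis_mult)
  qed
qed

lemma Ck_on_mult:
  assumes "open S" "Ck_on k S f" "Ck_on k S g"
  shows "Ck_on k S (\<lambda>x. f x * g x)"
  using assms(2,3)
proof (induction k arbitrary: f g)
  case 0
  then show ?case by (simp add: continuous_on_mult)
next
  case (Suc k)
  show ?case
  proof (rule Ck_on_SucI[OF assms(1)])
    show "((\<lambda>x. f x * g x) has_derivative
        (\<lambda>h. f x * (\<Sum>i\<in>UNIV. h $ i * partial i g x) + (\<Sum>i\<in>UNIV. h $ i * partial i f x) * g x)) (at x)"
      if "x \<in> S" for x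
      using Suc.prems that by (intro has_derivative_mult Ck_on_has_derivative[OF assms(1)])
    have "Ck_on k S f" "Ck_on k S g"
      using Suc.prems by (auto dest!: Ck_on_SucD simp del: Ck_on.simps)
    then show "Ck_on k S (\<lambda>x. f x * (\<Sum>j\<in>UNIV. axis i 1 $ j * partial j g x) + (\<Sum>j\<in>UNIV. axis i 1 $ j * partial j f x) * g x)" for i
      using Suc by (auto simp: sum_axis_mult intro!: Ck_on_add assms(1))
  qed
qed

lemma Ck_on_sum:
  assumes "open S" "\<And>i. i \<in> I \<Longrightarrow> Ck_on k S (f i)"
  shows "Ck_on k S (\<lambda>x. \<Sum>i\<in>I. f i x)"
  using assms by (induction I rule: infinite_finite_induct) (auto intro!: Ck_on_const Ck_on_add)

text \<open>A set \<open>G\<close> of functions that is closed under differentiation plays the role of a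
  coinductive invariant for smoothness in one variable.\<close>

lemma Ck_on_compose_real:
  fixes f :: "real^'n \<Rightarrow> real"
  assumes "open S" "Ck_on k S f" "f ` S \<subseteq> U" "g \<in> G"
    and "\<And>g. g \<in> G \<Longrightarrow> \<exists>g'\<in>G. \<forall>t\<in>U. (g has_real_derivative g' t) (at t)"
  shows "Ck_on k S (\<lambda>x. g (f x))"
  using assms(2,4)
proof (induction k arbitrary: g)
  case 0
  then obtain g' where "\<forall>t\<in>U. (g has_real_derivative g' t) (at t)"
    using assms(5) by blast
  then have "continuous_on U g"
    using DERIV_continuous_on has_field_derivative_at_within by blast
  then show ?case
    using 0 assms(3) by (auto intro: continuous_on_compose2)
next
  case (Suc k)
  obtain g' where g': "g' \<in> G" "\<And>t. t \<in> U \<Longrightarrow> (g has_real_derivative g' t) (at t)"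
    using assms(5) Suc.prems by blast
  show ?case
  proof (rule Ck_on_SucI[OF assms(1)])
    show "((\<lambda>x. g (f x)) has_derivative
        (\<lambda>h. g' (f x) * (\<Sum>i\<in>UNIV. h $ i * partial i f x))) (at x)"
      if "x \<in> S" for x
      using has_derivative_compose[OF Ck_on_has_derivative[OF assms(1) Suc.prems(1) that]
          g'(2)[of "f x", unfolded has_field_derivative_def]] that assms(3) by auto
    have "Ck_on k S f"
      using Suc.prems by (auto dest!: Ck_on_SucD simp del: Ck_on.simps)
    then show "Ck_on k S (\<lambda>x. g' (f x) * (\<Sum>j\<in>UNIV. axis i 1 $ j * partial j f x))" for i
      using Suc g' by (auto simp: sum_axis_mult
          intro!: Ck_on_mult assms(1))
  qed
qed

lemma has_derivative_vecI:
  fixes T :: "'a::real_normed_vector \<Rightarrow> real^'n"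
  assumes "\<And>j. ((\<lambda>x. T x $ j) has_derivative (\<lambda>h. T' h $ j)) (at x within S)"
  shows "(T has_derivative T') (at x within S)"
proof -
  have "((\<lambda>x. T x \<bullet> i) has_derivative (\<lambda>h. T' h \<bullet> i)) (at x within S)" if "i \<in> Basis" for i
  proof -
    from that obtain j where "i = axis j 1"
      by (auto simp: Basis_vec_def)
    then show ?thesis
      using assms[of j] by (simp add: inner_axis)
  qed
  then show ?thesis
    using has_derivative_componentwise_within[of T T'] by blast
qed


text \<open>By the chain rule the partials of the composite are sums of products of partials of the
  components of \<open>T\<close> with \<open>partial j f (T x)\<close>; the induction hypothesis
  covers the latter because \<open>f\<close> is arbitrary in it.\<close>

lemma Ck_on_compose:
  fixes f :: "real^'m \<Rightarrow> real" and T :: "real^'n \<Rightarrow> real^'m"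
  assumes "open S" "open U" "T ` S \<subseteq> U" "\<And>j. Ck_on k S (\<lambda>x. T x $ j)" "Ck_on k U f"
  shows "Ck_on k S (\<lambda>x. f (T x))"
  using assms(4,5)
proof (induction k arbitrary: f)
  case 0
  have "continuous_on S (\<lambda>x. \<chi> j. T x $ j)"
    by (rule continuous_on_vec_lambda) (use 0 in auto)
  moreover have "(\<lambda>x. \<chi> j. T x $ j) = T"
    by (simp add: fun_eq_iff vec_eq_iff)
  ultimately have "continuous_on S T" by simp
  with 0 show ?case
    using assms(3) by (auto intro: continuous_on_compose2)
next
  case (Suc k)
  define T' where "T' x h = (\<chi> j. \<Sum>i\<in>UNIV. h $ i * partial i (\<lambda>x. T x $ j) x)" for x h
  have T': "(T has_derivative T' x) (at x)" if "x \<in> S" for x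
    using Ck_on_has_derivative[OF assms(1) Suc.prems(1) that]
    by (intro has_derivative_vecI) (simp add: T'_def)
  show ?case
  proof (rule Ck_on_SucI[OF assms(1)])
    show "((\<lambda>x. f (T x)) has_derivative (\<lambda>h. \<Sum>j\<in>UNIV. T' x h $ j * partial j f (T x))) (at x)"
      if "x \<in> S" for x
      by (rule has_derivative_compose[OF T'[OF that] Ck_on_has_derivative[OF assms(2) Suc.prems(2)]])
        (use that assms(3) in auto)
    have "Ck_on k S (\<lambda>x. T x $ j)" for j
      using Suc.prems(1)[of j] by (rule Ck_on_SucD)
    moreover have "Ck_on k U (partial j f)" for j
      using Suc.prems(2) by simp
    ultimately have "Ck_on k S (\<lambda>x. partial j f (T x))" for j
      by (rule Suc.IH)
    moreover have "Ck_on k S (partial i (\<lambda>x. T x $ j))" for i j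
      using Suc.prems(1)[of j] by simp
    ultimately have "Ck_on k S (\<lambda>x. \<Sum>j\<in>UNIV. partial i (\<lambda>x. T x $ j) x * partial j f (T x))" for i
      by (intro Ck_on_sum Ck_on_mult assms(1))
    then show "Ck_on k S (\<lambda>x. \<Sum>j\<in>UNIV. T' x (axis i 1) $ j * partial j f (T x))" for i
      by (simp only: T'_def vec_lambda_beta sum_axis_mult)
  qed
qed

lemma partial_DERIV:
  fixes f :: "real^'n \<Rightarrow> real"
  assumes "f differentiable (at (y + s *\<^sub>R axis i 1))"
  shows "((\<lambda>t. f (y + t *\<^sub>R axis i 1)) has_real_derivative partial i f (y + s *\<^sub>R axis i 1)) (at s)"
proof -
  have "((\<lambda>t. y + t *\<^sub>R axis i 1) has_derivative (\<lambda>t. t *\<^sub>R axis i 1)) (at s)"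
    by (auto intro!: derivative_eq_intros)
  from has_derivative_compose[OF this has_derivative_partials[OF assms]]
  have "((\<lambda>t. f (y + t *\<^sub>R axis i 1)) has_derivative
      (\<lambda>t. t * partial i f (y + s *\<^sub>R axis i 1))) (at s)"
    by (simp add: mult.assoc sum_axis_mult flip: sum_distrib_left)
  then show ?thesis
    by (simp add: has_field_derivative_def mult.commute[of _ "partial i f _"])
qed

text \<open>The mean value theorem twice: in direction \<open>i\<close> for the increment of
  \<open>f\<close> in direction \<open>j\<close>, then in direction \<open>j\<close> for
  \<open>partial i f\<close>. The left side is symmetric in \<open>i\<close> and
  \<open>j\<close>.\<close>

lemma second_difference:
  fixes f :: "real^'n \<Rightarrow> real"
  assumes "0 < h" and f: "\<And>y. dist y x \<le> 2 * h \<Longrightarrow> f differentiable (at y)"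
    and f': "\<And>y. dist y x \<le> 2 * h \<Longrightarrow> partial i f differentiable (at y)"
  shows "\<exists>y. dist y x \<le> 2 * h \<and>
    f (x + h *\<^sub>R axis i 1 + h *\<^sub>R axis j 1) - f (x + h *\<^sub>R axis i 1) - f (x + h *\<^sub>R axis j 1) + f x
      = h * h * partial j (partial i f) y"
proof -
  have d: "dist (x + s *\<^sub>R axis i 1 + t *\<^sub>R axis j 1) x \<le> 2 * h" if "0 \<le> s" "s \<le> h" "0 \<le> t" "t \<le> h" for s t
  proof -
    have "norm (s *\<^sub>R axis i (1::real) + t *\<^sub>R axis j 1 :: real^'n) \<le> s + t"
      using norm_triangle_ineq[of "s *\<^sub>R axis i (1::real) :: real^'n" "t *\<^sub>R axis j 1"] that by simp
    then show ?thesis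
      using that by (simp add: dist_norm add.assoc)
  qed
  have comm: "x + s *\<^sub>R axis i 1 + t *\<^sub>R axis j 1 = (x + t *\<^sub>R axis j 1) + s *\<^sub>R axis i 1" for s t
    by (simp add: ac_simps)
  define g where "g s = f (x + s *\<^sub>R axis i 1 + h *\<^sub>R axis j 1) - f (x + s *\<^sub>R axis i 1)" for s
  have "(g has_real_derivative partial i f (x + s *\<^sub>R axis i 1 + h *\<^sub>R axis j 1) - partial i f (x + s *\<^sub>R axis i 1)) (at s)"
    if "0 \<le> s" "s \<le> h" for s
    unfolding g_def comm
    by (intro DERIV_diff partial_DERIV f) (use d[of s h] d[of s 0] that assms(1) in \<open>auto simp: comm[symmetric]\<close>)
  from MVT2[OF assms(1) this] obtain s where s: "0 < s" "s < h"
    "g h - g 0 = h * (partial i f (x + s *\<^sub>R axis i 1 + h *\<^sub>R axis j 1) - partial i f (x + s *\<^sub>R axis i 1))"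
    by auto
  have "((\<lambda>t. partial i f (x + s *\<^sub>R axis i 1 + t *\<^sub>R axis j 1)) has_real_derivative
     partial j (partial i f) (x + s *\<^sub>R axis i 1 + t *\<^sub>R axis j 1)) (at t)"
    if "0 \<le> t" "t \<le> h" for t
    by (intro partial_DERIV f') (use d[of s t] that s in auto)
  from MVT2[OF assms(1) this] obtain t where t: "0 < t" "t < h"
    "partial i f (x + s *\<^sub>R axis i 1 + h *\<^sub>R axis j 1) - partial i f (x + s *\<^sub>R axis i 1)
      = h * partial j (partial i f) (x + s *\<^sub>R axis i 1 + t *\<^sub>R axis j 1)"
    by auto
  show ?thesis
    by (rule exI[of _ "x + s *\<^sub>R axis i 1 + t *\<^sub>R axis j 1"])
      (use d[of s t] s t in \<open>auto simp: g_def algebra_simps\<close>)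
qed

text \<open>Schwarz's theorem: one second difference equals \<open>h * h\<close> times either mixed
  partial, each taken at a point near \<open>x\<close>; continuity at \<open>x\<close> identifies
  the two limits.\<close>

lemma partial_commute:
  fixes f :: "real^'n \<Rightarrow> real"
  assumes "open S" "Ck_on 2 S f" "x \<in> S"
  shows "partial i (partial j f) x = partial j (partial i f) x"
proof -
  have C2: "Ck_on (Suc 1) S f" "Ck_on (Suc 0) S (partial k f)" for k
    using assms(2) by (simp_all add: numeral_2_eq_2)
  have df: "f differentiable (at y)" "partial k f differentiable (at y)" if "y \<in> S" for k y
    using Ck_on_has_derivative[OF assms(1) C2(1) that] Ck_on_has_derivative[OF assms(1) C2(2) that]
    by (auto simp: differentiable_def)
  have ct: "isCont (partial k (partial l f)) x" for k l
    using assms C2(2)[of l] by (auto simp: continuous_on_eq_continuous_at)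
  have "\<bar>partial i (partial j f) x - partial j (partial i f) x\<bar> < e" if "e > 0" for e
  proof -
    obtain d1 where d1: "d1 > 0" "\<And>y. dist y x < d1 \<Longrightarrow> dist (partial i (partial j f) y) (partial i (partial j f) x) < e/2"
      using ct[of i j] half_gt_zero[OF \<open>e > 0\<close>] unfolding continuous_at_eps_delta by blast
    obtain d2 where d2: "d2 > 0" "\<And>y. dist y x < d2 \<Longrightarrow> dist (partial j (partial i f) y) (partial j (partial i f) x) < e/2"
      using ct[of j i] half_gt_zero[OF \<open>e > 0\<close>] unfolding continuous_at_eps_delta by blast
    obtain d3 where d3: "d3 > 0" "ball x d3 \<subseteq> S"
      using assms(1,3) openE by blast
    \<comment> \<open>Division by 4 puts \<open>2 * h\<close>, the radius in
      \<open>second_difference\<close>, strictly below all three radii.\<close>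
    define h where "h = min d1 (min d2 d3) / 4"
    have h: "h > 0" "2 * h < d1" "2 * h < d2" "2 * h < d3"
      using d1 d2 d3 by (auto simp: h_def)
    have S: "y \<in> S" if "dist y x \<le> 2 * h" for y
      using that d3 h by (auto simp: subset_iff dist_commute)
    obtain y where y: "dist y x \<le> 2 * h"
      "f (x + h *\<^sub>R axis i 1 + h *\<^sub>R axis j 1) - f (x + h *\<^sub>R axis i 1) - f (x + h *\<^sub>R axis j 1) + f x
      = h * h * partial j (partial i f) y"
      using second_difference[of h x f i j] h df S by blast
    obtain z where z: "dist z x \<le> 2 * h"
      "f (x + h *\<^sub>R axis j 1 + h *\<^sub>R axis i 1) - f (x + h *\<^sub>R axis j 1) - f (x + h *\<^sub>R axis i 1) + f x
      = h * h * partial i (partial j f) z"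
      using second_difference[of h x f j i] h df S by blast
    have "f (x + h *\<^sub>R axis j 1 + h *\<^sub>R axis i 1) = f (x + h *\<^sub>R axis i 1 + h *\<^sub>R axis j 1)"
      by (rule arg_cong[where f = f]) (simp add: ac_simps)
    then have "h * h * partial i (partial j f) z = h * h * partial j (partial i f) y"
      using y(2) z(2) by linarith
    then have "partial i (partial j f) z = partial j (partial i f) y"
      using h by simp
    moreover have "dist (partial i (partial j f) z) (partial i (partial j f) x) < e/2"
      using z h by (intro d1) auto
    moreover have "dist (partial j (partial i f) y) (partial j (partial i f) x) < e/2"
      using y h by (intro d2) auto
    ultimately show ?thesis
      unfolding dist_real_def by linarith
  qed
  then show ?thesis
    by (metis abs_0_eq abs_ge_zero less_irrefl linorder_not_le right_minus_eq zero_less_abs_iff)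
qed

section \<open>Closure properties of smooth functions\<close>

lemma smooth_on_cong:
  assumes "open S" "\<And>x. x \<in> S \<Longrightarrow> f x = g x" "smooth_on S f"
  shows "smooth_on S g"
  using assms Ck_on_cong unfolding smooth_on_def by blast

lemma smooth_on_const: "smooth_on S (\<lambda>x. c)"
  by (simp add: smooth_on_def Ck_on_const)

lemma smooth_on_nth: "open S \<Longrightarrow> smooth_on S (\<lambda>x. x $ i)"
  by (simp add: smooth_on_def Ck_on_nth)

lemma smooth_on_add: "open S \<Longrightarrow> smooth_on S f \<Longrightarrow> smooth_on S g \<Longrightarrow> smooth_on S (\<lambda>x. f x + g x)"
  by (simp add: smooth_on_def Ck_on_add)

lemma smooth_on_mult: "open S \<Longrightarrow> smooth_on S f \<Longrightarrow> smooth_on S g \<Longrightarrow> smooth_on S (\<lambda>x. f x * g x)"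
  by (simp add: smooth_on_def Ck_on_mult)

lemma smooth_on_diff:
  assumes "open S" "smooth_on S f" "smooth_on S g"
  shows "smooth_on S (\<lambda>x. f x - g x)"
  using smooth_on_add[OF assms(1,2) smooth_on_mult[OF assms(1) smooth_on_const[of S "-1"] assms(3)]] by simp

lemma smooth_on_sum: "open S \<Longrightarrow> (\<And>i. i \<in> I \<Longrightarrow> smooth_on S (f i)) \<Longrightarrow> smooth_on S (\<lambda>x. \<Sum>i\<in>I. f i x)"
  by (simp add: smooth_on_def Ck_on_sum)

lemma smooth_on_partial: "smooth_on S f \<Longrightarrow> smooth_on S (partial i f)"
  unfolding smooth_on_def by (meson Ck_on.simps(2))

lemma smooth_on_compose_real:
  assumes "open S" "smooth_on S f" "f ` S \<subseteq> U" "g \<in> G"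
    and "\<And>g. g \<in> G \<Longrightarrow> \<exists>g'\<in>G. \<forall>t\<in>U. (g has_real_derivative g' t) (at t)"
  shows "smooth_on S (\<lambda>x. g (f x))"
  using assms(2) Ck_on_compose_real[OF assms(1) _ assms(3-5)] by (simp add: smooth_on_def)

lemma smooth_on_compose:
  assumes "open S" "open U" "T ` S \<subseteq> U" "\<And>j. smooth_on S (\<lambda>x. T x $ j)" "smooth_on U f"
  shows "smooth_on S (\<lambda>x. f (T x))"
  using assms(4,5) Ck_on_compose[OF assms(1-3)] by (simp add: smooth_on_def)

lemma smooth_on_has_derivative:
  assumes "open S" "smooth_on S f" "x \<in> S"
  shows "(f has_derivative (\<lambda>h. \<Sum>i\<in>UNIV. h $ i * partial i f x)) (at x)"
  using Ck_on_has_derivative[OF assms(1) _ assms(3)] assms(2) unfolding smooth_on_def by blast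

section \<open>Test functions and the radial and rotational fields\<close>

lemma open_hball [simp]: "open hball"
  by (simp add: hball_def)

lemma mem_hball: "x \<in> hball \<longleftrightarrow> norm x < 1"
  by (simp add: hball_def)

lemma Cc_inf_H_smooth: "u \<in> Cc_inf_H \<Longrightarrow> smooth_on hball u"
  by (simp add: Cc_inf_H_def)

text \<open>A compact subset of the open ball stays at positive distance from the sphere. This
  radial form of the support condition is the one used in all later estimates.\<close>

lemma Cc_inf_H_support:
  assumes "u \<in> Cc_inf_H"
  obtains R where "0 < R" "R < 1" "\<And>x. norm x > R \<Longrightarrow> u x = 0"
proof -
  obtain K where K: "compact K" "K \<subseteq> hball" "\<And>x. x \<notin> K \<Longrightarrow> u x = 0"
    using assms by (auto simp: Cc_inf_H_def)
  show thesis
  proof (cases "K = {}")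
    case True
    then show ?thesis using K by (intro that[of "1/2"]) auto
  next
    case False
    have "continuous_on K norm" by (intro continuous_intros)
    from continuous_attains_sup[OF K(1) False this]
    obtain y where y: "y \<in> K" "\<And>x. x \<in> K \<Longrightarrow> norm x \<le> norm y" by auto
    have "norm y < 1" using y K by (auto simp: mem_hball)
    show ?thesis
    \<comment> \<open>The midpoint between \<open>norm y\<close> and 1 is positive even if
      \<open>y = 0\<close>.\<close>
    proof (rule that[of "(norm y + 1) / 2"])
      show "u x = 0" if "norm x > (norm y + 1) / 2" for x
      proof (rule K(3))
        show "x \<notin> K" using y(2)[of x] that \<open>norm y < 1\<close> by auto
      qed
      show "0 < (norm y + 1) / 2" by (simp add: add_nonneg_pos)
      show "(norm y + 1) / 2 < 1" using \<open>norm y < 1\<close> by simp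
    qed
  qed
qed

lemma Cc_inf_HI:
  assumes "smooth_on hball u" "R < 1" "\<And>x. norm x > R \<Longrightarrow> u x = 0"
  shows "u \<in> Cc_inf_H"
  unfolding Cc_inf_H_def
proof (intro CollectI conjI exI[of _ "cball 0 R"] assms(1))
  show "cball 0 R \<subseteq> hball" "\<forall>x. x \<notin> cball 0 R \<longrightarrow> u x = 0"
    using assms by (auto simp: mem_hball)
qed simp

lemma partial_zero_outside:
  fixes u :: "real^'n \<Rightarrow> real"
  assumes "\<And>x. norm x > R \<Longrightarrow> u x = 0" "norm x > R"
  shows "partial i u x = 0"
proof -
  have "open {x::real^'n. norm x > R}"
    by (intro open_Collect_less continuous_intros)
  then have "partial i u x = partial i (\<lambda>x. 0) x"
    by (rule partial_cong_open) (use assms in auto)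
  then show ?thesis by (simp add: partial_def)
qed

lemma Cc_inf_H_partial:
  assumes "u \<in> Cc_inf_H" shows "partial i u \<in> Cc_inf_H"
proof -
  obtain R where R: "0 < R" "R < 1" "\<And>x. norm x > R \<Longrightarrow> u x = 0"
    using Cc_inf_H_support[OF assms] by metis
  show ?thesis
    using R(2) smooth_on_partial[OF Cc_inf_H_smooth[OF assms]] partial_zero_outside[of R u] R(3)
    by (intro Cc_inf_HI[of _ R]) auto
qed

text \<open>Valid at every point of the space: on and beyond the unit sphere \<open>u\<close>
  vanishes in a neighbourhood. Test functions can therefore be integrated and differentiated over
  all of \<open>real^'n\<close> without boundary terms.\<close>

lemma Cc_inf_H_has_derivative:
  assumes "u \<in> Cc_inf_H"
  shows "(u has_derivative (\<lambda>h. \<Sum>i\<in>UNIV. h $ i * partial i u x)) (at x)"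
proof (cases "x \<in> hball")
  case True
  then show ?thesis
    using smooth_on_has_derivative[OF open_hball Cc_inf_H_smooth[OF assms]] by blast
next
  case False
  obtain R where R: "0 < R" "R < 1" "\<And>x. norm x > R \<Longrightarrow> u x = 0"
    using Cc_inf_H_support[OF assms] by metis
  have op: "open {x::real^'a. norm x > R}"
    by (intro open_Collect_less continuous_intros)
  have x: "x \<in> {x. norm x > R}" using False R by (auto simp: mem_hball)
  have "((\<lambda>x. 0::real) has_derivative (\<lambda>h. 0)) (at x)" by simp
  then have "(u has_derivative (\<lambda>h. 0)) (at x)"
    by (rule has_derivative_transform_within_open[OF _ op x]) (use R in auto)
  then show ?thesis
    by (intro has_derivative_partials) (auto simp: differentiable_def)
qed

lemma Cc_inf_H_continuous: "u \<in> Cc_inf_H \<Longrightarrow> continuous_on UNIV u"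
  by (intro continuous_at_imp_continuous_on) (auto intro: has_derivative_continuous Cc_inf_H_has_derivative)

lemma Cc_inf_H_measurable: "u \<in> Cc_inf_H \<Longrightarrow> u \<in> borel_measurable borel"
  by (intro borel_measurable_continuous_onI Cc_inf_H_continuous)

lemma Cc_inf_H_bounded:
  assumes "u \<in> Cc_inf_H"
  obtains B where "B \<ge> 0" "\<And>x. \<bar>u x\<bar> \<le> B"
proof -
  obtain R where R: "0 < R" "R < 1" "\<And>x. norm x > R \<Longrightarrow> u x = 0"
    using Cc_inf_H_support[OF assms] by metis
  have "compact (u ` cball 0 1)"
    by (intro compact_continuous_image continuous_on_subset[OF Cc_inf_H_continuous[OF assms]]) auto
  then obtain B where B: "B > 0" "\<And>y. y \<in> u ` cball 0 1 \<Longrightarrow> norm y \<le> B"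
    using compact_imp_bounded[of "u ` cball 0 1"] unfolding bounded_pos by blast
  have "\<bar>u x\<bar> \<le> B" for x
  proof (cases "norm x \<le> 1")
    case True
    then have "u x \<in> u ` cball 0 1" by (intro imageI) simp
    from B(2)[OF this] show ?thesis by simp
  next
    case False
    then have "u x = 0" using R(2) by (intro R(3)) linarith
    then show ?thesis using B(1) by simp
  qed
  then show thesis using that[of B] B by auto
qed

lemma Cc_inf_H_mult_smooth:
  assumes "u \<in> Cc_inf_H" "smooth_on hball f"
  shows "(\<lambda>x. f x * u x) \<in> Cc_inf_H"
proof -
  obtain R where R: "0 < R" "R < 1" "\<And>x. norm x > R \<Longrightarrow> u x = 0"
    using Cc_inf_H_support[OF assms(1)] by metis
  show ?thesis
    by (intro Cc_inf_HI[OF _ R(2)] smooth_on_mult) (use assms R Cc_inf_H_smooth in auto)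
qed

lemma Cc_inf_H_mult:
  "u \<in> Cc_inf_H \<Longrightarrow> w \<in> Cc_inf_H \<Longrightarrow> (\<lambda>x. u x * w x) \<in> Cc_inf_H"
  by (intro Cc_inf_H_mult_smooth Cc_inf_H_smooth)

lemma Cc_inf_H_add:
  assumes "u \<in> Cc_inf_H" "w \<in> Cc_inf_H"
  shows "(\<lambda>x. u x + w x) \<in> Cc_inf_H"
proof -
  obtain R where R: "R < 1" "\<And>x. norm x > R \<Longrightarrow> u x = 0"
    using Cc_inf_H_support[OF assms(1)] by metis
  obtain R' where R': "R' < 1" "\<And>x. norm x > R' \<Longrightarrow> w x = 0"
    using Cc_inf_H_support[OF assms(2)] by metis
  show ?thesis
  proof (rule Cc_inf_HI)
    show "smooth_on hball (\<lambda>x. u x + w x)"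
      by (intro smooth_on_add Cc_inf_H_smooth assms open_hball)
    show "max R R' < 1" using R(1) R'(1) by simp
    show "u x + w x = 0" if "norm x > max R R'" for x
      using R(2)[of x] R'(2)[of x] that by simp
  qed
qed

lemma Cc_inf_H_cmult: "u \<in> Cc_inf_H \<Longrightarrow> (\<lambda>x. c * u x) \<in> Cc_inf_H"
  by (intro Cc_inf_H_mult_smooth smooth_on_const)

lemma Cc_inf_H_zero: "(\<lambda>x. 0) \<in> Cc_inf_H"
  by (rule Cc_inf_HI[of _ 0]) (auto simp: smooth_on_const)

lemma Cc_inf_H_diff:
  assumes "u \<in> Cc_inf_H" "w \<in> Cc_inf_H"
  shows "(\<lambda>x. u x - w x) \<in> Cc_inf_H"
  using Cc_inf_H_add[OF assms(1) Cc_inf_H_cmult[OF assms(2), of "-1"]] by simp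

lemma Cc_inf_H_sum:
  "(\<And>i. i \<in> I \<Longrightarrow> f i \<in> Cc_inf_H) \<Longrightarrow> (\<lambda>x. \<Sum>i\<in>I. f i x) \<in> Cc_inf_H"
  by (induction I rule: infinite_finite_induct) (auto intro!: Cc_inf_H_add Cc_inf_H_zero)

lemma Cc_inf_H_nth_mult: "u \<in> Cc_inf_H \<Longrightarrow> (\<lambda>x. x $ i * u x) \<in> Cc_inf_H"
  by (intro Cc_inf_H_mult_smooth smooth_on_nth) auto

text \<open>The generator of dilations, equal to \<open>sinh r \<partial>\<^sub>r\<close> in
  hyperbolic terms.\<close>

definition euler :: "(real^'n \<Rightarrow> real) \<Rightarrow> real^'n \<Rightarrow> real" where
  "euler u x = (\<Sum>i\<in>UNIV. x $ i * partial i u x)"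

text \<open>The generator of rotations in the plane of the coordinates \<open>i\<close> and
  \<open>j\<close>.\<close>

definition rot :: "'n \<Rightarrow> 'n \<Rightarrow> (real^'n \<Rightarrow> real) \<Rightarrow> real^'n \<Rightarrow> real" where
  "rot i j u x = x $ i * partial j u x - x $ j * partial i u x"

lemma Cc_inf_H_euler: "u \<in> Cc_inf_H \<Longrightarrow> euler u \<in> Cc_inf_H"
  unfolding euler_def [abs_def] by (intro Cc_inf_H_sum Cc_inf_H_nth_mult Cc_inf_H_partial)

lemma Cc_inf_H_rot: "u \<in> Cc_inf_H \<Longrightarrow> rot i j u \<in> Cc_inf_H"
  unfolding rot_def [abs_def] by (intro Cc_inf_H_diff Cc_inf_H_nth_mult Cc_inf_H_partial)

lemma euler_has_derivative:
  assumes "(f has_derivative f') (at x)"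
  shows "euler f x = f' x"
proof -
  have "(f has_derivative (\<lambda>h. \<Sum>i\<in>UNIV. h $ i * partial i f x)) (at x)"
    using assms by (intro has_derivative_partials) (auto simp: differentiable_def)
  then have "f' = (\<lambda>h. \<Sum>i\<in>UNIV. h $ i * partial i f x)"
    using assms has_derivative_unique by blast
  then show ?thesis by (simp add: euler_def)
qed

lemma euler_mult:
  assumes "u \<in> Cc_inf_H" "w \<in> Cc_inf_H"
  shows "euler (\<lambda>x. u x * w x) x = u x * euler w x + euler u x * w x"
  using euler_has_derivative[OF has_derivative_mult[OF Cc_inf_H_has_derivative[OF assms(1)] Cc_inf_H_has_derivative[OF assms(2)]]]
  by (simp add: euler_def)

lemma euler_DERIV:
  assumes "u \<in> Cc_inf_H" "k \<noteq> 0"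
  shows "((\<lambda>k. u (k *\<^sub>R x)) has_real_derivative euler u (k *\<^sub>R x) / k) (at k)"
proof -
  have "((\<lambda>k. k *\<^sub>R x) has_derivative (\<lambda>h. h *\<^sub>R x)) (at k)"
    by (auto intro!: derivative_eq_intros)
  from has_derivative_compose[OF this Cc_inf_H_has_derivative[OF assms(1)]]
  have "((\<lambda>k. u (k *\<^sub>R x)) has_derivative (\<lambda>h. \<Sum>i\<in>UNIV. (h *\<^sub>R x) $ i * partial i u (k *\<^sub>R x))) (at k)" .
  moreover have "(\<lambda>h. \<Sum>i\<in>UNIV. (h *\<^sub>R x) $ i * partial i u (k *\<^sub>R x)) = (*) (euler u (k *\<^sub>R x) / k)"
    using assms(2) by (auto simp: fun_eq_iff euler_def sum_distrib_left sum_distrib_right sum_divide_distrib ac_simps intro!: sum.cong)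
  ultimately show ?thesis
    by (simp add: has_field_derivative_def)
qed

section \<open>Second derivatives, the commutator of the two fields and the decomposition of the
  Laplacian\<close>

lemma partial_Cc_mult:
  assumes "u \<in> Cc_inf_H"
  shows "partial k (\<lambda>x. x $ i * u x) x = (if k = i then u x else 0) + x $ i * partial k u x"
proof -
  have "((\<lambda>x. x $ i) has_derivative (\<lambda>h. h $ i)) (at x)"
    by (intro bounded_linear_imp_has_derivative bounded_linear_vec_nth)
  from partial_has_derivative[OF has_derivative_mult[OF this Cc_inf_H_has_derivative[OF assms]], of k]
  show ?thesis by (simp only: sum_axis_mult) (simp add: axis_def)
qed

lemma partial_Cc_diff:
  assumes "u \<in> Cc_inf_H" "w \<in> Cc_inf_H"
  shows "partial k (\<lambda>x. u x - w x) x = partial k u x - partial k w x"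
  using partial_has_derivative[OF has_derivative_diff[OF Cc_inf_H_has_derivative[OF assms(1)]
        Cc_inf_H_has_derivative[OF assms(2)]], of k]
  by (simp only: sum_axis_mult)

lemma partial_Cc_sum:
  assumes "\<And>i. i \<in> I \<Longrightarrow> f i \<in> Cc_inf_H"
  shows "partial k (\<lambda>x. \<Sum>i\<in>I. f i x) x = (\<Sum>i\<in>I. partial k (f i) x)"
proof -
  have "((\<lambda>x. \<Sum>i\<in>I. f i x) has_derivative (\<lambda>h. \<Sum>i\<in>I. \<Sum>j\<in>UNIV. h $ j * partial j (f i) x)) (at x)"
    by (intro has_derivative_sum Cc_inf_H_has_derivative assms)
  from partial_has_derivative[OF this, of k] show ?thesis
    by (simp only: sum_axis_mult)
qed

lemma partial_rot:
  assumes u: "u \<in> Cc_inf_H"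
  shows "partial k (rot i j u) x = (if k = i then partial j u x else 0) + x $ i * partial k (partial j u) x
    - (if k = j then partial i u x else 0) - x $ j * partial k (partial i u) x"
proof -
  have "partial k (rot i j u) x = partial k (\<lambda>x. x $ i * partial j u x) x - partial k (\<lambda>x. x $ j * partial i u x) x"
    unfolding rot_def [abs_def]
    by (intro partial_Cc_diff Cc_inf_H_nth_mult Cc_inf_H_partial u)
  then show ?thesis
    by (simp add: partial_Cc_mult[OF Cc_inf_H_partial[OF u]])
qed

lemma partial_euler:
  assumes u: "u \<in> Cc_inf_H"
  shows "partial k (euler u) x = partial k u x + (\<Sum>i\<in>UNIV. x $ i * partial k (partial i u) x)"
proof -
  have "partial k (euler u) x = (\<Sum>i\<in>UNIV. partial k (\<lambda>x. x $ i * partial i u x) x)"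
    unfolding euler_def [abs_def]
    by (intro partial_Cc_sum Cc_inf_H_nth_mult Cc_inf_H_partial u)
  also have "\<dots> = (\<Sum>i\<in>UNIV. (if k = i then partial i u x else 0)) + (\<Sum>i\<in>UNIV. x $ i * partial k (partial i u) x)"
    by (simp add: partial_Cc_mult[OF Cc_inf_H_partial[OF u]] sum.distrib)
  finally show ?thesis by simp
qed

lemma Cc_inf_H_partial_commute:
  assumes "u \<in> Cc_inf_H"
  shows "partial i (partial j u) x = partial j (partial i u) x"
proof (cases "x \<in> hball")
  case True
  then show ?thesis
    using Cc_inf_H_smooth[OF assms] by (intro partial_commute[of hball]) (auto simp: smooth_on_def)
next
  case False
  obtain R where R: "0 < R" "R < 1" "\<And>x. norm x > R \<Longrightarrow> u x = 0"
    using Cc_inf_H_support[OF assms] by metis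
  have "norm x > R" using R False by (auto simp: mem_hball)
  then show ?thesis
    using partial_zero_outside[of R] R(3) by metis
qed

text \<open>Rotations commute with dilations. In coordinates, the first-order terms agree and the
  second-order ones match by symmetry of the Hessian.\<close>

lemma euler_rot_commute:
  assumes u: "u \<in> Cc_inf_H"
  shows "euler (rot i j u) x = rot i j (euler u) x"
proof -
  have "euler (rot i j u) x = (\<Sum>k\<in>UNIV. (if k = i then x $ k * partial j u x else 0)
      + x $ i * (x $ k * partial k (partial j u) x)
      - (if k = j then x $ k * partial i u x else 0) - x $ j * (x $ k * partial k (partial i u) x))"
    unfolding euler_def partial_rot[OF u] by (rule sum.cong) (auto simp: algebra_simps)
  also have "\<dots> = x $ i * partial j u x + x $ i * (\<Sum>k\<in>UNIV. x $ k * partial k (partial j u) x)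
      - x $ j * partial i u x - x $ j * (\<Sum>k\<in>UNIV. x $ k * partial k (partial i u) x)"
    by (simp add: sum.distrib sum_subtractf sum_distrib_left)
  also have "\<dots> = rot i j (euler u) x"
    unfolding rot_def partial_euler[OF u] Cc_inf_H_partial_commute[OF u, of j] Cc_inf_H_partial_commute[OF u, of i]
    by (simp add: algebra_simps)
  finally show ?thesis .
qed

lemma norm_sq_sum: "(norm (x::real^'n))\<^sup>2 = (\<Sum>i\<in>UNIV. (x $ i)\<^sup>2)"
  by (simp add: norm_vec_def L2_set_def sum_nonneg)

text \<open>An operator form of Lagrange's identity \<open>|x|\<^sup>2 |\<xi>|\<^sup>2 = (x
  \<bullet> \<xi>)\<^sup>2 + (1/2) \<Sum> (x\<^sub>i \<xi>\<^sub>j - x\<^sub>j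
  \<xi>\<^sub>i)\<^sup>2\<close>; the coefficient \<open>N - 2\<close> collects the first-order
  terms of the squared fields.\<close>

lemma laplacian_decomposition:
  fixes u :: "real^'n \<Rightarrow> real"
  assumes u: "u \<in> Cc_inf_H"
  shows "(norm x)\<^sup>2 * eucl_laplacian u x = euler (euler u) x + (real CARD('n) - 2) * euler u x
    + (\<Sum>i\<in>UNIV. \<Sum>j\<in>UNIV. rot i j (rot i j u) x) / 2"
proof -
  define H where "H i j = partial i (partial j u) x" for i j
  define p where "p i = partial i u x" for i
  have E2: "euler (euler u) x = euler u x + (\<Sum>i\<in>UNIV. \<Sum>j\<in>UNIV. x $ i * x $ j * H i j)"
    unfolding euler_def[of "euler u"] partial_euler[OF u]
    by (simp add: euler_def H_def distrib_left sum.distrib sum_distrib_left mult.assoc)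
  \<comment> \<open>The term for \<open>i = j\<close> makes one formula serve the diagonal too,
    where both sides vanish.\<close>
  have r: "rot i j (rot i j u) x = (if i = j then 2 * (x $ i * p i) else 0) + (x $ i)\<^sup>2 * H j j + (x $ j)\<^sup>2 * H i i
     - x $ i * x $ j * H j i - x $ j * x $ i * H i j - x $ i * p i - x $ j * p j" for i j
    unfolding rot_def[of i j "rot i j u"] partial_rot[OF u]
    by (auto simp: H_def p_def algebra_simps power2_eq_square)
  have s1: "(\<Sum>i\<in>UNIV. \<Sum>j\<in>UNIV. (if i = j then 2 * (x $ i * p i) else 0)) = 2 * euler u x"
    by (simp add: euler_def p_def sum_distrib_left)
  have s2: "(\<Sum>i\<in>UNIV. \<Sum>j\<in>UNIV. (x $ i)\<^sup>2 * H j j) = (norm x)\<^sup>2 * eucl_laplacian u x"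
    by (simp add: norm_sq_sum eucl_laplacian_def H_def sum_product)
  have s3: "(\<Sum>i\<in>UNIV. \<Sum>j\<in>UNIV. (x $ j)\<^sup>2 * H i i) = (norm x)\<^sup>2 * eucl_laplacian u x"
    by (subst sum.swap) (rule s2)
  have s4: "(\<Sum>i\<in>UNIV. \<Sum>j\<in>UNIV. x $ i * x $ j * H j i) = (\<Sum>i\<in>UNIV. \<Sum>j\<in>UNIV. x $ i * x $ j * H i j)"
    by (subst sum.swap) (simp add: ac_simps)
  have s5: "(\<Sum>i\<in>UNIV. \<Sum>j\<in>UNIV. x $ j * x $ i * H i j) = (\<Sum>i\<in>UNIV. \<Sum>j\<in>UNIV. x $ i * x $ j * H i j)"
    by (simp add: ac_simps)
  have s6: "(\<Sum>i\<in>(UNIV::'n set). \<Sum>j\<in>(UNIV::'n set). x $ i * p i) = real CARD('n) * euler u x"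
    by (simp add: euler_def p_def sum_distrib_left)
  have s7: "(\<Sum>i\<in>(UNIV::'n set). \<Sum>j\<in>(UNIV::'n set). x $ j * p j) = real CARD('n) * euler u x"
    by (simp add: euler_def p_def)
  show ?thesis
    unfolding r sum.distrib sum_subtractf s1 s2 s3 s4 s5 s6 s7 E2
    by (simp add: algebra_simps add_divide_distrib diff_divide_distrib)
qed

text \<open>The factor is \<open>sinh\<^sup>2 r\<close>. It cancels the conformal factor in front of
  the Euclidean Laplacian up to \<open>|x|\<^sup>2\<close>, and the two first-order coefficients add
  up because \<open>1 + 2 q / (1 - q) = cosh r\<close> for \<open>q = |x|\<^sup>2\<close>.\<close>

lemma hyp_laplacian_decomposition:
  fixes u :: "real^'n \<Rightarrow> real"
  assumes u: "u \<in> Cc_inf_H" and x: "x \<in> hball"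
  shows "(2 * norm x / (1 - (norm x)\<^sup>2))\<^sup>2 * hyp_laplacian u x = euler (euler u) x
    + (real CARD('n) - 2) * ((1 + (norm x)\<^sup>2) / (1 - (norm x)\<^sup>2)) * euler u x
    + (\<Sum>i\<in>UNIV. \<Sum>j\<in>UNIV. rot i j (rot i j u) x) / 2"
proof -
  define q where "q = (norm x)\<^sup>2"
  define N where "N = real CARD('n)"
  define L Z where "L = eucl_laplacian u x" and "Z = (\<Sum>i\<in>UNIV. \<Sum>j\<in>UNIV. rot i j (rot i j u) x) / 2"
  have "q < 1" using x by (simp add: q_def mem_hball abs_square_less_1)
  have e: "q * L = euler (euler u) x + (N - 2) * euler u x + Z"
    using laplacian_decomposition[OF u, of x] by (simp add: q_def L_def Z_def N_def)
  have "(2 * norm x / (1 - q))\<^sup>2 * hyp_laplacian u x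
     = 4 * q / (1 - q)\<^sup>2 * (((1 - q) / 2)\<^sup>2 * L + (N - 2) * ((1 - q) / 2) * euler u x)"
    by (simp add: hyp_laplacian_def euler_def q_def L_def N_def power_divide power_mult_distrib)
  also have "\<dots> = q * L + (N - 2) * (2 * q / (1 - q)) * euler u x"
    using \<open>q < 1\<close> by (simp add: distrib_left power_divide) (simp add: power2_eq_square)
  also have "\<dots> = euler (euler u) x + (N - 2) * (1 + 2 * q / (1 - q)) * euler u x + Z"
    unfolding e by (simp add: algebra_simps)
  also have "1 + 2 * q / (1 - q) = (1 + q) / (1 - q)"
    using \<open>q < 1\<close> by (simp add: field_simps)
  finally show ?thesis by (simp add: q_def N_def Z_def)
qed

section \<open>Integration by parts\<close>

text \<open>Dyadic shells: where \<open>2\<^sup>-\<^sup>k\<^sup>-\<^sup>1 \<le> |x| <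
  2\<^sup>-\<^sup>k\<close> the weight is at most \<open>2 ^ ((k+1)*(N-1))\<close>, while the ball
  of radius \<open>2\<^sup>-\<^sup>k\<close> has volume of order
  \<open>2\<^sup>-\<^sup>k\<^sup>N\<close>; the products form a geometric series.\<close>

lemma integrable_norm_weight:
  "integrable lborel (\<lambda>x::real^'n. indicator (ball 0 1) x * (norm x / norm x ^ CARD('n)))"
proof (rule integrableI_nonneg)
  define N where "N = CARD('n)"
  have N: "N > 0" by (simp add: N_def)
  define V where "V = unit_ball_vol (real N)"
  define f where "f k x = ennreal (2 ^ ((k+1)*(N-1))) * indicator (ball 0 ((1/2)^k)) x" for k and x :: "real^'n"
  show "AE x::real^'n in lborel. 0 \<le> indicator (ball 0 1) x * (norm x / norm x ^ CARD('n))"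
    by simp
  have le: "ennreal (indicator (ball 0 1) x * (norm x / norm x ^ N)) \<le> (\<Sum>k. f k x)" for x :: "real^'n"
  proof (cases "x \<in> ball 0 1 \<and> x \<noteq> 0")
    case True
    then have x: "0 < norm x" "norm x < 1" by auto
    \<comment> \<open>The least \<open>k\<close> with \<open>P k\<close> locates the shell of
      \<open>x\<close>. It is positive because \<open>norm x < 1\<close>, so its predecessor
      violates \<open>P\<close>.\<close>
    define P where "P k \<longleftrightarrow> (1/2)^k \<le> norm x" for k :: nat
    have "\<exists>k. P k"
      using real_arch_pow_inv[of "norm x" "1/2"] x by (auto simp: P_def intro: less_imp_le)
    then have P: "P (LEAST k. P k)" by (rule LeastI_ex)
    have "(LEAST k. P k) \<noteq> 0"
    proof
      assume "(LEAST k. P k) = 0"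
      with P have "P 0" by simp
      with x show False by (simp add: P_def)
    qed
    then obtain k where k: "(LEAST k. P k) = Suc k" using not0_implies_Suc by blast
    have Pk: "P (Suc k)" "\<not> P k"
      using P k not_less_Least[of k P] by auto
    have "norm x / norm x ^ N = 1 / norm x ^ (N - 1)"
      using x N by (cases N) (auto simp: field_simps)
    also have "\<dots> \<le> 1 / ((1/2) ^ (k+1)) ^ (N - 1)"
      using Pk(1) x by (intro divide_left_mono power_mono mult_pos_pos) (auto simp: P_def)
    also have "\<dots> = 2 ^ ((k+1)*(N-1))"
      by (simp add: power_one_over power_add power_mult)
    finally have "ennreal (indicator (ball 0 1) x * (norm x / norm x ^ N)) \<le> ennreal (2 ^ ((k+1)*(N-1)))"
      using True by (intro ennreal_leI) simp
    also have "\<dots> = f k x"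
      using Pk(2) by (simp add: f_def P_def)
    also have "\<dots> \<le> (\<Sum>k. f k x)"
      using sum_le_suminf[of "\<lambda>k. f k x" "{k}"] by simp
    finally show ?thesis .
  next
    case False
    then show ?thesis by (auto simp: indicator_def)
  qed
  have "(\<integral>\<^sup>+x. ennreal (indicator (ball 0 1) x * (norm x / norm x ^ N)) \<partial>(lborel :: (real^'n) measure)) \<le> (\<integral>\<^sup>+x. (\<Sum>k. f k x) \<partial>lborel)"
    by (intro nn_integral_mono le)
  also have "\<dots> = (\<Sum>k. \<integral>\<^sup>+x. f k x \<partial>lborel)"
    unfolding f_def
    by (intro nn_integral_suminf borel_measurable_times_ennreal borel_measurable_const borel_measurable_indicator) auto
  also have "\<dots> = (\<Sum>k. ennreal (2 ^ (N-1) * V * (1/2)^k))"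
  proof (intro suminf_cong)
    fix k
    have "(\<integral>\<^sup>+x. f k x \<partial>lborel) = ennreal (2 ^ ((k+1)*(N-1))) * emeasure lborel (ball (0::real^'n) ((1/2)^k))"
      unfolding f_def by (intro nn_integral_cmult_indicator) simp
    also have "\<dots> = ennreal (2 ^ ((k+1)*(N-1)) * (V * ((1/2)^k)^N))"
      by (simp add: emeasure_ball V_def N_def ennreal_mult)
    also have "2 ^ ((k+1)*(N-1)) * (V * ((1/2)^k)^N) = 2 ^ (N-1) * V * ((2 ^ k) ^ (N-1) * ((1/2)^k)^N)"
      by (simp add: power_add power_mult mult.assoc)
    also have "(2 ^ k) ^ (N-1) * ((1/2)^k)^N = (1/2::real)^k"
      using N by (cases N) (auto simp: power_mult_distrib[symmetric] power_one_over)
    finally show "(\<integral>\<^sup>+x. f k x \<partial>lborel) = ennreal (2 ^ (N-1) * V * (1/2)^k)" .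
  qed
  also have "\<dots> = ennreal (\<Sum>k. 2 ^ (N-1) * V * (1/2)^k)"
    by (intro suminf_ennreal2 summable_mult summable_geometric) (auto simp: V_def)
  also have "\<dots> < \<infinity>" by simp
  finally show "(\<integral>\<^sup>+x. ennreal (indicator (ball 0 1) x * (norm x / norm x ^ CARD('n))) \<partial>(lborel :: (real^'n) measure)) < \<infinity>"
    by (simp add: N_def)
  have [measurable]: "ball 0 1 \<in> sets (borel :: (real^'n) measure)" by simp
  show "(\<lambda>x::real^'n. indicator (ball 0 1) x * (norm x / norm x ^ CARD('n))) \<in> borel_measurable lborel"
    by measurable
qed

text \<open>Linear decay at the origin gains the one power of \<open>norm x\<close> that makes the
  singular weight integrable.\<close>

lemma integrable_over_norm_power:
  fixes g :: "real^'n \<Rightarrow> real"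
  assumes [measurable]: "g \<in> borel_measurable borel" and "\<And>x. \<bar>g x\<bar> \<le> C * norm x" "\<And>x. norm x \<ge> 1 \<Longrightarrow> g x = 0"
  shows "integrable lborel (\<lambda>x. g x / norm x ^ CARD('n))"
proof (rule Bochner_Integration.integrable_bound)
  show "integrable lborel (\<lambda>x::real^'n. C * (indicator (ball 0 1) x * (norm x / norm x ^ CARD('n))))"
    by (intro integrable_mult_right integrable_norm_weight)
  have "norm (g x / norm x ^ CARD('n)) \<le> norm (C * (indicator (ball 0 1) x * (norm x / norm x ^ CARD('n))))" for x
  proof (cases "norm x < 1")
    case True
    have "\<bar>g x\<bar> \<le> \<bar>C * norm x\<bar>" using assms(2)[of x] by linarith
    then show ?thesis using True by (simp add: abs_mult divide_right_mono)
  qed (simp add: assms(3))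
  then show "AE x in lborel. norm (g x / norm x ^ CARD('n)) \<le> norm (C * (indicator (ball 0 1) x * (norm x / norm x ^ CARD('n))))"
    by simp
qed simp

lemma integral_dilation:
  fixes g :: "real^'n \<Rightarrow> real"
  assumes [measurable]: "g \<in> borel_measurable borel" and "k > 0"
  shows "(\<integral>x. g (k *\<^sub>R x) / norm x ^ CARD('n) \<partial>lborel) = (\<integral>x. g x / norm x ^ CARD('n) \<partial>lborel)"
proof -
  have "(\<integral>x. g x / norm x ^ CARD('n) \<partial>lborel)
      = (\<integral>x. g x / norm x ^ CARD('n) \<partial>density (distr lborel borel (\<lambda>x. 0 + k *\<^sub>R x)) (\<lambda>_. \<bar>k\<bar>^DIM(real^'n)))"
    using assms(2) lborel_affine[of k "0::real^'n"] by simp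
  also have "\<dots> = (\<integral>x. k ^ CARD('n) * (g x / norm x ^ CARD('n)) \<partial>distr lborel borel (\<lambda>x. k *\<^sub>R x))"
    using assms(2) by (subst integral_density) auto
  also have "\<dots> = (\<integral>x. k ^ CARD('n) * (g (k *\<^sub>R x) / norm (k *\<^sub>R x) ^ CARD('n)) \<partial>lborel)"
    by (subst integral_distr) auto
  also have "\<dots> = (\<integral>x. g (k *\<^sub>R x) / norm x ^ CARD('n) \<partial>lborel)"
    using assms(2) by (simp add: power_mult_distrib)
  finally show ?thesis by simp
qed

text \<open>The measure \<open>dx / |x|\<^sup>N\<close> is invariant under dilations; differentiating the dilated integral
  at scale one gives the radial integration by parts formula.\<close>

lemma integral_radial_derivative:
  fixes g h :: "real^'n \<Rightarrow> real"
  assumes [measurable]: "g \<in> borel_measurable borel" "h \<in> borel_measurable borel"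
    and d: "\<And>x. x \<noteq> 0 \<Longrightarrow> ((\<lambda>k. g (k *\<^sub>R x)) has_real_derivative h x) (at 1)"
    and g: "\<And>x. \<bar>g x\<bar> \<le> C * norm x" and h: "\<And>x. \<bar>h x\<bar> \<le> C * norm x"
    and g0: "\<And>x. norm x \<ge> 1 \<Longrightarrow> g x = 0" 
  shows "(\<integral>x. h x / norm x ^ CARD('n) \<partial>lborel) = 0"
proof -
  define N where "N = CARD('n)"
  \<comment> \<open>Difference quotients with dilation factors above 1: they shrink the support, so
    every \<open>F n\<close> vanishes for \<open>norm x \<ge> 1\<close>.\<close>
  define F where "F n x = (g ((1 + 1 / Suc n) *\<^sub>R x) - g x) * Suc n / norm x ^ N" for n :: nat and x
  have dk: "((\<lambda>k. g (k *\<^sub>R x)) has_real_derivative h (k *\<^sub>R x) / k) (at k)" if "x \<noteq> 0" "k > 0" for x k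
  proof -
    have "((\<lambda>l. g (l *\<^sub>R (k *\<^sub>R x))) has_real_derivative h (k *\<^sub>R x)) (at (k / k))"
      using d[of "k *\<^sub>R x"] that by simp
    moreover have "((\<lambda>l. l / k) has_real_derivative 1 / k) (at k)"
      using that by (auto intro!: derivative_eq_intros)
    ultimately have "((\<lambda>l. g ((l / k) *\<^sub>R (k *\<^sub>R x))) has_real_derivative h (k *\<^sub>R x) * (1 / k)) (at k)"
      by (rule DERIV_chain2)
    then show ?thesis using that by simp
  qed
  have C0: "C \<ge> 0"
    using h[of "axis undefined 1"] by auto
  \<comment> \<open>The mean value theorem turns the quotient into
    \<open>h (z *\<^sub>R x) / z\<close> with \<open>z > 1\<close>; the linear bound on
    \<open>h\<close> supplies a factor \<open>z\<close> that cancels.\<close>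
  have bound: "norm (F n x) \<le> C * (indicator (ball 0 1) x * (norm x / norm x ^ N))" for n x
  proof (cases "x \<noteq> 0 \<and> norm x < 1")
    case True
    have "\<exists>z. 1 < z \<and> z < 1 + 1 / Suc n \<and> g ((1 + 1 / Suc n) *\<^sub>R x) - g (1 *\<^sub>R x) = (1 + 1 / Suc n - 1) * (h (z *\<^sub>R x) / z)"
      using True by (intro MVT2 dk) auto
    then obtain z where z: "1 < z" "g ((1 + 1 / Suc n) *\<^sub>R x) - g x = (1 / Suc n) * (h (z *\<^sub>R x) / z)"
      by auto
    have "\<bar>(g ((1 + 1 / Suc n) *\<^sub>R x) - g x) * Suc n\<bar> = \<bar>h (z *\<^sub>R x)\<bar> / z"
      using z by (simp add: abs_mult)
    also have "\<dots> \<le> C * norm x"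
      using h[of "z *\<^sub>R x"] z(1) by (simp add: divide_le_eq mult_ac)
    finally have "norm (F n x) \<le> C * norm x / norm x ^ N"
      unfolding F_def by (simp add: divide_right_mono)
    then show ?thesis using True by simp
  next
    case False
    then consider "x = 0" | "norm x \<ge> 1" by fastforce
    then show ?thesis
    proof cases
      case 1 then show ?thesis by (simp add: F_def)
    next
      case 2
      have "norm ((1 + 1 / Suc n) *\<^sub>R x) \<ge> 1 * 1"
        unfolding norm_scaleR by (intro mult_mono) (use 2 in auto)
      then show ?thesis using 2 by (simp add: F_def g0)
    qed
  qed
  have int0: "integrable lborel (\<lambda>x. g x / norm x ^ N)"
    unfolding N_def by (intro integrable_over_norm_power[of _ C] g g0) simp
  have intk: "integrable lborel (\<lambda>x. g ((1 + 1 / Suc n) *\<^sub>R x) / norm x ^ N)" for n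
    unfolding N_def
  proof (intro integrable_over_norm_power)
    show "\<bar>g ((1 + 1 / Suc n) *\<^sub>R x)\<bar> \<le> C * (1 + 1 / Suc n) * norm x" for x
      using g[of "(1 + 1 / Suc n) *\<^sub>R x"] by (simp add: mult_ac)
    show "g ((1 + 1 / Suc n) *\<^sub>R x) = 0" if "norm x \<ge> 1" for x
    proof (rule g0)
      have "norm ((1 + 1 / Suc n) *\<^sub>R x) \<ge> 1 * 1"
        unfolding norm_scaleR by (intro mult_mono) (use that in auto)
      then show "norm ((1 + 1 / Suc n) *\<^sub>R x) \<ge> 1" by simp
    qed
  qed simp
  have F0: "(\<integral>x. F n x \<partial>lborel) = 0" for n
  proof -
    have "F n x = Suc n * (g ((1 + 1 / Suc n) *\<^sub>R x) / norm x ^ N - g x / norm x ^ N)" for x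
      unfolding F_def by (simp only: diff_divide_distrib[symmetric] times_divide_eq_right mult.commute)
    then have "(\<integral>x. F n x \<partial>lborel) = Suc n * ((\<integral>x. g ((1 + 1 / Suc n) *\<^sub>R x) / norm x ^ N \<partial>lborel) - (\<integral>x. g x / norm x ^ N \<partial>lborel))"
      using int0 intk[of n] by simp
    also have "\<dots> = 0"
      unfolding N_def by (subst integral_dilation) (auto simp: add_pos_pos)
    finally show ?thesis .
  qed
  have "(\<lambda>n. \<integral>x. F n x \<partial>lborel) \<longlonglongrightarrow> (\<integral>x. h x / norm x ^ N \<partial>lborel)"
  proof (rule integral_dominated_convergence[where w = "\<lambda>x. C * (indicator (ball 0 1) x * (norm x / norm x ^ N))"])
    show "integrable lborel (\<lambda>x::real^'n. C * (indicator (ball 0 1) x * (norm x / norm x ^ N)))"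
      unfolding N_def by (intro integrable_mult_right integrable_norm_weight)
    show "AE x in lborel. (\<lambda>n. F n x) \<longlonglongrightarrow> h x / norm x ^ N"
    proof (rule AE_I2)
      fix x
      show "(\<lambda>n. F n x) \<longlonglongrightarrow> h x / norm x ^ N"
      proof (cases "x = 0")
        case True
        then show ?thesis using h[of 0] by (simp add: F_def)
      next
        case False
        have "((\<lambda>t. (g ((1 + t) *\<^sub>R x) - g (1 *\<^sub>R x)) / t) \<longlongrightarrow> h x) (at 0)"
          using d[OF False] unfolding DERIV_def .
        moreover have "filterlim (\<lambda>n. 1 / real (Suc n)) (at 0) sequentially"
          unfolding filterlim_at using LIMSEQ_inverse_real_of_nat by (auto simp: inverse_eq_divide)
        ultimately have "(\<lambda>n. (g ((1 + 1 / real (Suc n)) *\<^sub>R x) - g (1 *\<^sub>R x)) / (1 / real (Suc n))) \<longlonglongrightarrow> h x"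
          by (rule filterlim_compose)
        then have "(\<lambda>n. (g ((1 + 1 / real (Suc n)) *\<^sub>R x) - g (1 *\<^sub>R x)) / (1 / real (Suc n)) / norm x ^ N) \<longlonglongrightarrow> h x / norm x ^ N"
          by (intro tendsto_divide tendsto_const) (use False in auto)
        then show ?thesis by (simp add: F_def)
      qed
    qed
    show "F n \<in> borel_measurable lborel" for n
      unfolding F_def[abs_def] by measurable
    show "AE x in lborel. norm (F n x) \<le> C * (indicator (ball 0 1) x * (norm x / norm x ^ N))" for n
      using bound by simp
  qed simp
  then show ?thesis
    unfolding F0 N_def by (simp add: LIMSEQ_const_iff)
qed

lemma Cc_inf_H_integrable:
  fixes f :: "real^'n \<Rightarrow> real"
  assumes "f \<in> Cc_inf_H"
  shows "integrable lborel f"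
proof -
  have [measurable]: "f \<in> borel_measurable borel"
    by (rule Cc_inf_H_measurable[OF assms])
  obtain B where B: "B \<ge> 0" "\<And>x. \<bar>f x\<bar> \<le> B"
    using Cc_inf_H_bounded[OF assms] by metis
  obtain R where R: "0 < R" "R < 1" "\<And>x. norm x > R \<Longrightarrow> f x = 0"
    using Cc_inf_H_support[OF assms] by metis
  show ?thesis
  proof (rule Bochner_Integration.integrable_bound)
    show "integrable lborel (\<lambda>x::real^'n. B * indicator (cball 0 1) x)"
      by (intro integrable_mult_right integrable_real_indicator) (auto simp: emeasure_cball)
    have "norm (f x) \<le> norm (B * indicator (cball 0 1) x)" for x
    proof (cases "norm x \<le> 1")
      case True
      then show ?thesis using B by simp
    next
      case False
      then have "f x = 0" using R by (intro R(3)) linarith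
      then show ?thesis by simp
    qed
    then show "AE x in lborel. norm (f x) \<le> norm (B * indicator (cball 0 1) x)"
      by simp
  qed simp
qed

text \<open>Translation invariance makes the integral of every difference quotient vanish; dominated
  convergence passes this to the derivative.\<close>

lemma integral_partial_eq_0:
  fixes f :: "real^'n \<Rightarrow> real"
  assumes f: "f \<in> Cc_inf_H"
  shows "(\<integral>x. partial i f x \<partial>lborel) = 0"
proof -
  have [measurable]: "f \<in> borel_measurable borel" "partial i f \<in> borel_measurable borel"
    using f by (auto intro: Cc_inf_H_measurable Cc_inf_H_partial)
  define e :: "real^'n" where "e = axis i 1"
  define F where "F n x = (f (x + (1 / Suc n) *\<^sub>R e) - f x) * Suc n" for n :: nat and x
  obtain B where B: "B \<ge> 0" "\<And>x. \<bar>partial i f x\<bar> \<le> B"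
    using Cc_inf_H_bounded[OF Cc_inf_H_partial[OF f]] by metis
  obtain R where R: "0 < R" "R < 1" "\<And>x. norm x > R \<Longrightarrow> f x = 0"
    using Cc_inf_H_support[OF f] by metis
  have D: "((\<lambda>t. f (x + t *\<^sub>R e)) has_real_derivative partial i f (x + s *\<^sub>R e)) (at s)" for x s
    unfolding e_def using Cc_inf_H_has_derivative[OF f]
    by (intro partial_DERIV) (auto simp: differentiable_def)
  \<comment> \<open>Steps have length at most 1 and the support lies in the unit ball, so all
    quotients live on \<open>cball 0 2\<close>.\<close>
  have bound: "norm (F n x) \<le> B * indicator (cball 0 2) x" for n x
  proof (cases "norm x \<le> 2")
    case True
    have "\<exists>z. 0 < z \<and> z < 1 / Suc n \<and> f (x + (1 / Suc n) *\<^sub>R e) - f (x + 0 *\<^sub>R e) = (1 / Suc n - 0) * partial i f (x + z *\<^sub>R e)"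
      by (intro MVT2 D) auto
    then obtain z where "f (x + (1 / Suc n) *\<^sub>R e) - f x = (1 / Suc n) * partial i f (x + z *\<^sub>R e)"
      by auto
    then have "F n x = partial i f (x + z *\<^sub>R e)"
      by (simp add: F_def)
    then show ?thesis using B True by simp
  next
    case False
    have "norm x \<le> norm (x + (1 / Suc n) *\<^sub>R e) + norm ((1 / Suc n) *\<^sub>R e)"
      using norm_triangle_ineq4[of "x + (1 / Suc n) *\<^sub>R e" "(1 / Suc n) *\<^sub>R e"] by simp
    moreover have "norm ((1 / Suc n) *\<^sub>R e) \<le> 1"
      by (simp add: e_def)
    ultimately have "norm (x + (1 / Suc n) *\<^sub>R e) > R" "norm x > R"
      using False R(2) by linarith+
    then show ?thesis using False by (simp add: F_def R(3))
  qed
  have tr: "integrable lborel (\<lambda>x. f (x + a))" "(\<integral>x. f (x + a) \<partial>lborel) = (\<integral>x. f x \<partial>lborel)" for a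
  proof -
    have "integrable (distr lborel borel (\<lambda>x. a + x)) f"
      using Cc_inf_H_integrable[OF f] lborel_distr_plus[of a] by simp
    then show "integrable lborel (\<lambda>x. f (x + a))"
      by (subst (asm) integrable_distr_eq) (auto simp: add.commute)
    have "(\<integral>x. f x \<partial>lborel) = (\<integral>x. f x \<partial>distr lborel borel (\<lambda>x. a + x))"
      using lborel_distr_plus[of a] by simp
    also have "\<dots> = (\<integral>x. f (a + x) \<partial>lborel)"
      by (subst integral_distr) auto
    finally show "(\<integral>x. f (x + a) \<partial>lborel) = (\<integral>x. f x \<partial>lborel)"
      by (simp add: add.commute)
  qed
  have F0: "(\<integral>x. F n x \<partial>lborel) = 0" for n
    unfolding F_def using tr Cc_inf_H_integrable[OF f] by simp
  have "(\<lambda>n. \<integral>x. F n x \<partial>lborel) \<longlonglongrightarrow> (\<integral>x. partial i f x \<partial>lborel)"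
  proof (rule integral_dominated_convergence[where w = "\<lambda>x. B * indicator (cball 0 2) x"])
    show "integrable lborel (\<lambda>x::real^'n. B * indicator (cball 0 2) x)"
      by (intro integrable_mult_right integrable_real_indicator) (auto simp: emeasure_cball)
    show "AE x in lborel. (\<lambda>n. F n x) \<longlonglongrightarrow> partial i f x"
    proof (rule AE_I2)
      fix x
      have "((\<lambda>t. (f (x + (0 + t) *\<^sub>R e) - f (x + 0 *\<^sub>R e)) / t) \<longlongrightarrow> partial i f (x + 0 *\<^sub>R e)) (at 0)"
        using D[of x 0] unfolding DERIV_def .
      moreover have "filterlim (\<lambda>n. 1 / real (Suc n)) (at 0) sequentially"
        unfolding filterlim_at using LIMSEQ_inverse_real_of_nat by (auto simp: inverse_eq_divide)
      ultimately have "(\<lambda>n. (f (x + (0 + 1 / real (Suc n)) *\<^sub>R e) - f (x + 0 *\<^sub>R e)) / (1 / real (Suc n))) \<longlonglongrightarrow> partial i f (x + 0 *\<^sub>R e)"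
        by (rule filterlim_compose)
      then show "(\<lambda>n. F n x) \<longlonglongrightarrow> partial i f x"
        by (simp add: F_def)
    qed
    show "F n \<in> borel_measurable lborel" for n
      unfolding F_def[abs_def] by measurable
    show "AE x in lborel. norm (F n x) \<le> B * indicator (cball 0 2) x" for n
      using bound by simp
  qed simp
  then show ?thesis
    unfolding F0 by (simp add: LIMSEQ_const_iff)
qed

text \<open>The rotation field is divergence free, so \<open>rot i j f\<close> is a difference of
  two total derivatives.\<close>

lemma integral_rot_eq_0:
  assumes f: "f \<in> Cc_inf_H"
  shows "(\<integral>x. rot i j f x \<partial>lborel) = 0"
proof -
  have "rot i j f x = partial j (\<lambda>x. x $ i * f x) x - partial i (\<lambda>x. x $ j * f x) x" for x
    unfolding partial_Cc_mult[OF f] rot_def by simp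
  then show ?thesis
    using f by (simp add: integral_partial_eq_0 Cc_inf_H_integrable Cc_inf_H_partial Cc_inf_H_nth_mult)
qed

section \<open>Radial weights\<close>

text \<open>In the ball model these are \<open>sinh r\<close>, \<open>cosh r\<close> and \<open>r\<close>, where \<open>r\<close> is the hyperbolic distance of \<open>x\<close>
  from the centre.\<close>

definition sh :: "real^'n \<Rightarrow> real" where "sh x = 2 * norm x / (1 - (norm x)\<^sup>2)"
definition ch :: "real^'n \<Rightarrow> real" where "ch x = (1 + (norm x)\<^sup>2) / (1 - (norm x)\<^sup>2)"
definition rd :: "real^'n \<Rightarrow> real" where "rd x = arcosh (ch x)"

lemma sh_measurable [measurable]: "sh \<in> borel_measurable borel"
  unfolding sh_def[abs_def] by measurable

lemma ch_measurable [measurable]: "ch \<in> borel_measurable borel"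
  unfolding ch_def[abs_def] by measurable

lemma rd_measurable [measurable]: "rd \<in> borel_measurable borel"
  unfolding rd_def[abs_def] arcosh_def by measurable

lemma ch_sq: "x \<in> hball \<Longrightarrow> (ch x)\<^sup>2 = 1 + (sh x)\<^sup>2"
proof -
  assume "x \<in> hball"
  then have q: "1 - (norm x)\<^sup>2 > 0" by (simp add: mem_hball abs_square_less_1)
  define d where "d = 1 - (norm x)\<^sup>2"
  have "(norm x)\<^sup>2 = 1 - d" by (simp add: d_def)
  then have "ch x = (2 - d) / d" "(sh x)\<^sup>2 = 4 * (1 - d) / d\<^sup>2"
    by (simp_all add: ch_def sh_def power_divide power_mult_distrib)
  then show ?thesis using q unfolding d_def[symmetric]
    by (simp add: power_divide) (simp add: field_simps power2_eq_square)
qed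

lemma ch_ge_1: "x \<in> hball \<Longrightarrow> ch x \<ge> 1"
  by (simp add: ch_def mem_hball abs_square_less_1 le_divide_eq)

lemma sh_nonneg: "x \<in> hball \<Longrightarrow> sh x \<ge> 0"
  by (simp add: sh_def mem_hball abs_square_le_1)

lemma sh_pos: "x \<in> hball \<Longrightarrow> x \<noteq> 0 \<Longrightarrow> sh x > 0"
  by (simp add: sh_def mem_hball abs_square_less_1)

lemma hyp_dist_0: "x \<in> hball \<Longrightarrow> hyp_dist x 0 = rd x"
proof -
  assume "x \<in> hball"
  then have q: "1 - (norm x)\<^sup>2 > 0" by (simp add: mem_hball abs_square_less_1)
  then have "1 + 2 * (norm x)\<^sup>2 / (1 - (norm x)\<^sup>2) = ch x"
    by (simp add: ch_def field_simps)
  then show ?thesis by (simp add: hyp_dist_def rd_def)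
qed

lemma cosh_rd: "x \<in> hball \<Longrightarrow> cosh (rd x) = ch x"
  by (simp add: rd_def ch_ge_1)

lemma sinh_rd: "x \<in> hball \<Longrightarrow> sinh (rd x) = sh x"
  by (simp add: rd_def ch_ge_1 sinh_arcosh_real ch_sq sh_nonneg)

lemma rd_nonneg: "x \<in> hball \<Longrightarrow> rd x \<ge> 0"
  by (simp add: rd_def ch_ge_1)

lemma rd_pos: "x \<in> hball \<Longrightarrow> x \<noteq> 0 \<Longrightarrow> rd x > 0"
  using sinh_rd[of x] sh_pos[of x] rd_nonneg[of x] by (cases "rd x = 0") auto

text \<open>Both follow from \<open>sinh t = t * cosh z\<close> with \<open>0 < z < t\<close>. The
  second one controls \<open>sinh r / r\<close> near the centre.\<close>

lemma sinh_bounds: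
  fixes t :: real
  assumes "t > 0"
  shows "t \<le> sinh t" "sinh t \<le> t * cosh t"
proof -
  have "\<exists>z. 0 < z \<and> z < t \<and> sinh t - sinh 0 = (t - 0) * cosh z"
    using assms by (intro MVT2) (auto intro!: derivative_eq_intros)
  then obtain z where z: "0 < z" "z < t" "sinh t = t * cosh z" by auto
  show "t \<le> sinh t" using z assms cosh_real_ge_1[of z] by simp
  show "sinh t \<le> t * cosh t" using z assms cosh_real_nonneg_le_iff[of z t] by simp
qed

lemma rd_le_sh: "x \<in> hball \<Longrightarrow> rd x \<le> sh x"
  using sinh_bounds(1)[of "rd x"] sinh_rd[of x] rd_nonneg[of x] by (cases "rd x = 0") auto

lemma sh_le_rd_ch: "x \<in> hball \<Longrightarrow> sh x \<le> rd x * ch x"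
  using sinh_bounds(2)[of "rd x"] sinh_rd[of x] cosh_rd[of x] rd_nonneg[of x] by (cases "rd x = 0") auto

section \<open>Derivatives of the radial weights along dilations\<close>

lemma dilation_DERIV_radial:
  assumes "(F has_real_derivative D) (at (norm x))" "x \<noteq> 0"
  shows "((\<lambda>k. F (norm (k *\<^sub>R x))) has_real_derivative D * norm x) (at 1)"
proof -
  have "((\<lambda>k. k * norm x) has_real_derivative norm x) (at 1)"
    by (auto intro!: derivative_eq_intros)
  moreover have "(F has_real_derivative D) (at (1 * norm x))" using assms(1) by simp
  ultimately have "((\<lambda>k. F (k * norm x)) has_real_derivative D * norm x) (at 1)"
    by (intro DERIV_chain2)
  then show ?thesis
    \<comment> \<open>Restricting to \<open>k > 0\<close> removes the absolute value from
      \<open>norm (k *\<^sub>R x)\<close>.\<close>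
    by (rule has_field_derivative_transform_within_open[where S = "{0<..}"]) auto
qed

text \<open>This and the next two facts say that \<open>E = sinh r \<partial>\<^sub>r\<close> sends
  \<open>sinh r\<close>, \<open>cosh r\<close> and \<open>r\<close> to \<open>sinh r cosh r\<close>,
  \<open>sinh\<^sup>2 r\<close> and \<open>sinh r\<close>.\<close>

lemma dilation_DERIV_sh:
  assumes "x \<in> hball" "x \<noteq> 0"
  shows "((\<lambda>k. sh (k *\<^sub>R x)) has_real_derivative sh x * ch x) (at 1)"
proof -
  define t where "t = norm x"
  have t: "0 < t" "1 - t\<^sup>2 > 0" using assms by (auto simp: t_def mem_hball abs_square_less_1)
  have "((\<lambda>t. 2 * t / (1 - t\<^sup>2)) has_real_derivative 2 * (1 + t\<^sup>2) / (1 - t\<^sup>2)\<^sup>2) (at t)"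
    using t by (auto intro!: derivative_eq_intros simp: field_simps power2_eq_square)
  from dilation_DERIV_radial[OF this[unfolded t_def] assms(2)] show ?thesis
    by (simp add: sh_def ch_def power2_eq_square mult_ac)
qed

lemma dilation_DERIV_ch:
  assumes "x \<in> hball" "x \<noteq> 0"
  shows "((\<lambda>k. ch (k *\<^sub>R x)) has_real_derivative (sh x)\<^sup>2) (at 1)"
proof -
  define t where "t = norm x"
  have t: "0 < t" "1 - t\<^sup>2 > 0" using assms by (auto simp: t_def mem_hball abs_square_less_1)
  have "((\<lambda>t. (1 + t\<^sup>2) / (1 - t\<^sup>2)) has_real_derivative 4 * t / (1 - t\<^sup>2)\<^sup>2) (at t)"
    using t by (auto intro!: derivative_eq_intros simp: field_simps power2_eq_square)
  from dilation_DERIV_radial[OF this[unfolded t_def] assms(2)] show ?thesis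
    by (simp add: sh_def ch_def power2_eq_square mult_ac)
qed

lemma dilation_DERIV_rd:
  assumes "x \<in> hball" "x \<noteq> 0"
  shows "((\<lambda>k. rd (k *\<^sub>R x)) has_real_derivative sh x) (at 1)"
proof -
  have "(ch x)\<^sup>2 > 1" using ch_sq[OF assms(1)] sh_pos[OF assms] by simp
  then have c: "ch x > 1" using ch_ge_1[OF assms(1)] by (cases "ch x = 1") auto
  have s: "sqrt ((ch x)\<^sup>2 - 1) = sh x"
    using ch_sq[OF assms(1)] sh_nonneg[OF assms(1)] by simp
  have "(arcosh has_real_derivative 1 / sqrt ((ch x)\<^sup>2 - 1)) (at (ch (1 *\<^sub>R x)))"
    using arcosh_real_has_field_derivative[OF c, of UNIV] by simp
  from DERIV_chain2[OF this dilation_DERIV_ch[OF assms]] show ?thesis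
    using sh_pos[OF assms] unfolding s by (simp add: rd_def power2_eq_square)
qed

text \<open>Monomials in \<open>sinh r\<close>, \<open>cosh r\<close> and \<open>1 / r\<close>.
  Their linear span is closed under \<open>E\<close> and contains every weight of the inequality and
  of its proof.\<close>

definition radmono :: "nat \<Rightarrow> nat \<Rightarrow> nat \<Rightarrow> real^'n \<Rightarrow> real" where
  "radmono a b d x = sh x ^ a * ch x ^ b / rd x ^ d"

lemma radmono_measurable [measurable]: "radmono a b d \<in> borel_measurable borel"
  unfolding radmono_def[abs_def] by measurable

text \<open>\<open>E\<close> applied to the monomial. The truncated difference \<open>b - 1\<close>
  is harmless, since that term carries the factor \<open>b\<close>.\<close>

definition radmono_deriv :: "nat \<Rightarrow> nat \<Rightarrow> nat \<Rightarrow> real^'n \<Rightarrow> real" where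
  "radmono_deriv a b d x = a * radmono a (b + 1) d x + b * radmono (a + 2) (b - 1) d x
     - d * radmono (a + 1) b (d + 1) x"

lemma radmono_deriv_measurable [measurable]: "radmono_deriv a b d \<in> borel_measurable borel"
  unfolding radmono_deriv_def[abs_def] by measurable

lemma dilation_DERIV_radmono:
  assumes "x \<in> hball" "x \<noteq> 0"
  shows "((\<lambda>k. radmono a b d (k *\<^sub>R x)) has_real_derivative radmono_deriv a b d x) (at 1)"
proof -
  note [derivative_intros] = dilation_DERIV_sh[OF assms] dilation_DERIV_ch[OF assms] dilation_DERIV_rd[OF assms]
  have r: "rd x > 0" by (rule rd_pos[OF assms])
  have "((\<lambda>k. radmono a b d (k *\<^sub>R x)) has_real_derivative
     (((a * sh x ^ (a - 1) * (sh x * ch x)) * ch x ^ b + sh x ^ a * (b * ch x ^ (b - 1) * (sh x)\<^sup>2)) * rd x ^ d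
       - sh x ^ a * ch x ^ b * (d * rd x ^ (d - 1) * sh x)) / (rd x ^ d * rd x ^ d)) (at 1)"
    unfolding radmono_def[abs_def] using r
    by (auto intro!: derivative_eq_intros simp: mult_ac)
  moreover have "(((a * sh x ^ (a - 1) * (sh x * ch x)) * ch x ^ b + sh x ^ a * (b * ch x ^ (b - 1) * (sh x)\<^sup>2)) * rd x ^ d
       - sh x ^ a * ch x ^ b * (d * rd x ^ (d - 1) * sh x)) / (rd x ^ d * rd x ^ d) = radmono_deriv a b d x"
  proof -
    have 1: "a * sh x ^ (a - 1) * (sh x * ch x) = a * sh x ^ a * ch x"
      by (cases a) auto
    have 2: "d * rd x ^ (d - 1) * sh x / (rd x ^ d * rd x ^ d) = d * sh x / rd x ^ (d + 1)"
      using r by (cases d) (auto simp: field_simps)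
    have 3: "(X * rd x ^ d - Y * Z) / (rd x ^ d * rd x ^ d) = X / rd x ^ d - Y * (Z / (rd x ^ d * rd x ^ d))" for X Y Z
      using r by (simp add: diff_divide_distrib)
    show ?thesis
      unfolding 1 3 2
      by (simp add: radmono_deriv_def radmono_def add_divide_distrib power_add power2_eq_square mult_ac)
  qed
  ultimately show ?thesis by simp
qed

text \<open>By \<open>sinh r \<le> r cosh r\<close> each factor \<open>1 / r\<close> costs one
  factor \<open>sinh r\<close> and one \<open>cosh r\<close>. With \<open>a \<ge> d + 1\<close> a
  factor \<open>sinh r\<close> survives, and it is linear in \<open>norm x\<close>.\<close>

lemma radmono_bound:
  assumes "0 \<le> R" "R < 1" "a \<ge> d + 1"
  obtains K where "K \<ge> 0" "\<And>x::real^'n. norm x \<le> R \<Longrightarrow> \<bar>radmono a b d x\<bar> \<le> K * norm x"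
proof -
  \<comment> \<open>One constant bounds \<open>sh x / norm x\<close>, \<open>sh x\<close> and
    \<open>ch x\<close> on the ball of radius \<open>R\<close>.\<close>
  define M where "M = 2 / (1 - R\<^sup>2)"
  have R2: "R\<^sup>2 < 1" using assms by (simp add: abs_square_less_1)
  then have M: "M \<ge> 0" by (simp add: M_def)
  have "\<bar>radmono a b d x\<bar> \<le> (M * (M ^ (a - d - 1) * M ^ (b + d))) * norm x" if "norm x \<le> R" for x :: "real^'n"
  proof (cases "x = 0")
    case True
    then show ?thesis using assms by (simp add: radmono_def sh_def)
  next
    case False
    have x: "x \<in> hball" using that assms by (simp add: mem_hball)
    have q: "(norm x)\<^sup>2 \<le> R\<^sup>2" using that by (intro power_mono) auto
    have i: "1 / (1 - (norm x)\<^sup>2) \<le> 1 / (1 - R\<^sup>2)"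
      using q R2 by (intro divide_left_mono mult_pos_pos) auto
    have "norm x * (2 / (1 - (norm x)\<^sup>2)) \<le> norm x * M"
      using i by (intro mult_left_mono) (auto simp: M_def)
    then have s: "sh x \<le> M * norm x" by (simp add: sh_def mult_ac)
    also have "\<dots> \<le> M * 1" using that assms M by (intro mult_left_mono) auto
    finally have s': "sh x \<le> M" by simp
    have "(1 + (norm x)\<^sup>2) * (1 / (1 - (norm x)\<^sup>2)) \<le> 2 * (1 / (1 - R\<^sup>2))"
      using q R2 i by (intro mult_mono) auto
    then have c: "ch x \<le> M" by (simp add: ch_def M_def)
    note p = sh_pos[OF x False] ch_ge_1[OF x] rd_pos[OF x False]
    have a: "sh x ^ a = sh x * sh x ^ (a - d - 1) * sh x ^ d"
      using assms(3) by (simp add: power_add[symmetric] flip: power_Suc)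
    have "sh x / rd x \<le> ch x" using sh_le_rd_ch[OF x] p by (simp add: divide_le_eq mult.commute)
    then have sr: "(sh x / rd x) ^ d \<le> ch x ^ d" using p by (intro power_mono) auto
    have "radmono a b d x = sh x * sh x ^ (a - d - 1) * ch x ^ b * (sh x / rd x) ^ d"
      by (simp add: radmono_def a power_divide mult_ac)
    also have "\<dots> \<le> sh x * sh x ^ (a - d - 1) * ch x ^ b * ch x ^ d"
      using p by (intro mult_left_mono sr) auto
    also have "\<dots> = sh x * (sh x ^ (a - d - 1) * ch x ^ (b + d))"
      by (simp add: power_add mult_ac)
    also have "\<dots> \<le> (M * norm x) * (M ^ (a - d - 1) * M ^ (b + d))"
      using p s s' c M by (intro mult_mono power_mono mult_nonneg_nonneg) auto
    finally have "radmono a b d x \<le> (M * (M ^ (a - d - 1) * M ^ (b + d))) * norm x" by (simp add: mult_ac)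
    moreover have "radmono a b d x \<ge> 0" using p by (simp add: radmono_def)
    ultimately show ?thesis by simp
  qed
  then show thesis using that M by (meson mult_nonneg_nonneg zero_le_power)
qed

lemma Cc_radmono_bound:
  fixes f :: "real^'n \<Rightarrow> real"
  assumes f: "f \<in> Cc_inf_H" and "a \<ge> d + 1"
  obtains K where "K \<ge> 0" "\<And>x. \<bar>f x * radmono a b d x\<bar> \<le> K * norm x"
proof -
  obtain B where B: "B \<ge> 0" "\<And>x. \<bar>f x\<bar> \<le> B"
    using Cc_inf_H_bounded[OF f] by metis
  obtain R where R: "0 < R" "R < 1" "\<And>x. norm x > R \<Longrightarrow> f x = 0"
    using Cc_inf_H_support[OF f] by metis
  obtain K where K: "K \<ge> 0" "\<And>x::real^'n. norm x \<le> R \<Longrightarrow> \<bar>radmono a b d x\<bar> \<le> K * norm x"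
    using radmono_bound[of R d a b] R assms by (metis less_imp_le)
  have "\<bar>f x * radmono a b d x\<bar> \<le> B * K * norm x" for x
  proof (cases "norm x \<le> R")
    case True
    have "\<bar>f x\<bar> * \<bar>radmono a b d x\<bar> \<le> B * (K * norm x)"
      using B K True by (intro mult_mono) auto
    then show ?thesis by (simp add: abs_mult mult_ac)
  qed (use R B K in auto)
  then show thesis using that B K by (metis mult_nonneg_nonneg)
qed

lemma Cc_vanish: 
  assumes "f \<in> Cc_inf_H" "norm x \<ge> 1" shows "f x = 0"
proof -
  obtain R where R: "R < 1" "\<And>x. norm x > R \<Longrightarrow> f x = 0"
    using Cc_inf_H_support[OF assms(1)] by metis
  show ?thesis using assms(2) R(1) by (intro R(2)) linarith
qed

lemma integrable_radmono:
  fixes f :: "real^'n \<Rightarrow> real"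
  assumes f: "f \<in> Cc_inf_H" and "a \<ge> d + 1"
  shows "integrable lborel (\<lambda>x. f x * radmono a b d x / norm x ^ CARD('n))"
proof -
  obtain K where K: "\<And>x. \<bar>f x * radmono a b d x\<bar> \<le> K * norm x"
    using Cc_radmono_bound[OF assms] by metis
  have [measurable]: "f \<in> borel_measurable borel"
    by (rule Cc_inf_H_measurable[OF f])
  show ?thesis
    by (rule integrable_over_norm_power[OF _ K]) (auto simp: Cc_vanish[OF f])
qed

text \<open>\<open>integral_radial_derivative\<close> for the product of \<open>f\<close> with a
  monomial. All three monomials of the derivative satisfy the exponent condition again, so each is
  linearly bounded.\<close>

lemma radial_parts:
  fixes f :: "real^'n \<Rightarrow> real"
  assumes f: "f \<in> Cc_inf_H" and a: "a \<ge> d + 1"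
  shows "integrable lborel (\<lambda>x. (euler f x * radmono a b d x + f x * radmono_deriv a b d x) / norm x ^ CARD('n))"
    and "(\<integral>x. (euler f x * radmono a b d x + f x * radmono_deriv a b d x) / norm x ^ CARD('n) \<partial>lborel) = 0"
proof -
  have E: "euler f \<in> Cc_inf_H" by (rule Cc_inf_H_euler[OF f])
  have [measurable]: "f \<in> borel_measurable borel" "euler f \<in> borel_measurable borel"
    using f E by (auto intro: Cc_inf_H_measurable)
  define h where "h x = euler f x * radmono a b d x + f x * radmono_deriv a b d x" for x
  obtain K0 where K0: "K0 \<ge> 0" "\<And>x. \<bar>f x * radmono a b d x\<bar> \<le> K0 * norm x"
    using Cc_radmono_bound[OF assms] by metis
  obtain K1 where K1: "K1 \<ge> 0" "\<And>x. \<bar>euler f x * radmono a b d x\<bar> \<le> K1 * norm x"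
    using Cc_radmono_bound[OF E a] by metis
  obtain K2 where K2: "K2 \<ge> 0" "\<And>x. \<bar>f x * radmono a (b + 1) d x\<bar> \<le> K2 * norm x"
    using Cc_radmono_bound[OF assms] by metis
  obtain K3 where K3: "K3 \<ge> 0" "\<And>x. \<bar>f x * radmono (a + 2) (b - 1) d x\<bar> \<le> K3 * norm x"
    using Cc_radmono_bound[OF f, of d "a + 2" "b - 1"] a by auto
  obtain K4 where K4: "K4 \<ge> 0" "\<And>x. \<bar>f x * radmono (a + 1) b (d + 1) x\<bar> \<le> K4 * norm x"
    using Cc_radmono_bound[OF f, of "d + 1" "a + 1" b] a by auto
  define C where "C = K0 + K1 + a * K2 + b * K3 + d * K4"
  have hb: "\<bar>h x\<bar> \<le> C * norm x" for x
  proof -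
    have "h x = euler f x * radmono a b d x + a * (f x * radmono a (b + 1) d x) + b * (f x * radmono (a + 2) (b - 1) d x)
        - d * (f x * radmono (a + 1) b (d + 1) x)"
      by (simp add: h_def radmono_deriv_def algebra_simps)
    then have "\<bar>h x\<bar> \<le> \<bar>euler f x * radmono a b d x\<bar> + \<bar>a * (f x * radmono a (b + 1) d x)\<bar> + \<bar>b * (f x * radmono (a + 2) (b - 1) d x)\<bar>
        + \<bar>d * (f x * radmono (a + 1) b (d + 1) x)\<bar>"
      by linarith
    also have "\<dots> = \<bar>euler f x * radmono a b d x\<bar> + a * \<bar>f x * radmono a (b + 1) d x\<bar> + b * \<bar>f x * radmono (a + 2) (b - 1) d x\<bar>
        + d * \<bar>f x * radmono (a + 1) b (d + 1) x\<bar>"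
      by (simp add: abs_mult)
    also have "\<dots> \<le> K1 * norm x + a * (K2 * norm x) + b * (K3 * norm x) + d * (K4 * norm x)"
      by (intro add_mono mult_left_mono K1 K2 K3 K4) auto
    also have "\<dots> \<le> C * norm x"
      using K0(1) by (simp add: C_def algebra_simps)
    finally show ?thesis .
  qed
  have gb: "\<bar>f x * radmono a b d x\<bar> \<le> C * norm x" for x
  proof -
    have "K0 \<le> C" using K1 K2 K3 K4 by (simp add: C_def)
    then have "K0 * norm x \<le> C * norm x" by (rule mult_right_mono) simp
    then show ?thesis using K0(2)[of x] by linarith
  qed
  have d: "((\<lambda>k. f (k *\<^sub>R x) * radmono a b d (k *\<^sub>R x)) has_real_derivative h x) (at 1)" if "x \<noteq> 0" for x
  proof (cases "x \<in> hball")
    case True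
    show ?thesis
      using DERIV_mult[OF euler_DERIV[OF f, of 1 x] dilation_DERIV_radmono[OF True that, of a b d]]
      by (simp add: h_def mult_ac)
  next
    case False
    obtain R where R: "R < 1" "\<And>x. norm x > R \<Longrightarrow> f x = 0"
      using Cc_inf_H_support[OF f] by metis
    have h0: "h x = 0" using False Cc_vanish[OF f] Cc_vanish[OF E] by (simp add: h_def mem_hball)
    \<comment> \<open>On and beyond the sphere the weight has no geometric meaning, but
      \<open>f (k *\<^sub>R x)\<close> vanishes for \<open>k\<close> near 1.\<close>
    have "((\<lambda>k::real. 0::real) has_real_derivative 0) (at 1)" by simp
    then have "((\<lambda>k. f (k *\<^sub>R x) * radmono a b d (k *\<^sub>R x)) has_real_derivative 0) (at 1)"
    proof (rule has_field_derivative_transform_within_open[where S = "{k. norm (k *\<^sub>R x) > R}"])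
      show "open {k. R < norm (k *\<^sub>R x)}"
        by (intro open_Collect_less continuous_intros)
    qed (use R False in \<open>auto simp: mem_hball\<close>)
    then show ?thesis by (simp add: h0)
  qed
  have m: "(\<lambda>x. f x * radmono a b d x) \<in> borel_measurable borel" "h \<in> borel_measurable borel"
    unfolding h_def[abs_def] by measurable
  show "integrable lborel (\<lambda>x. (euler f x * radmono a b d x + f x * radmono_deriv a b d x) / norm x ^ CARD('n))"
    unfolding h_def[symmetric]
    by (rule integrable_over_norm_power[OF m(2) hb]) (simp add: h_def Cc_vanish[OF f] Cc_vanish[OF E])
  show "(\<integral>x. (euler f x * radmono a b d x + f x * radmono_deriv a b d x) / norm x ^ CARD('n) \<partial>lborel) = 0"
    unfolding h_def[symmetric]
    by (rule integral_radial_derivative[OF m d gb hb]) (auto simp: Cc_vanish[OF f])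
qed

text \<open>Rests on \<open>2 / (1 - |x|\<^sup>2) = sh x / |x|\<close>. The integrands may differ at
  the origin, where the right one is 0 by division by zero; that point is a null set.\<close>

lemma hyp_integral_radial:
  fixes f :: "real^'n \<Rightarrow> real"
  assumes [measurable]: "f \<in> borel_measurable borel" and f: "\<And>x. norm x \<ge> 1 \<Longrightarrow> f x = 0"
  shows "hyp_integral f = (\<integral>x. (sh x ^ CARD('n) * f x) / norm x ^ CARD('n) \<partial>lborel)"
  unfolding hyp_integral_def set_lebesgue_integral_def
proof (rule integral_cong_AE)
  have [measurable]: "hball \<in> sets (borel :: (real^'n) measure)" by (simp add: hball_def)
  show "(\<lambda>x. indicat_real hball x *\<^sub>R ((2 / (1 - (norm x)\<^sup>2)) ^ CARD('n) * f x)) \<in> borel_measurable lborel"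
    by measurable
  show "(\<lambda>x. sh x ^ CARD('n) * f x / norm x ^ CARD('n)) \<in> borel_measurable lborel"
    by measurable
  have "indicat_real hball x *\<^sub>R ((2 / (1 - (norm x)\<^sup>2)) ^ CARD('n) * f x) = sh x ^ CARD('n) * f x / norm x ^ CARD('n)"
    if "x \<noteq> 0" for x
    using f[of x] that by (cases "x \<in> hball") (auto simp: mem_hball sh_def power_divide power_mult_distrib)
  then show "AE x in lborel. indicat_real hball x *\<^sub>R ((2 / (1 - (norm x)\<^sup>2)) ^ CARD('n) * f x) = sh x ^ CARD('n) * f x / norm x ^ CARD('n)"
    using AE_lborel_singleton[of "0::real^'n"] by (auto elim: eventually_mono)
qed

section \<open>The inequality for the distance from the centre of the ball\<close>

text \<open>The multiples of powers of \<open>inverse\<close> form the family that is closed under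
  differentiation.\<close>

lemma smooth_on_inverse:
  assumes "open S" "smooth_on S f" "\<And>x. x \<in> S \<Longrightarrow> f x \<noteq> 0"
  shows "smooth_on S (\<lambda>x. inverse (f x))"
proof -
  define G where "G = {g. \<exists>c k. g = (\<lambda>t::real. c * inverse t ^ k)}"
  have "(\<lambda>t. 1 * inverse t ^ 1) \<in> G" unfolding G_def by blast
  then have "inverse \<in> G" by simp
  moreover have "\<exists>g'\<in>G. \<forall>t\<in>- {0}. (g has_real_derivative g' t) (at t)" if "g \<in> G" for g
  proof -
    from that obtain c k where g: "g = (\<lambda>t. c * inverse t ^ k)" by (auto simp: G_def)
    have "(g has_real_derivative (- c * k) * inverse t ^ (k + 1)) (at t)" if "t \<noteq> 0" for t
      unfolding g using DERIV_cmult[OF DERIV_power[OF DERIV_inverse[OF that], of k], of c]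
      by (cases k) (simp_all add: mult_ac)
    moreover have "(\<lambda>t. (- c * k) * inverse t ^ (k + 1)) \<in> G"
      unfolding G_def by blast
    ultimately show ?thesis by (intro bexI[of _ "\<lambda>t. (- c * k) * inverse t ^ (k + 1)"]) auto
  qed
  ultimately show ?thesis
    by (rule smooth_on_compose_real[OF assms(1,2), where U = "- {0}", rotated]) (use assms(3) in auto)
qed

lemma smooth_on_power:
  assumes "open S" "smooth_on S f"
  shows "smooth_on S (\<lambda>x. f x ^ k)"
  by (induction k) (auto intro!: smooth_on_const smooth_on_mult assms)

lemma smooth_on_norm_sq:
  assumes "open S" shows "smooth_on S (\<lambda>x. (norm x)\<^sup>2)"
  unfolding norm_sq_sum by (intro smooth_on_sum smooth_on_power smooth_on_nth assms)

lemma rot_has_derivative: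
  assumes "(f has_derivative f') (at x)"
  shows "rot i j f x = f' (x $ i *\<^sub>R axis j 1 - x $ j *\<^sub>R axis i 1)"
  using has_derivative_linear[OF assms]
  by (simp add: rot_def partial_has_derivative[OF assms] linear_diff linear_scale)

lemma rot_mult:
  assumes "u \<in> Cc_inf_H" "w \<in> Cc_inf_H"
  shows "rot i j (\<lambda>x. u x * w x) x = rot i j u x * w x + u x * rot i j w x"
proof -
  note u = Cc_inf_H_has_derivative[OF assms(1), of x] and w = Cc_inf_H_has_derivative[OF assms(2), of x]
  show ?thesis
    unfolding rot_has_derivative[OF has_derivative_mult[OF u w]] rot_has_derivative[OF u] rot_has_derivative[OF w]
    by simp
qed

text \<open>The gradient of \<open>|x|\<^sup>2\<close> is orthogonal to the direction of rotation.
  The weight is written in \<open>|x|\<^sup>2\<close>, which is smooth at the origin, unlike the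
  norm.\<close>

lemma rot_radial_mult:
  assumes f: "f \<in> Cc_inf_H" and F: "(F has_real_derivative D) (at ((norm x)\<^sup>2))"
  shows "rot i j (\<lambda>x. F ((norm x)\<^sup>2) * f x) x = F ((norm x)\<^sup>2) * rot i j f x"
proof -
  note f' = Cc_inf_H_has_derivative[OF f, of x]
  have "((\<lambda>x. (norm x)\<^sup>2) has_derivative (\<lambda>h. 2 * (x \<bullet> h))) (at x)"
    unfolding power2_norm_eq_inner by (auto intro!: derivative_eq_intros simp: inner_commute)
  from has_derivative_compose[OF this F[unfolded has_field_derivative_def]]
  have "((\<lambda>x. F ((norm x)\<^sup>2)) has_derivative (\<lambda>h. D * (2 * (x \<bullet> h)))) (at x)" .
  from rot_has_derivative[OF has_derivative_mult[OF this f']]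
  show ?thesis
    unfolding rot_has_derivative[OF f'] by (simp add: inner_diff_right inner_axis inner_scaleR_right)
qed

text \<open>The weight is of order \<open>|x|\<^sup>-\<^sup>4\<close> at the origin; \<open>|x|\<^sup>4\<close> is first replaced by the smooth \<open>(|x|\<^sup>2 + \<epsilon>)\<^sup>2\<close>.\<close>

lemma rot_parts:
  fixes f y :: "real^'n \<Rightarrow> real"
  assumes f: "f \<in> Cc_inf_H" and y: "y \<in> Cc_inf_H" and N: "CARD('n) = M + 4" "M \<ge> 1"
  shows "(\<integral>x. (rot i j f x * y x + f x * rot i j y x) * radmono M b 0 x / norm x ^ CARD('n) \<partial>lborel) = 0"
proof -
  define k where "k x = rot i j f x * y x + f x * rot i j y x" for x
  have k: "k \<in> Cc_inf_H"
    unfolding k_def[abs_def] by (intro Cc_inf_H_add Cc_inf_H_mult Cc_inf_H_rot f y)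
  have [measurable]: "k \<in> borel_measurable borel" by (rule Cc_inf_H_measurable[OF k])
  \<comment> \<open>Since \<open>CARD('n) = M + 4\<close>, the quotient
    \<open>sh x ^ M / norm x ^ CARD('n)\<close> equals \<open>(2 / (1 - q)) ^ M / q\<^sup>2\<close>
    with \<open>q = |x|\<^sup>2\<close>; only \<open>1 / q\<close> is regularised.\<close>
  define F where "F n q = (2 * inverse (1 - q)) ^ M * ((1 + q) * inverse (1 - q)) ^ b * (inverse (q + inverse (real (Suc n))))\<^sup>2"
    for n :: nat and q :: real
  have q1: "(norm x)\<^sup>2 < 1" if "x \<in> hball" for x :: "real^'n"
    using that by (simp add: mem_hball abs_square_less_1)
  have qp: "(norm x)\<^sup>2 + inverse (real (Suc n)) > 0" for x :: "real^'n" and n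
    by (intro add_nonneg_pos) auto
  have sF: "smooth_on hball (\<lambda>x::real^'n. F n ((norm x)\<^sup>2))" for n
  proof -
    have 1: "smooth_on hball (\<lambda>x::real^'n. inverse (1 - (norm x)\<^sup>2))"
      by (intro smooth_on_inverse smooth_on_diff smooth_on_const smooth_on_norm_sq open_hball) (use q1 in force)
    have 2: "smooth_on hball (\<lambda>x::real^'n. inverse ((norm x)\<^sup>2 + inverse (real (Suc n))))"
    proof (rule smooth_on_inverse)
      show "(norm x)\<^sup>2 + inverse (real (Suc n)) \<noteq> 0" for x :: "real^'n"
        using qp[of x n] by linarith
    qed (intro smooth_on_add smooth_on_const smooth_on_norm_sq open_hball)+
    have 3: "smooth_on hball (\<lambda>x::real^'n. 1 + (norm x)\<^sup>2)"
      by (intro smooth_on_add smooth_on_const smooth_on_norm_sq open_hball)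
    show ?thesis
      unfolding F_def by (intro smooth_on_mult smooth_on_power smooth_on_const 1 2 3 open_hball)
  qed
  have z: "(\<integral>x. F n ((norm x)\<^sup>2) * k x \<partial>lborel) = 0" for n
  proof -
    have "rot i j (\<lambda>x. F n ((norm x)\<^sup>2) * (f x * y x)) x = F n ((norm x)\<^sup>2) * k x" for x
    proof (cases "x \<in> hball")
      case True
      have "\<exists>D. (F n has_real_derivative D) (at ((norm x)\<^sup>2))"
        unfolding F_def[abs_def] using q1[OF True] qp[of x n]
        by (intro exI) (auto intro!: derivative_eq_intros simp del: of_nat_Suc)
      then obtain D where "(F n has_real_derivative D) (at ((norm x)\<^sup>2))" ..
      from rot_radial_mult[OF Cc_inf_H_mult[OF f y] this] show ?thesis
        by (simp add: rot_mult[OF f y] k_def)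
    next
      case False
      have "(\<lambda>x. F n ((norm x)\<^sup>2) * (f x * y x)) \<in> Cc_inf_H"
        by (intro Cc_inf_H_mult_smooth Cc_inf_H_mult f y sF)
      from Cc_vanish[OF Cc_inf_H_rot[OF this], of x] Cc_vanish[OF k, of x] False show ?thesis
        by (simp add: mem_hball)
    qed
    moreover have "(\<integral>x. rot i j (\<lambda>x. F n ((norm x)\<^sup>2) * (f x * y x)) x \<partial>lborel) = 0"
      by (intro integral_rot_eq_0 Cc_inf_H_mult_smooth Cc_inf_H_mult f y sF)
    ultimately show ?thesis by simp
  qed
  \<comment> \<open>Regularisation enlarges the denominator, so the limit itself is the dominating
    function.\<close>
  have lim: "(\<lambda>n. F n ((norm x)\<^sup>2) * k x) \<longlonglongrightarrow> k x * radmono M b 0 x / norm x ^ CARD('n)"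
    and le: "norm (F n ((norm x)\<^sup>2) * k x) \<le> \<bar>k x * radmono M b 0 x / norm x ^ CARD('n)\<bar>" if "x \<noteq> 0" for x n
  proof -
    have "(\<lambda>n. F n ((norm x)\<^sup>2) * k x) \<longlonglongrightarrow> k x * radmono M b 0 x / norm x ^ CARD('n)
      \<and> norm (F n ((norm x)\<^sup>2) * k x) \<le> \<bar>k x * radmono M b 0 x / norm x ^ CARD('n)\<bar>"
    proof (cases "x \<in> hball")
      case True
      define L where "L = (2 * inverse (1 - (norm x)\<^sup>2)) ^ M * ((1 + (norm x)\<^sup>2) * inverse (1 - (norm x)\<^sup>2)) ^ b"
      have L: "L \<ge> 0" using q1[OF True] by (simp add: L_def)
      have r: "radmono M b 0 x / norm x ^ CARD('n) = L * (inverse ((norm x)\<^sup>2 + 0))\<^sup>2"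
        using that by (simp add: radmono_def N L_def sh_def ch_def power_add power_divide power_mult_distrib field_simps
            flip: power_mult)
      have "(\<lambda>n. L * (inverse ((norm x)\<^sup>2 + inverse (real (Suc n))))\<^sup>2 * k x) \<longlonglongrightarrow> L * (inverse ((norm x)\<^sup>2 + 0))\<^sup>2 * k x"
        by (intro tendsto_intros LIMSEQ_inverse_real_of_nat) (use that in auto)
      moreover have "(inverse ((norm x)\<^sup>2 + inverse (real (Suc n))))\<^sup>2 \<le> (inverse ((norm x)\<^sup>2 + 0))\<^sup>2"
        using that by (intro power_mono le_imp_inverse_le) auto
      then have "L * (inverse ((norm x)\<^sup>2 + inverse (real (Suc n))))\<^sup>2 * \<bar>k x\<bar> \<le> L * (inverse ((norm x)\<^sup>2 + 0))\<^sup>2 * \<bar>k x\<bar>"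
        using L by (intro mult_right_mono mult_left_mono) auto
      moreover have "F n ((norm x)\<^sup>2) = L * (inverse ((norm x)\<^sup>2 + inverse (real (Suc n))))\<^sup>2" for n
        by (simp add: F_def L_def)
      moreover have "k x * radmono M b 0 x / norm x ^ CARD('n) = L * (inverse ((norm x)\<^sup>2 + 0))\<^sup>2 * k x"
        unfolding r[symmetric] by simp
      ultimately show ?thesis using L by (simp only: real_norm_def abs_mult abs_of_nonneg[OF L] abs_power2)
    next
      case False
      then show ?thesis using Cc_vanish[OF k, of x] by (simp add: mem_hball)
    qed
    then show "(\<lambda>n. F n ((norm x)\<^sup>2) * k x) \<longlonglongrightarrow> k x * radmono M b 0 x / norm x ^ CARD('n)"
      "norm (F n ((norm x)\<^sup>2) * k x) \<le> \<bar>k x * radmono M b 0 x / norm x ^ CARD('n)\<bar>" by auto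
  qed
  have "(\<lambda>n. \<integral>x. F n ((norm x)\<^sup>2) * k x \<partial>lborel) \<longlonglongrightarrow> (\<integral>x. k x * radmono M b 0 x / norm x ^ CARD('n) \<partial>lborel)"
  proof (rule integral_dominated_convergence)
    show "integrable lborel (\<lambda>x. \<bar>k x * radmono M b 0 x / norm x ^ CARD('n)\<bar>)"
      using N by (intro integrable_abs integrable_radmono k) auto
    show "AE x in lborel. (\<lambda>n. F n ((norm x)\<^sup>2) * k x) \<longlonglongrightarrow> k x * radmono M b 0 x / norm x ^ CARD('n)"
      using AE_lborel_singleton[of "0::real^'n"] lim by (auto elim: eventually_mono)
    show "AE x in lborel. norm (F n ((norm x)\<^sup>2) * k x) \<le> \<bar>k x * radmono M b 0 x / norm x ^ CARD('n)\<bar>" for n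
      using AE_lborel_singleton[of "0::real^'n"] le by (auto elim: eventually_mono)
    show "(\<lambda>x. F n ((norm x)\<^sup>2) * k x) \<in> borel_measurable lborel" for n
      unfolding F_def by measurable
  qed simp
  then show ?thesis
    unfolding z k_def[symmetric] by (simp add: LIMSEQ_const_iff)
qed

text \<open>For test functions, exponents \<open>CARD('n)\<close>, 0, 0 give the hyperbolic
  integral.\<close>

definition radint :: "(real^'n \<Rightarrow> real) \<Rightarrow> nat \<Rightarrow> nat \<Rightarrow> nat \<Rightarrow> real" where
  "radint f a b d = (\<integral>x. f x * radmono a b d x / norm x ^ CARD('n) \<partial>lborel)"

lemma radint_add:
  assumes "f \<in> Cc_inf_H" "g \<in> Cc_inf_H" "a \<ge> d + 1"
  shows "radint (\<lambda>x. f x + g x) a b d = radint f a b d + radint g a b d"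
  using integrable_radmono[OF assms(1,3)] integrable_radmono[OF assms(2,3)]
  by (simp add: radint_def distrib_right add_divide_distrib)

lemma radint_cmult: "radint (\<lambda>x. c * f x) a b d = c * radint f a b d"
  by (simp add: radint_def mult.assoc flip: times_divide_eq_right)

lemma radint_nonneg:
  assumes "f \<in> Cc_inf_H" "\<And>x. f x \<ge> 0"
  shows "radint f a b d \<ge> 0"
  unfolding radint_def
proof (rule Bochner_Integration.integral_nonneg)
  show "0 \<le> f x * radmono a b d x / norm x ^ CARD('a)" for x
  proof (cases "x \<in> hball")
    case True
    then show ?thesis
      using assms sh_nonneg[of x] ch_ge_1[of x] rd_nonneg[of x] by (simp add: radmono_def)
  qed (simp add: Cc_vanish[OF assms(1)] mem_hball)
qed

text \<open>Integration by parts as a linear relation between numbers, so that its later uses are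
  pure algebra.\<close>

lemma radint_euler:
  assumes f: "f \<in> Cc_inf_H" and a: "a \<ge> d + 1"
  shows "radint (euler f) a b d + a * radint f a (b + 1) d + b * radint f (a + 2) (b - 1) d
    - d * radint f (a + 1) b (d + 1) = 0"
proof -
  note i = integrable_radmono[OF Cc_inf_H_euler[OF f] a, of b] integrable_radmono[OF f a, of "b + 1"]
    integrable_radmono[OF f, of d "a + 2" "b - 1"] integrable_radmono[OF f, of "d + 1" "a + 1" b]
  have "has_bochner_integral lborel (\<lambda>x. euler f x * radmono a b d x / norm x ^ CARD('a) + a * (f x * radmono a (b + 1) d x / norm x ^ CARD('a))
      + b * (f x * radmono (a + 2) (b - 1) d x / norm x ^ CARD('a)) - d * (f x * radmono (a + 1) b (d + 1) x / norm x ^ CARD('a)))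
      (radint (euler f) a b d + a * radint f a (b + 1) d
      + b * radint f (a + 2) (b - 1) d - d * radint f (a + 1) b (d + 1))"
    unfolding radint_def
    by (intro has_bochner_integral_add has_bochner_integral_diff has_bochner_integral_mult_right has_bochner_integral_integrable i)
      (use a in auto)
  moreover have "euler f x * radmono a b d x / norm x ^ CARD('a) + a * (f x * radmono a (b + 1) d x / norm x ^ CARD('a))
      + b * (f x * radmono (a + 2) (b - 1) d x / norm x ^ CARD('a)) - d * (f x * radmono (a + 1) b (d + 1) x / norm x ^ CARD('a))
      = (euler f x * radmono a b d x + f x * radmono_deriv a b d x) / norm x ^ CARD('a)" for x
    by (simp add: radmono_deriv_def algebra_simps add_divide_distrib diff_divide_distrib)
  ultimately have "has_bochner_integral lborel (\<lambda>x. (euler f x * radmono a b d x + f x * radmono_deriv a b d x) / norm x ^ CARD('a))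
      (radint (euler f) a b d + a * radint f a (b + 1) d + b * radint f (a + 2) (b - 1) d - d * radint f (a + 1) b (d + 1))"
    by (simp only:)
  from has_bochner_integral_integral_eq[OF this] show ?thesis
    using radial_parts(2)[OF f a, of b] by (simp only:)
qed

text \<open>Put \<open>y = D\<^sub>i\<^sub>j u\<close> and write \<open>s\<close>, \<open>c\<close>
  for \<open>sinh r\<close>, \<open>cosh r\<close>. Moving one \<open>D\<^sub>i\<^sub>j\<close> onto
  the other factor and integrating \<open>E\<close> by parts leaves the integral of
  \<open>s ^ M ((E y)\<^sup>2 - 2 c y E y)\<close>. The mixed term is half of
  \<open>E (y\<^sup>2)\<close>, and a further integration by parts turns it into
  \<open>s ^ M (M c\<^sup>2 + s\<^sup>2) y\<^sup>2\<close>.\<close>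

lemma cross_term_nonneg:
  fixes u :: "real^'n \<Rightarrow> real"
  assumes u: "u \<in> Cc_inf_H" and N: "CARD('n) = M + 4" "M \<ge> 1"
  shows "radint (\<lambda>x. euler (euler u) x * rot i j (rot i j u) x) M 0 0
    + (M + 2) * radint (\<lambda>x. euler u x * rot i j (rot i j u) x) M 1 0 \<ge> 0"
proof -
  define y where "y = rot i j u"
  have y: "y \<in> Cc_inf_H" by (simp add: y_def Cc_inf_H_rot u)
  note C = Cc_inf_H_euler Cc_inf_H_mult Cc_inf_H_rot u y
  have r1: "rot i j (euler u) = euler y"
    by (simp add: fun_eq_iff euler_rot_commute[OF u] y_def)
  have r2: "rot i j (euler (euler u)) = euler (euler y)"
  proof
    fix x
    show "rot i j (euler (euler u)) x = euler (euler y) x"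
      using euler_rot_commute[OF Cc_inf_H_euler[OF u], of i j x] by (simp only: r1)
  qed
  have p1: "radint (\<lambda>x. euler (euler y) x * y x) M 0 0 + radint (\<lambda>x. euler (euler u) x * rot i j y x) M 0 0 = 0"
    using rot_parts[of "euler (euler u)" y M i j 0] N
    by (subst radint_add[symmetric]) (auto simp: radint_def r2 intro!: C)
  have p2: "radint (\<lambda>x. euler y x * y x) M 1 0 + radint (\<lambda>x. euler u x * rot i j y x) M 1 0 = 0"
    using rot_parts[of "euler u" y M i j 1] N
    by (subst radint_add[symmetric]) (auto simp: radint_def r1 intro!: C)
  have e1: "euler (\<lambda>x. y x * euler y x) = (\<lambda>x. euler (euler y) x * y x + euler y x * euler y x)"
    by (simp add: fun_eq_iff euler_mult C)
  have "radint (euler (\<lambda>x. y x * euler y x)) M 0 0 + M * radint (\<lambda>x. euler y x * y x) M 1 0 = 0"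
    using radint_euler[of "\<lambda>x. y x * euler y x" 0 M 0] N by (simp add: C mult.commute[of "y _"])
  then have q1: "radint (\<lambda>x. euler (euler y) x * y x) M 0 0 + radint (\<lambda>x. euler y x * euler y x) M 0 0
      + M * radint (\<lambda>x. euler y x * y x) M 1 0 = 0"
    unfolding e1 using N by (subst (asm) radint_add) (auto intro!: C)
  have e2: "euler (\<lambda>x. y x * y x) = (\<lambda>x. 2 * (euler y x * y x))"
    by (simp add: fun_eq_iff euler_mult C)
  have q2: "2 * radint (\<lambda>x. euler y x * y x) M 1 0 + M * radint (\<lambda>x. y x * y x) M 2 0
      + radint (\<lambda>x. y x * y x) (M + 2) 0 0 = 0"
    using radint_euler[of "\<lambda>x. y x * y x" 0 M 1] N unfolding e2 radint_cmult
    by (simp add: C numeral_2_eq_2)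
  have pos: "radint (\<lambda>x. euler y x * euler y x) M 0 0 \<ge> 0" "radint (\<lambda>x. y x * y x) M 2 0 \<ge> 0"
     "radint (\<lambda>x. y x * y x) (M + 2) 0 0 \<ge> 0"
    by (auto intro!: radint_nonneg C)
  then have "M * radint (\<lambda>x. y x * y x) M 2 0 \<ge> 0" by simp
  moreover have "radint (\<lambda>x. euler (euler u) x * rot i j y x) M 0 0 + (M + 2) * radint (\<lambda>x. euler u x * rot i j y x) M 1 0
    = radint (\<lambda>x. euler y x * euler y x) M 0 0 + M * radint (\<lambda>x. y x * y x) M 2 0 + radint (\<lambda>x. y x * y x) (M + 2) 0 0"
    unfolding of_nat_add of_nat_numeral using p1 p2 q1 q2 by algebra
  ultimately show ?thesis
    using pos unfolding y_def[symmetric] of_nat_add of_nat_numeral by linarith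
qed

text \<open>Here \<open>p = E u\<close>, \<open>q = E\<^sup>2 u\<close>, \<open>i = 1 / r\<close> and \<open>N = 2 n + 1\<close>. The ten-term bracket is the radial derivative of
  \<open>- 2 A v v' - 2 B v v' / s\<^sup>2 + v'\<^sup>2 / 2 r + 3 v\<^sup>2 / 8 r\<^sup>3 + A v\<^sup>2 / r + B v\<^sup>2 / (r s\<^sup>2)\<close> for \<open>v = s\<^sup>n u\<close>, and the squares on the
  right are those of \<open>v'' - v' / 2 r\<close>, \<open>v' - 3 v / 2 r\<close>, \<open>v' - v / 2 r\<close> and \<open>w' - w / 2 r\<close> with \<open>w = v / s\<close>, after division
  by common powers of \<open>s\<close>.\<close>

lemma pointwise_identity:
  fixes u p q s c i n :: real
  assumes c: "c\<^sup>2 = 1 + s\<^sup>2"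
  defines "A \<equiv> n\<^sup>2" and "B \<equiv> n * (n - 1)"
  defines "V \<equiv> p + n * c * u"
  shows "(q + (2 * n - 1) * c * p)\<^sup>2
    - (n ^ 4 * s ^ 4 + n\<^sup>2 / 2 * (s ^ 4 * i\<^sup>2) + 9 / 16 * (s ^ 4 * i ^ 4) + n * (n + 1) * (n - 1)\<^sup>2 * 2 * s\<^sup>2
        + n * (n - 1) * (4 * n\<^sup>2 - 4 * n - 6) / 4) * u\<^sup>2
    - (- 2 * A * n * (2 * u * p * (s\<^sup>2 * c) + u\<^sup>2 * ((2 * n - 1) * s\<^sup>2 * c\<^sup>2 + s ^ 4))
       - 2 * B * n * (2 * u * p * c + u\<^sup>2 * ((2 * n - 3) * c\<^sup>2 + s\<^sup>2))
       + n\<^sup>2 / 2 * (2 * u * p * (s * c\<^sup>2 * i) + u\<^sup>2 * ((2 * n - 2) * s * c ^ 3 * i + 2 * s ^ 3 * c * i - s\<^sup>2 * c\<^sup>2 * i\<^sup>2))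
       + 3 / 8 * (2 * u * p * (s ^ 3 * i ^ 3) + u\<^sup>2 * (2 * n * s ^ 3 * c * i ^ 3 - 3 * s ^ 4 * i ^ 4))
       + A * (2 * u * p * (s ^ 3 * i) + u\<^sup>2 * (2 * n * s ^ 3 * c * i - s ^ 4 * i\<^sup>2))
       + B * (2 * u * p * (s * i) + u\<^sup>2 * ((2 * n - 2) * s * c * i - s\<^sup>2 * i\<^sup>2))
       - 2 * A * ((p\<^sup>2 + u * q) * s\<^sup>2 + u * p * ((2 * n - 1) * s\<^sup>2 * c))
       - 2 * B * ((p\<^sup>2 + u * q) + u * p * ((2 * n - 3) * c))
       + n * ((p\<^sup>2 + u * q) * (s * c * i) + u * p * ((2 * n - 2) * s * c\<^sup>2 * i + s ^ 3 * i - s\<^sup>2 * c * i\<^sup>2))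
       + 1 / 2 * (2 * p * q * (s * i) + p\<^sup>2 * ((2 * n - 2) * s * c * i - s\<^sup>2 * i\<^sup>2)))
   = ((n - 1) * c * V + q + n * s\<^sup>2 * u + n * c * p - s * V * i / 2)\<^sup>2
     + 1 / 4 * (i * s * (V - 3 / 2 * (s * u * i)))\<^sup>2
     + 2 * A * (s * (V - s * u * i / 2))\<^sup>2
     + 2 * B * (V - c * u - s * u * i / 2)\<^sup>2
     + B / 2 * u\<^sup>2 * ((s * i)\<^sup>2 - 1)"
  unfolding A_def B_def V_def using c by algebra

text \<open>Integrated form of \<open>pointwise_identity\<close>: the total derivatives integrate to
  0, and what remains is a nonnegative factor times a sum of nonnegative terms, off the null set
  \<open>{0}\<close>.\<close>

lemma radial_inequality:
  fixes u :: "real^'n \<Rightarrow> real"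
  assumes u: "u \<in> Cc_inf_H" and N: "CARD('n) = M + 4" "M \<ge> 1"
  defines "n \<equiv> (real M + 3) / 2"
  shows "radint (\<lambda>x. euler (euler u) x * euler (euler u) x) M 0 0
    + 2 * (2 * n - 1) * radint (\<lambda>x. euler (euler u) x * euler u x) M 1 0
    + (2 * n - 1)\<^sup>2 * radint (\<lambda>x. euler u x * euler u x) M 2 0
   \<ge> n ^ 4 * radint (\<lambda>x. u x * u x) (M + 4) 0 0 + n\<^sup>2 / 2 * radint (\<lambda>x. u x * u x) (M + 4) 0 2
    + 9 / 16 * radint (\<lambda>x. u x * u x) (M + 4) 0 4 + n * (n + 1) * (n - 1)\<^sup>2 * 2 * radint (\<lambda>x. u x * u x) (M + 2) 0 0
    + n * (n - 1) * (4 * n\<^sup>2 - 4 * n - 6) / 4 * radint (\<lambda>x. u x * u x) M 0 0" (is "?L \<ge> ?R")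
proof -
  define p q where "p = euler u" and "q = euler p"
  have p: "p \<in> Cc_inf_H" and q: "q \<in> Cc_inf_H" by (simp_all add: p_def q_def Cc_inf_H_euler u)
  \<comment> \<open>\<open>D\<close> collects exact radial derivatives, whose integrals vanish;
    \<open>I\<close> collects the weighted integrands themselves.\<close>
  define D where "D f a b d x = (euler f x * radmono a b d x + f x * radmono_deriv a b d x) / norm x ^ CARD('n)"
    for f a b d and x :: "real^'n"
  define I where "I f a b d x = f x * radmono a b d x / norm x ^ CARD('n)"
    for f a b d and x :: "real^'n"
  \<comment> \<open>The difference of the two integrands minus ten exact derivatives, in the order
    of the bracket in \<open>pointwise_identity\<close>.\<close>
  define T where "T x = I (\<lambda>x. q x * q x) M 0 0 x + 2 * (2 * n - 1) * I (\<lambda>x. q x * p x) M 1 0 x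
    + (2 * n - 1)\<^sup>2 * I (\<lambda>x. p x * p x) M 2 0 x
    - (n ^ 4 * I (\<lambda>x. u x * u x) (M + 4) 0 0 x + n\<^sup>2 / 2 * I (\<lambda>x. u x * u x) (M + 4) 0 2 x
    + 9 / 16 * I (\<lambda>x. u x * u x) (M + 4) 0 4 x + n * (n + 1) * (n - 1)\<^sup>2 * 2 * I (\<lambda>x. u x * u x) (M + 2) 0 0 x
    + n * (n - 1) * (4 * n\<^sup>2 - 4 * n - 6) / 4 * I (\<lambda>x. u x * u x) M 0 0 x)
    - ((- 2 * n\<^sup>2 * n) * D (\<lambda>x. u x * u x) (M + 2) 1 0 x + (- 2 * (n * (n - 1)) * n) * D (\<lambda>x. u x * u x) M 1 0 x
     + n\<^sup>2 / 2 * D (\<lambda>x. u x * u x) (M + 1) 2 1 x + 3 / 8 * D (\<lambda>x. u x * u x) (M + 3) 0 3 x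
     + n\<^sup>2 * D (\<lambda>x. u x * u x) (M + 3) 0 1 x + n * (n - 1) * D (\<lambda>x. u x * u x) (M + 1) 0 1 x
     + (- 2 * n\<^sup>2) * D (\<lambda>x. u x * p x) (M + 2) 0 0 x + (- 2 * (n * (n - 1))) * D (\<lambda>x. u x * p x) M 0 0 x
     + n * D (\<lambda>x. u x * p x) (M + 1) 1 1 x + 1 / 2 * D (\<lambda>x. p x * p x) (M + 1) 0 1 x)" for x
  have DI: "has_bochner_integral lborel (D (\<lambda>x. f x * g x) a b d) 0"
    if "f \<in> Cc_inf_H" "g \<in> Cc_inf_H" "a \<ge> d + 1" for f g a b d
    using radial_parts[OF Cc_inf_H_mult[OF that(1,2)] that(3)]
    by (simp add: has_bochner_integral_iff D_def[abs_def])
  have II: "has_bochner_integral lborel (I (\<lambda>x. f x * g x) a b d) (radint (\<lambda>x. f x * g x) a b d)"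
    if "f \<in> Cc_inf_H" "g \<in> Cc_inf_H" "a \<ge> d + 1" for f g a b d
    using integrable_radmono[OF Cc_inf_H_mult[OF that(1,2)] that(3)]
    by (simp add: has_bochner_integral_iff I_def[abs_def] radint_def)
  have "has_bochner_integral lborel T (?L - ?R - ((- 2 * n\<^sup>2 * n) * 0 + (- 2 * (n * (n - 1)) * n) * 0
     + n\<^sup>2 / 2 * 0 + 3 / 8 * 0 + n\<^sup>2 * 0 + n * (n - 1) * 0 + (- 2 * n\<^sup>2) * 0 + (- 2 * (n * (n - 1))) * 0 + n * 0 + 1 / 2 * 0))"
    unfolding T_def[abs_def] p_def[symmetric] q_def[symmetric]
    by (intro has_bochner_integral_add has_bochner_integral_diff has_bochner_integral_mult_right II DI u p q)
      (use N in auto)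
  then have TI: "has_bochner_integral lborel T (?L - ?R)" by simp
  have "0 \<le> T x" if "x \<noteq> 0" for x
  proof (cases "x \<in> hball \<and> x \<noteq> 0")
    case True
    then have x: "x \<in> hball" "x \<noteq> 0" by auto
    define s c i where "s = sh x" and "c = ch x" and "i = 1 / rd x"
    have s: "s > 0" and i: "i > 0" and c: "c\<^sup>2 = 1 + s\<^sup>2"
      using sh_pos[OF x] rd_pos[OF x] ch_sq[OF x(1)] by (simp_all add: s_def i_def c_def)
    have si: "s * i \<ge> 1"
      using rd_le_sh[OF x(1)] rd_pos[OF x] by (simp add: s_def i_def)
    \<comment> \<open>Substituting \<open>M = 2 n - 3\<close> turns the exponents
      \<open>M + k\<close>, which the derivatives produce as coefficients, into those of
      \<open>pointwise_identity\<close>.\<close>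
    have "2 * n = real M + 3" by (simp add: n_def)
    then have M: "real M = 2 * n - 3" by linarith
    have eu: "euler (\<lambda>x. u x * u x) x = 2 * u x * p x" "euler (\<lambda>x. u x * p x) x = (p x)\<^sup>2 + u x * q x"
      "euler (\<lambda>x. p x * p x) x = 2 * p x * q x"
      by (simp_all add: euler_mult u p p_def[symmetric] q_def[symmetric] power2_eq_square)
    define X where "X = ((n - 1) * c * (p x + n * c * u x) + q x + n * s\<^sup>2 * u x + n * c * p x - s * (p x + n * c * u x) * i / 2)\<^sup>2
     + 1 / 4 * (i * s * ((p x + n * c * u x) - 3 / 2 * (s * u x * i)))\<^sup>2
     + 2 * n\<^sup>2 * (s * ((p x + n * c * u x) - s * u x * i / 2))\<^sup>2
     + 2 * (n * (n - 1)) * ((p x + n * c * u x) - c * u x - s * u x * i / 2)\<^sup>2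
     + (n * (n - 1)) / 2 * (u x)\<^sup>2 * ((s * i)\<^sup>2 - 1)"
    have "n \<ge> 1" by (simp add: n_def)
    moreover have "(s * i)\<^sup>2 \<ge> 1" using si by (simp add: one_le_power)
    ultimately have X: "X \<ge> 0" unfolding X_def by (intro add_nonneg_nonneg mult_nonneg_nonneg) auto
    define g where "g = s ^ M / norm x ^ CARD('n)"
    have rm: "radmono (M + k) b d x / norm x ^ CARD('n) = g * (s ^ k * c ^ b * i ^ d)" for k b d
      by (simp add: radmono_def s_def c_def i_def g_def power_add power_one_over field_simps)
    have Ik: "I f (M + k) b d x = g * (f x * (s ^ k * c ^ b * i ^ d))" for f k b d
      using rm[of k b d] by (simp add: I_def mult_ac flip: times_divide_eq_right)
    have Dk: "D f (M + k) b d x = g * (euler f x * (s ^ k * c ^ b * i ^ d) + f x * ((M + k) * (s ^ k * c ^ (b + 1) * i ^ d)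
       + b * (s ^ (k + 2) * c ^ (b - 1) * i ^ d) - d * (s ^ (k + 1) * c ^ b * i ^ (d + 1))))" for f k b d
    proof -
      have "D f (M + k) b d x = euler f x * (radmono (M + k) b d x / norm x ^ CARD('n))
        + f x * ((M + k) * (radmono (M + k) (b + 1) d x / norm x ^ CARD('n))
          + b * (radmono (M + (k + 2)) (b - 1) d x / norm x ^ CARD('n)) - d * (radmono (M + (k + 1)) b (d + 1) x / norm x ^ CARD('n)))"
        by (simp add: D_def radmono_deriv_def add_divide_distrib diff_divide_distrib algebra_simps)
      then show ?thesis unfolding rm by (simp add: algebra_simps)
    qed
    note I0 = Ik[where k = 0, simplified] and D0 = Dk[where k = 0, simplified]
    have "T x = g * X"
      unfolding X_def pointwise_identity[OF c, of "q x" n "p x" i "u x", symmetric]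
      unfolding T_def Ik Dk I0 D0 eu of_nat_add M
      by (simp add: power_numeral_reduce) algebra
    moreover have "g \<ge> 0" using s by (simp add: g_def)
    ultimately show ?thesis using X by simp
  next
    case False
    then have "norm x \<ge> 1" using that by (simp add: mem_hball)
    then have "u x = 0" "p x = 0" "q x = 0"
      using Cc_vanish u p q by blast+
    then show ?thesis
      by (simp add: T_def I_def D_def euler_mult u p)
  qed
  then have "0 \<le> (\<integral>x. T x \<partial>lborel)"
    using AE_lborel_singleton[of "0::real^'n"] by (intro integral_nonneg_AE) (auto elim: eventually_mono)
  then show ?thesis
    using TI by (simp add: has_bochner_integral_iff)
qed

lemma Cc_inf_H_hyp_laplacian:
  assumes u: "u \<in> Cc_inf_H"
  shows "hyp_laplacian u \<in> Cc_inf_H"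
proof -
  have 1: "smooth_on hball (\<lambda>x::real^'a. (1 - (norm x)\<^sup>2) * (1 / 2))"
    by (intro smooth_on_mult smooth_on_diff smooth_on_const smooth_on_norm_sq open_hball)
  show ?thesis
    unfolding hyp_laplacian_def[abs_def] eucl_laplacian_def
    by (intro Cc_inf_H_add Cc_inf_H_mult_smooth Cc_inf_H_sum Cc_inf_H_partial Cc_inf_H_nth_mult u
        smooth_on_mult smooth_on_power smooth_on_const open_hball 1[simplified])
qed

lemma radint_sum:
  assumes "\<And>i. i \<in> I \<Longrightarrow> f i \<in> Cc_inf_H" "a \<ge> d + 1"
  shows "radint (\<lambda>x. \<Sum>i\<in>I. f i x) a b d = (\<Sum>i\<in>I. radint (f i) a b d)"
  using assms(1)
proof (induction I rule: infinite_finite_induct)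
  case (insert i I)
  then show ?case
    by (simp add: radint_add[OF _ _ assms(2)] Cc_inf_H_sum)
qed (simp_all add: radint_def)

lemma hyp_integral_radint:
  fixes f :: "real^'n \<Rightarrow> real"
  assumes g: "g \<in> Cc_inf_H" and fg: "\<And>x. sh x ^ CARD('n) * f x = g x * radmono a b d x"
    and "f \<in> borel_measurable borel" "\<And>x. norm x \<ge> 1 \<Longrightarrow> f x = 0"
  shows "hyp_integral f = radint g a b d"
  using hyp_integral_radial[OF assms(3,4)] by (simp add: radint_def fg)

lemma rellich_centre:
  fixes u :: "real^'n \<Rightarrow> real"
  assumes u: "u \<in> Cc_inf_H" and N5: "CARD('n) \<ge> 5"
  defines "N \<equiv> real CARD('n)"
  shows "hyp_integral (\<lambda>x. (hyp_laplacian u x)\<^sup>2) - (N - 1)^4 / 16 * hyp_integral (\<lambda>x. (u x)\<^sup>2)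
            \<ge> (N - 1)\<^sup>2 / 8 * hyp_integral (\<lambda>x. (u x)\<^sup>2 / (hyp_dist x 0)\<^sup>2)
              + 9 / 16 * hyp_integral (\<lambda>x. (u x)\<^sup>2 / (hyp_dist x 0) ^ 4)
              + (N\<^sup>2 - 1) * (N - 3)\<^sup>2 / 8 * hyp_integral (\<lambda>x. (u x)\<^sup>2 / (sinh (hyp_dist x 0))\<^sup>2)
              + (N - 1) * (N - 3) * (N\<^sup>2 - 4 * N - 3) / 16
                  * hyp_integral (\<lambda>x. (u x)\<^sup>2 / (sinh (hyp_dist x 0)) ^ 4)"
proof -
  define M where "M = CARD('n) - 4"
  have M: "CARD('n) = M + 4" "M \<ge> 1" using N5 by (auto simp: M_def)
  define n where "n = (real M + 3) / 2"
  have Nn: "N = 2 * n + 1" by (simp add: N_def M n_def)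
  define p q where "p = euler u" and "q = euler p"
  \<comment> \<open>The sum runs over ordered pairs without the factor 1/2, so this is twice the
    operator \<open>Z\<close> of the overview.\<close>
  define Z where "Z x = (\<Sum>i\<in>UNIV. \<Sum>j\<in>UNIV. rot i j (rot i j u) x)" for x
  have p: "p \<in> Cc_inf_H" and q: "q \<in> Cc_inf_H" and Z: "Z \<in> Cc_inf_H"
    unfolding Z_def[abs_def] p_def q_def by (intro Cc_inf_H_euler Cc_inf_H_sum Cc_inf_H_rot u)+
  have L: "hyp_laplacian u \<in> Cc_inf_H" by (rule Cc_inf_H_hyp_laplacian[OF u])
  have [measurable]: "u \<in> borel_measurable borel" "hyp_laplacian u \<in> borel_measurable borel"
    by (intro Cc_inf_H_measurable u L)+
  have uu: "(\<lambda>x. u x * u x) \<in> Cc_inf_H" by (intro Cc_inf_H_mult u)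
  have LL: "(\<lambda>x. hyp_laplacian u x * hyp_laplacian u x) \<in> Cc_inf_H" by (intro Cc_inf_H_mult L)
  have dr: "(u x)\<^sup>2 / hyp_dist x 0 ^ k = (u x)\<^sup>2 / rd x ^ k" for k x
    using Cc_vanish[OF u, of x] hyp_dist_0[of x] by (cases "x \<in> hball") (auto simp: mem_hball)
  have ds: "(u x)\<^sup>2 / (sinh (hyp_dist x 0)) ^ k = (u x)\<^sup>2 / sh x ^ k" for x k
    using Cc_vanish[OF u, of x] hyp_dist_0[of x] sinh_rd[of x] by (cases "x \<in> hball") (auto simp: mem_hball)
  have u0: "u x = 0" if "norm x \<ge> 1" for x by (rule Cc_vanish[OF u that])
  have i1: "hyp_integral (\<lambda>x. (u x)\<^sup>2) = radint (\<lambda>x. u x * u x) (M + 4) 0 0"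
    by (rule hyp_integral_radint[OF uu]) (auto simp: radmono_def M power2_eq_square u0)
  have i2: "hyp_integral (\<lambda>x. (u x)\<^sup>2 / (hyp_dist x 0)\<^sup>2) = radint (\<lambda>x. u x * u x) (M + 4) 0 2"
    unfolding dr by (rule hyp_integral_radint[OF uu]) (auto simp: radmono_def M power2_eq_square u0)
  have i3: "hyp_integral (\<lambda>x. (u x)\<^sup>2 / (hyp_dist x 0) ^ 4) = radint (\<lambda>x. u x * u x) (M + 4) 0 4"
    unfolding dr by (rule hyp_integral_radint[OF uu]) (auto simp: radmono_def M power2_eq_square u0)
  have i4: "hyp_integral (\<lambda>x. (u x)\<^sup>2 / (sinh (hyp_dist x 0))\<^sup>2) = radint (\<lambda>x. u x * u x) (M + 2) 0 0"
    unfolding ds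
  proof (rule hyp_integral_radint[OF uu])
    show "sh x ^ CARD('n) * ((u x)\<^sup>2 / (sh x)\<^sup>2) = u x * u x * radmono (M + 2) 0 0 x" for x
      by (cases "sh x = 0") (simp_all add: radmono_def M power2_eq_square power_add power4_eq_xxxx)
  qed (auto simp: u0)
  have i5: "hyp_integral (\<lambda>x. (u x)\<^sup>2 / (sinh (hyp_dist x 0)) ^ 4) = radint (\<lambda>x. u x * u x) M 0 0"
    unfolding ds
  proof (rule hyp_integral_radint[OF uu])
    \<comment> \<open>If \<open>sh x = 0\<close>, the left side vanishes by division by zero and the
      right side because \<open>M \<ge> 1\<close>.\<close>
    show "sh x ^ CARD('n) * ((u x)\<^sup>2 / (sh x) ^ 4) = u x * u x * radmono M 0 0 x" for x
      using M(2) by (cases "sh x = 0") (simp_all add: radmono_def M power2_eq_square power_add power4_eq_xxxx)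
  qed (auto simp: u0)
  have i6: "hyp_integral (\<lambda>x. (hyp_laplacian u x)\<^sup>2) = radint (\<lambda>x. hyp_laplacian u x * hyp_laplacian u x) (M + 4) 0 0"
    by (rule hyp_integral_radint[OF LL]) (auto simp: radmono_def M power2_eq_square Cc_vanish[OF L])
  define R where "R f a b d x = f x * radmono a b d x / norm x ^ CARD('n)" for f a b d and x :: "real^'n"
  have RI: "has_bochner_integral lborel (R (\<lambda>x. f x * g x) a b d) (radint (\<lambda>x. f x * g x) a b d)"
    if "f \<in> Cc_inf_H" "g \<in> Cc_inf_H" "a \<ge> d + 1" for f g a b d
    using integrable_radmono[OF Cc_inf_H_mult[OF that(1,2)] that(3)]
    by (simp add: has_bochner_integral_iff R_def[abs_def] radint_def)
  \<comment> \<open>\<open>s ^ M\<close> times the square of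
    \<open>s\<^sup>2 * hyp_laplacian u x\<close>, expanded, with the nonnegative square of
    \<open>Z x / 2\<close> dropped.\<close>
  have pos: "R (\<lambda>x. q x * q x) M 0 0 x + 2 * (M + 2) * R (\<lambda>x. q x * p x) M 1 0 x + (M + 2)\<^sup>2 * R (\<lambda>x. p x * p x) M 2 0 x
      + R (\<lambda>x. q x * Z x) M 0 0 x + (M + 2) * R (\<lambda>x. p x * Z x) M 1 0 x
      \<le> R (\<lambda>x. hyp_laplacian u x * hyp_laplacian u x) (M + 4) 0 0 x" for x
  proof (cases "x \<in> hball")
    case True
    define s c where "s = sh x" and "c = ch x"
    have "s \<ge> 0" using sh_nonneg[OF True] by (simp add: s_def)
    have d: "s\<^sup>2 * hyp_laplacian u x = q x + (M + 2) * c * p x + Z x / 2"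
      using hyp_laplacian_decomposition[OF u True]
      by (simp add: s_def c_def sh_def ch_def p_def q_def Z_def M algebra_simps)
    have "s ^ (M + 4) * (hyp_laplacian u x * hyp_laplacian u x) = s ^ M * (s\<^sup>2 * hyp_laplacian u x)\<^sup>2"
      by (simp add: power_add power2_eq_square power4_eq_xxxx mult_ac)
    also have "\<dots> = s ^ M * ((q x + (M + 2) * c * p x)\<^sup>2 + (q x + (M + 2) * c * p x) * Z x + (Z x / 2)\<^sup>2)"
      unfolding d by (simp add: power2_eq_square algebra_simps)
    also have "\<dots> \<ge> s ^ M * ((q x + (M + 2) * c * p x)\<^sup>2 + (q x + (M + 2) * c * p x) * Z x)"
      using \<open>s \<ge> 0\<close> by (intro mult_left_mono) auto
    finally have "s ^ M * ((q x + (M + 2) * c * p x)\<^sup>2 + (q x + (M + 2) * c * p x) * Z x) / norm x ^ CARD('n)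
       \<le> s ^ (M + 4) * (hyp_laplacian u x * hyp_laplacian u x) / norm x ^ CARD('n)"
      by (intro divide_right_mono) auto
    also have "\<dots> = R (\<lambda>x. hyp_laplacian u x * hyp_laplacian u x) (M + 4) 0 0 x"
      by (simp add: R_def radmono_def s_def mult_ac)
    also have "s ^ M * ((q x + (M + 2) * c * p x)\<^sup>2 + (q x + (M + 2) * c * p x) * Z x) / norm x ^ CARD('n)
      = R (\<lambda>x. q x * q x) M 0 0 x + 2 * (M + 2) * R (\<lambda>x. q x * p x) M 1 0 x + (M + 2)\<^sup>2 * R (\<lambda>x. p x * p x) M 2 0 x
      + R (\<lambda>x. q x * Z x) M 0 0 x + (M + 2) * R (\<lambda>x. p x * Z x) M 1 0 x"
      unfolding R_def radmono_def s_def[symmetric] c_def[symmetric] of_nat_add of_nat_numeral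
      by (simp add: power2_eq_square algebra_simps add_divide_distrib)
    finally show ?thesis .
  next
    case False
    then have "norm x \<ge> 1" by (simp add: mem_hball)
    then show ?thesis
      using Cc_vanish[OF p] Cc_vanish[OF q] Cc_vanish[OF L] by (simp add: R_def)
  qed
  have h1: "has_bochner_integral lborel (\<lambda>x. R (\<lambda>x. q x * q x) M 0 0 x + 2 * (M + 2) * R (\<lambda>x. q x * p x) M 1 0 x + (M + 2)\<^sup>2 * R (\<lambda>x. p x * p x) M 2 0 x
      + R (\<lambda>x. q x * Z x) M 0 0 x + (M + 2) * R (\<lambda>x. p x * Z x) M 1 0 x)
      (radint (\<lambda>x. q x * q x) M 0 0 + 2 * (M + 2) * radint (\<lambda>x. q x * p x) M 1 0 + (M + 2)\<^sup>2 * radint (\<lambda>x. p x * p x) M 2 0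
      + radint (\<lambda>x. q x * Z x) M 0 0 + (M + 2) * radint (\<lambda>x. p x * Z x) M 1 0)"
    by (intro has_bochner_integral_add has_bochner_integral_mult_right RI p q Z) (use M in auto)
  have h2: "has_bochner_integral lborel (R (\<lambda>x. hyp_laplacian u x * hyp_laplacian u x) (M + 4) 0 0) (hyp_integral (\<lambda>x. (hyp_laplacian u x)\<^sup>2))"
    unfolding i6 by (intro RI L) auto
  have lower: "radint (\<lambda>x. q x * q x) M 0 0 + 2 * (M + 2) * radint (\<lambda>x. q x * p x) M 1 0 + (M + 2)\<^sup>2 * radint (\<lambda>x. p x * p x) M 2 0
      + (radint (\<lambda>x. q x * Z x) M 0 0 + (M + 2) * radint (\<lambda>x. p x * Z x) M 1 0) \<le> hyp_integral (\<lambda>x. (hyp_laplacian u x)\<^sup>2)"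
    using integral_mono[OF integrable.intros[OF h1] integrable.intros[OF h2] pos]
    unfolding has_bochner_integral_integral_eq[OF h1] has_bochner_integral_integral_eq[OF h2] by (simp only: add.assoc)
  have Zs: "radint (\<lambda>x. f x * Z x) M b 0 = (\<Sum>i\<in>UNIV. \<Sum>j\<in>UNIV. radint (\<lambda>x. f x * rot i j (rot i j u) x) M b 0)"
    if "f \<in> Cc_inf_H" for f b
    unfolding Z_def sum_distrib_left using M
    by (subst radint_sum) (auto intro!: sum.cong radint_sum Cc_inf_H_sum Cc_inf_H_mult Cc_inf_H_rot u that)
  have "radint (\<lambda>x. q x * Z x) M 0 0 + (M + 2) * radint (\<lambda>x. p x * Z x) M 1 0
    = (\<Sum>i\<in>UNIV. \<Sum>j\<in>UNIV. radint (\<lambda>x. q x * rot i j (rot i j u) x) M 0 0 + (M + 2) * radint (\<lambda>x. p x * rot i j (rot i j u) x) M 1 0)"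
    unfolding Zs[OF p] Zs[OF q] by (simp add: sum.distrib sum_distrib_left)
  also have "\<dots> \<ge> 0"
    unfolding q_def p_def of_nat_add of_nat_numeral by (intro sum_nonneg cross_term_nonneg[OF u M])
  finally have cross: "radint (\<lambda>x. q x * Z x) M 0 0 + (M + 2) * radint (\<lambda>x. p x * Z x) M 1 0 \<ge> 0" .
  have n2: "2 * n - 1 = M + 2" by (simp add: n_def)
  note main = radial_inequality[OF u M, folded p_def, folded q_def, folded n_def, unfolded n2]
  have c: "(N - 1)^4 / 16 = n ^ 4" "(N - 1)\<^sup>2 / 8 = n\<^sup>2 / 2" "(N\<^sup>2 - 1) * (N - 3)\<^sup>2 / 8 = n * (n + 1) * (n - 1)\<^sup>2 * 2"
     "(N - 1) * (N - 3) * (N\<^sup>2 - 4 * N - 3) / 16 = n * (n - 1) * (4 * n\<^sup>2 - 4 * n - 6) / 4"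
    unfolding Nn by (simp_all add: power2_eq_square power4_eq_xxxx algebra_simps add_divide_distrib diff_divide_distrib)
  show ?thesis
    unfolding c i1 i2 i3 i4 i5 using main lower[unfolded of_nat_mult of_nat_power of_nat_numeral] cross by linarith
qed

section \<open>Moving the pole by an inversion\<close>

text \<open>Inversion in the sphere of centre \<open>p\<close> and squared radius \<open>|p|\<^sup>2 - 1\<close>, which is orthogonal to the
  unit sphere. It is an isometric involution of the ball that exchanges the origin with \<open>p / |p|\<^sup>2\<close>.
  Division by zero makes it fix its own centre, which lies outside the ball.\<close>

definition invr :: "real^'n \<Rightarrow> real^'n \<Rightarrow> real^'n" where
  "invr p x = p + (((norm p)\<^sup>2 - 1) / (norm (x - p))\<^sup>2) *\<^sub>R (x - p)"

text \<open>The multiplier is also the scale factor of the derivative, so the density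
  \<open>2 / (1 - |x|\<^sup>2)\<close> and the lengths change reciprocally: this is the isometry
  property.\<close>

lemma invr_norm:
  fixes p x :: "real^'n"
  assumes "x \<noteq> p"
  shows "1 - (norm (invr p x))\<^sup>2 = ((norm p)\<^sup>2 - 1) / (norm (x - p))\<^sup>2 * (1 - (norm x)\<^sup>2)"
proof -
  define z k Q where "z = x - p" and "k = (norm p)\<^sup>2 - 1" and "Q = (norm z)\<^sup>2"
  have Q: "Q > 0" using assms by (simp add: Q_def z_def)
  have x: "x = p + z" by (simp add: z_def)
  have "(norm (p + (k / Q) *\<^sub>R z))\<^sup>2 = (norm p)\<^sup>2 + 2 * (k / Q) * (p \<bullet> z) + (k / Q)\<^sup>2 * Q"
    unfolding Q_def power2_norm_eq_inner by (simp add: inner_add_left inner_add_right inner_commute power2_eq_square algebra_simps)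
  also have "(k / Q)\<^sup>2 * Q = k / Q * k" using Q by (simp add: power2_eq_square)
  finally have 1: "1 - (norm (p + (k / Q) *\<^sub>R z))\<^sup>2 = - k - 2 * (k / Q) * (p \<bullet> z) - k / Q * k"
    by (simp add: k_def)
  have 2: "(norm x)\<^sup>2 = (norm p)\<^sup>2 + 2 * (p \<bullet> z) + Q"
    unfolding Q_def power2_norm_eq_inner x by (simp add: inner_add_left inner_add_right inner_commute)
  have "k / Q * (1 - (norm x)\<^sup>2) = k / Q * (- k - 2 * (p \<bullet> z) - Q)"
    unfolding 2 k_def by simp
  also have "\<dots> = - k - 2 * (k / Q) * (p \<bullet> z) - k / Q * k"
    using Q by (simp add: field_simps)
  finally show ?thesis
    unfolding invr_def z_def[symmetric] k_def[symmetric] Q_def[symmetric] 1 by simp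
qed

lemma invr_mem_hball:
  assumes "norm p > 1"
  shows "invr p x \<in> hball \<longleftrightarrow> x \<in> hball"
proof (cases "x = p")
  case True
  then show ?thesis by (simp add: invr_def)
next
  case False
  have pos: "((norm p)\<^sup>2 - 1) / (norm (x - p))\<^sup>2 > 0"
    using assms False by (simp add: one_less_power)
  have hb: "y \<in> hball \<longleftrightarrow> 1 - (norm y)\<^sup>2 > 0" for y :: "real^'a"
    by (simp add: mem_hball abs_square_less_1)
  show ?thesis
    unfolding hb invr_norm[OF False] by (simp only: zero_less_mult_iff) (use pos in linarith)
qed

lemma invr_invr:
  assumes "norm p > 1" "x \<noteq> p"
  shows "invr p (invr p x) = x"
proof -
  define z k Q where "z = x - p" and "k = (norm p)\<^sup>2 - 1" and "Q = (norm z)\<^sup>2"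
  have Q: "Q > 0" and k: "k > 0"
    using assms by (simp_all add: Q_def z_def k_def one_less_power)
  have "invr p x - p = (k / Q) *\<^sub>R z" by (simp add: invr_def z_def k_def Q_def)
  moreover have "(norm (c *\<^sub>R z))\<^sup>2 = c\<^sup>2 * Q" for c
    by (simp add: power_mult_distrib Q_def)
  then have "(norm ((k / Q) *\<^sub>R z))\<^sup>2 = k * k / Q"
    using Q by (simp add: power2_eq_square)
  ultimately have "invr p (invr p x) = p + (k / (k * k / Q)) *\<^sub>R (k / Q) *\<^sub>R z"
    by (simp add: invr_def[of p "invr p x"] k_def)
  then show ?thesis using Q k by (simp add: z_def)
qed

lemma invr_0:
  assumes "norm p > 1"
  shows "invr p 0 = (1 / (norm p)\<^sup>2) *\<^sub>R p"
proof -
  have "p \<noteq> 0" using assms by auto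
  have "invr p 0 = (1 - ((norm p)\<^sup>2 - 1) / (norm p)\<^sup>2) *\<^sub>R p"
    by (simp add: invr_def scaleR_diff_left)
  also have "1 - ((norm p)\<^sup>2 - 1) / (norm p)\<^sup>2 = 1 / (norm p)\<^sup>2"
    using \<open>p \<noteq> 0\<close> by (simp add: field_simps)
  finally show ?thesis .
qed

text \<open>The squared Euclidean distance of the images carries the product of the scale factors at
  the two points; the same product stands in the denominator of the distance formula.\<close>

lemma invr_hyp_dist:
  fixes p x :: "real^'n"
  assumes "norm p > 1" "x \<in> hball"
  shows "hyp_dist (invr p x) (invr p 0) = hyp_dist x 0"
proof -
  have xp: "x \<noteq> p" "0 \<noteq> p" using assms by (auto simp: mem_hball)
  define z k Q P where "z = x - p" and "k = (norm p)\<^sup>2 - 1" and "Q = (norm z)\<^sup>2" and "P = (norm p)\<^sup>2"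
  have Q: "Q > 0" and P: "P > 0" using xp by (auto simp: Q_def z_def P_def)
  have k: "k > 0" using assms(1) by (simp add: k_def one_less_power)
  have n1: "1 - (norm (invr p x))\<^sup>2 = k / Q * (1 - (norm x)\<^sup>2)"
    using invr_norm[OF xp(1)] by (simp add: k_def Q_def z_def)
  have n2: "1 - (norm (invr p 0))\<^sup>2 = k / P"
    using invr_norm[OF xp(2)] by (simp add: k_def P_def)
  have "invr p x - invr p 0 = (k / Q) *\<^sub>R z + (k / P) *\<^sub>R p"
    by (simp add: invr_def k_def Q_def z_def P_def)
  then have "(norm (invr p x - invr p 0))\<^sup>2 = (k / Q)\<^sup>2 * Q + 2 * (k / Q) * (k / P) * (p \<bullet> z) + (k / P)\<^sup>2 * P"
    unfolding Q_def P_def power2_norm_eq_inner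
    by (simp add: inner_add_left inner_add_right inner_commute power2_eq_square algebra_simps)
  also have "\<dots> = k / Q * (k / P) * (P + 2 * (p \<bullet> z) + Q)"
    using Q P by (simp add: field_simps power2_eq_square)
  also have "P + 2 * (p \<bullet> z) + Q = (norm x)\<^sup>2"
    unfolding Q_def P_def power2_norm_eq_inner z_def
    by (simp add: inner_diff_left inner_diff_right inner_commute)
  finally have n3: "(norm (invr p x - invr p 0))\<^sup>2 = k / Q * (k / P) * (norm x)\<^sup>2" .
  have "2 * (norm (invr p x - invr p 0))\<^sup>2 / ((1 - (norm (invr p x))\<^sup>2) * (1 - (norm (invr p 0))\<^sup>2))
    = (k / Q * (k / P)) * (2 * (norm x)\<^sup>2) / ((k / Q * (k / P)) * (1 - (norm x)\<^sup>2))"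
    unfolding n1 n2 n3 by (simp add: mult_ac)
  also have "\<dots> = 2 * (norm x)\<^sup>2 / (1 - (norm x)\<^sup>2)"
    using k Q P by (intro mult_divide_mult_cancel_left) auto
  finally show ?thesis by (simp add: hyp_dist_def)
qed

text \<open>A scale factor times the reflection in the hyperplane orthogonal to
  \<open>x - p\<close>.\<close>

definition invr_deriv :: "real^'n \<Rightarrow> real^'n \<Rightarrow> real^'n \<Rightarrow> real^'n" where
  "invr_deriv p x h = (((norm p)\<^sup>2 - 1) / (norm (x - p))\<^sup>2) *\<^sub>R (h - (2 * ((x - p) \<bullet> h) / (norm (x - p))\<^sup>2) *\<^sub>R (x - p))"

lemma invr_has_derivative:
  assumes "x \<noteq> p"
  shows "(invr p has_derivative invr_deriv p x) (at x)"
proof -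
  define k where "k = (norm p)\<^sup>2 - 1"
  define q where "q = (x - p) \<bullet> (x - p)"
  have q: "q \<noteq> 0" using assms by (simp add: q_def)
  have "((\<lambda>x. (x - p) \<bullet> (x - p)) has_derivative (\<lambda>h. 2 * ((x - p) \<bullet> h))) (at x)"
    by (auto intro!: derivative_eq_intros simp: inner_commute)
  from has_derivative_mult_right[OF Deriv.has_derivative_inverse[OF q[unfolded q_def] this], of k]
  have 1: "((\<lambda>x. k * inverse ((x - p) \<bullet> (x - p))) has_derivative
      (\<lambda>h. k * - (inverse q * (2 * ((x - p) \<bullet> h)) * inverse q))) (at x)"
    unfolding q_def .
  have 2: "((\<lambda>x. x - p) has_derivative (\<lambda>h. h)) (at x)"
    by (auto intro!: derivative_eq_intros)
  have "((\<lambda>x. p + (k * inverse ((x - p) \<bullet> (x - p))) *\<^sub>R (x - p)) has_derivative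
    (\<lambda>h. 0 + ((k * inverse ((x - p) \<bullet> (x - p))) *\<^sub>R h + (k * - (inverse q * (2 * ((x - p) \<bullet> h)) * inverse q)) *\<^sub>R (x - p)))) (at x)"
    by (intro has_derivative_add has_derivative_const has_derivative_scaleR 1 2)
  moreover have "(\<lambda>h. 0 + ((k * inverse ((x - p) \<bullet> (x - p))) *\<^sub>R h + (k * - (inverse q * (2 * ((x - p) \<bullet> h)) * inverse q)) *\<^sub>R (x - p)))
     = invr_deriv p x"
    unfolding invr_deriv_def[abs_def] power2_norm_eq_inner k_def[unfolded power2_norm_eq_inner, symmetric] q_def[symmetric]
    by (simp add: fun_eq_iff scaleR_diff_right divide_inverse mult_ac)
  moreover have "invr p = (\<lambda>x. p + (k * inverse ((x - p) \<bullet> (x - p))) *\<^sub>R (x - p))"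
    unfolding invr_def[abs_def] power2_norm_eq_inner k_def divide_inverse ..
  ultimately show ?thesis by simp
qed

lemma invr_deriv_norm:
  assumes "x \<noteq> p"
  shows "norm (h - (2 * ((x - p) \<bullet> h) / (norm (x - p))\<^sup>2) *\<^sub>R (x - p)) = norm h"
proof -
  define z where "z = x - p"
  have z: "(norm z)\<^sup>2 > 0" using assms by (simp add: z_def)
  have "(norm (h - (2 * (z \<bullet> h) / (norm z)\<^sup>2) *\<^sub>R z))\<^sup>2
    = (norm h)\<^sup>2 - 2 * (2 * (z \<bullet> h) / (norm z)\<^sup>2) * (z \<bullet> h) + (2 * (z \<bullet> h) / (norm z)\<^sup>2)\<^sup>2 * (norm z)\<^sup>2"
    unfolding power2_norm_eq_inner
    by (simp add: inner_diff_left inner_diff_right inner_commute algebra_simps power2_eq_square)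
  also have "\<dots> = (norm h)\<^sup>2"
  proof -
    have "c - 2 * (2 * w / q) * w + (2 * w / q)\<^sup>2 * q = c" if "q > 0" for c w q :: real
      using that by (simp add: power2_eq_square field_simps)
    then show ?thesis using z by blast
  qed
  finally show ?thesis
    unfolding z_def by (simp add: power2_eq_iff_nonneg)
qed

lemma invr_det:
  fixes p x :: "real^'n"
  assumes "x \<noteq> p" "norm p > 1"
  shows "\<bar>det (matrix (invr_deriv p x))\<bar> = (((norm p)\<^sup>2 - 1) / (norm (x - p))\<^sup>2) ^ CARD('n)"
proof -
  define S where "S h = h - (2 * ((x - p) \<bullet> h) / (norm (x - p))\<^sup>2) *\<^sub>R (x - p)" for h
  define m where "m = ((norm p)\<^sup>2 - 1) / (norm (x - p))\<^sup>2"
  have m: "m > 0" using assms by (simp add: m_def one_less_power)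
  have lin: "linear S"
  proof (rule linearI)
    show "S (g + h) = S g + S h" for g h
      by (simp add: S_def inner_add_right distrib_left add_divide_distrib scaleR_add_left)
    show "S (c *\<^sub>R h) = c *\<^sub>R S h" for c h
      by (simp add: S_def scaleR_diff_right mult_ac)
  qed
  have "orthogonal_transformation S"
    unfolding orthogonal_transformation using lin invr_deriv_norm[OF assms(1)] by (simp add: S_def)
  then have "orthogonal_matrix (matrix S)"
    by (simp add: orthogonal_transformation_matrix)
  then have "\<bar>det (matrix S)\<bar> = 1"
    using det_orthogonal_matrix by fastforce
  moreover have "invr_deriv p x = (*\<^sub>R) m \<circ> S"
    by (simp add: fun_eq_iff invr_deriv_def S_def m_def)
  then have "matrix (invr_deriv p x) = matrix ((*\<^sub>R) m) ** matrix S"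
    using lin by (simp add: matrix_compose linear_scale_self)
  ultimately show ?thesis
    using m by (simp add: det_mul abs_mult m_def[symmetric])
qed

text \<open>By \<open>invr_det\<close> the Jacobian is \<open>m ^ CARD('m)\<close>, and
  \<open>invr_norm\<close> makes it cancel against the change of the density:
  \<open>m ^ CARD('m) * W (invr p x) = W x\<close>.\<close>

lemma hyp_integral_invr_wellorder:
  fixes f :: "real^'m::{finite,wellorder} \<Rightarrow> real" and p :: "real^'m::_"
  assumes p: "norm p > 1" and f [measurable]: "f \<in> borel_measurable borel"
    and fi [measurable]: "(\<lambda>x. f (invr p x)) \<in> borel_measurable borel"
  shows "hyp_integral (\<lambda>x. f (invr p x)) = hyp_integral f"
proof -
  define W where "W x = (2 / (1 - (norm x)\<^sup>2)) ^ CARD('m)" for x :: "real^'m::_"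
  have [measurable]: "W \<in> borel_measurable borel" unfolding W_def[abs_def] by measurable
  have [measurable]: "hball \<in> sets (borel :: (real^'m::_) measure)" by (simp add: hball_def)
  have np: "x \<noteq> p" if "x \<in> hball" for x using that p by (auto simp: mem_hball)
  have img: "invr p ` hball = hball"
  proof -
    have "x \<in> invr p ` hball" if "x \<in> hball" for x
      using invr_invr[OF p np[OF that]] invr_mem_hball[OF p] that by (metis imageI)
    then show ?thesis using invr_mem_hball[OF p] by auto
  qed
  have inj: "inj_on (invr p) hball"
    by (rule inj_on_inverseI[where g = "invr p"]) (use invr_invr[OF p] np in auto)
  \<comment> \<open>The integrands are lifted to \<open>real^1\<close> because the change of
    variables theorem speaks about vector-valued functions.\<close>
  have "(\<lambda>x. \<bar>det (matrix (invr_deriv p x))\<bar> *\<^sub>R (vec (W (invr p x) * f (invr p x)) :: real^1)) absolutely_integrable_on hball \<and>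
       integral hball (\<lambda>x. \<bar>det (matrix (invr_deriv p x))\<bar> *\<^sub>R (vec (W (invr p x) * f (invr p x)) :: real^1)) = vec b
     \<longleftrightarrow> (\<lambda>x. vec (W x * f x) :: real^1) absolutely_integrable_on (invr p ` hball)
       \<and> integral (invr p ` hball) (\<lambda>x. vec (W x * f x) :: real^1) = vec b" for b
  proof (rule has_absolute_integral_change_of_variables[OF _ _ inj])
    show "hball \<in> sets lebesgue" by (simp add: hball_def)
    show "(invr p has_derivative invr_deriv p x) (at x within hball)" if "x \<in> hball" for x
      by (rule has_derivative_at_withinI[OF invr_has_derivative[OF np[OF that]]])
  qed
  then have cv: "(\<lambda>x. \<bar>det (matrix (invr_deriv p x))\<bar> * (W (invr p x) * f (invr p x))) absolutely_integrable_on hball \<and>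
       integral hball (\<lambda>x. \<bar>det (matrix (invr_deriv p x))\<bar> * (W (invr p x) * f (invr p x))) = b
     \<longleftrightarrow> (\<lambda>x. W x * f x) absolutely_integrable_on hball \<and> integral hball (\<lambda>x. W x * f x) = b" for b
    unfolding img by (simp add: absolutely_integrable_on_1_iff integral_on_1_eq)
  have eq: "\<bar>det (matrix (invr_deriv p x))\<bar> * (W (invr p x) * f (invr p x)) = W x * f (invr p x)" if "x \<in> hball" for x
  proof -
    define m where "m = ((norm p)\<^sup>2 - 1) / (norm (x - p))\<^sup>2"
    have m: "m > 0" using p np[OF that] by (simp add: m_def one_less_power)
    have "W (invr p x) = (2 / (m * (1 - (norm x)\<^sup>2))) ^ CARD('m)"
      by (simp only: W_def invr_norm[OF np[OF that]] m_def)
    then have "m ^ CARD('m) * W (invr p x) = W x"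
      using m by (simp add: W_def power_divide power_mult_distrib)
    then show ?thesis
      unfolding invr_det[OF np[OF that] p] m_def[symmetric] by (simp add: mult.assoc[symmetric])
  qed
  have cv': "(\<lambda>x. W x * f (invr p x)) absolutely_integrable_on hball \<and> integral hball (\<lambda>x. W x * f (invr p x)) = b
     \<longleftrightarrow> (\<lambda>x. W x * f x) absolutely_integrable_on hball \<and> integral hball (\<lambda>x. W x * f x) = b" for b
  proof -
    have i: "integral hball (\<lambda>x. \<bar>det (matrix (invr_deriv p x))\<bar> * (W (invr p x) * f (invr p x))) = integral hball (\<lambda>x. W x * f (invr p x))"
      by (rule integral_cong) (rule eq)
    have s: "(\<lambda>x. \<bar>det (matrix (invr_deriv p x))\<bar> * (W (invr p x) * f (invr p x))) absolutely_integrable_on hball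
      \<longleftrightarrow> (\<lambda>x. W x * f (invr p x)) absolutely_integrable_on hball"
      by (rule set_integrable_cong) (simp_all only: eq)
    show ?thesis using cv[of b] unfolding i s .
  qed
  \<comment> \<open>The set integral defaults to 0 for a non-integrable function. Since
    \<open>cv'\<close> transfers integrability as well as the value, both sides take the same
    branch.\<close>
  have lb: "(LINT x:hball|lborel. g x) = (if g absolutely_integrable_on hball then integral hball g else 0)"
    if [measurable]: "g \<in> borel_measurable borel" for g :: "real^'m::_ \<Rightarrow> real"
  proof -
    have "set_integrable lborel hball g \<longleftrightarrow> g absolutely_integrable_on hball"
      unfolding set_integrable_def by (subst integrable_completion) auto
    then show ?thesis
      using set_borel_integral_eq_integral(2)[of hball g]
      by (auto simp: set_lebesgue_integral_def set_integrable_def not_integrable_integral_eq)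
  qed
  have "(LINT x:hball|lborel. W x * f (invr p x)) = (LINT x:hball|lborel. W x * f x)"
    using cv' by (subst (1 2) lb) auto
  then show ?thesis by (simp add: hyp_integral_def W_def)
qed


text \<open>The change of variables theorem of the library needs a well-ordered index type. The type \<open>'a wo\<close> is a
  well-ordered copy of the finite type \<open>'a\<close>.\<close>

typedef 'a wo = "UNIV :: 'a set" morphisms un_wo mk_wo by simp

lemma bij_un_wo: "bij un_wo"
  by (rule bij_betw_byWitness[where f' = mk_wo]) (auto simp: un_wo_inverse mk_wo_inverse)

instance wo :: (finite) finite
proof
  have "UNIV = range (mk_wo :: 'a \<Rightarrow> 'a wo)"
    by (metis un_wo_inverse surjI)
  then show "finite (UNIV :: 'a wo set)"
    by (metis finite_code finite_imageI)
qed

lemma CARD_wo: "CARD('a::finite wo) = CARD('a)"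
  using bij_un_wo by (rule bij_betw_same_card)

text \<open>The order on the copy is pulled back from an arbitrary injection into the natural
  numbers.\<close>

definition wo_index :: "'a::finite wo \<Rightarrow> nat" where
  "wo_index x = (SOME f. inj f) (un_wo x)"

lemma wo_index_eq_iff: "wo_index x = wo_index y \<longleftrightarrow> x = (y :: 'a::finite wo)"
proof -
  have "\<exists>f :: 'a \<Rightarrow> nat. inj f"
    using finite_imp_inj_to_nat_seg[of "UNIV :: 'a set"] by auto
  then have "inj (SOME f :: 'a \<Rightarrow> nat. inj f)" by (rule someI_ex)
  then show ?thesis by (auto simp: wo_index_def un_wo_inject dest: injD)
qed

instantiation wo :: (finite) wellorder
begin

definition less_eq_wo :: "'a wo \<Rightarrow> 'a wo \<Rightarrow> bool" where
  "less_eq_wo x y \<longleftrightarrow> wo_index x \<le> wo_index y"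

definition less_wo :: "'a wo \<Rightarrow> 'a wo \<Rightarrow> bool" where
  "less_wo x y \<longleftrightarrow> wo_index x < wo_index y"

instance
proof
  fix P :: "'a wo \<Rightarrow> bool" and a :: "'a wo"
  assume IH: "\<And>x. (\<And>y. y < x \<Longrightarrow> P y) \<Longrightarrow> P x"
  show "P a"
    by (induction a rule: measure_induct_rule[where f = wo_index]) (auto intro: IH simp: less_wo_def)
qed (auto simp: less_eq_wo_def less_wo_def wo_index_eq_iff)

end

section \<open>Relabelling coordinates, and invariance of the hyperbolic integral for any index
  type\<close>

definition of_wo :: "real^('n wo) \<Rightarrow> real^'n" where "of_wo y = (\<chi> i. y $ mk_wo i)"
definition to_wo :: "real^'n \<Rightarrow> real^('n wo)" where "to_wo x = (\<chi> j. x $ un_wo j)"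

lemma of_wo_to_wo [simp]: "of_wo (to_wo x) = x"
  by (simp add: of_wo_def to_wo_def vec_eq_iff mk_wo_inverse)

lemma to_wo_of_wo [simp]: "to_wo (of_wo y) = y"
  by (simp add: of_wo_def to_wo_def vec_eq_iff un_wo_inverse)

lemma norm_of_wo [simp]: "norm (of_wo (y :: real^('n::finite wo))) = norm y"
proof -
  have "(\<Sum>j\<in>UNIV. (y $ j)\<^sup>2) = (\<Sum>j\<in>UNIV. (of_wo y $ un_wo j)\<^sup>2)"
    by (simp add: of_wo_def un_wo_inverse)
  also have "\<dots> = (\<Sum>i\<in>UNIV. (of_wo y $ i)\<^sup>2)"
    by (rule sum.reindex_bij_betw[OF bij_un_wo])
  finally show ?thesis by (simp add: norm_vec_def L2_set_def)
qed

lemma linear_of_wo: "linear (of_wo :: real^('n::finite wo) \<Rightarrow> _)"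
  by (rule linearI) (simp_all add: of_wo_def vec_eq_iff)

lemma of_wo_measurable [measurable]: "of_wo \<in> borel_measurable (borel :: (real^('n::finite wo)) measure)"
  by (intro borel_measurable_continuous_onI linear_continuous_on linear_conv_bounded_linear[THEN iffD1] linear_of_wo)

lemma prod_Basis_vec: "(\<Prod>b\<in>(Basis :: (real^'n) set). f b) = (\<Prod>i\<in>UNIV. f (axis i 1))"
proof -
  have B: "(Basis :: (real^'n) set) = range (\<lambda>i. axis i 1)"
    by (auto simp: Basis_vec_def)
  have "inj (\<lambda>i. axis i 1 :: real^'n)"
    by (auto simp: inj_def axis_eq_axis)
  from prod.reindex[OF this, of f] show ?thesis
    unfolding B by (simp add: o_def)
qed

text \<open>Lebesgue measure is determined by its values on boxes, and relabelling coordinates only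
  permutes side lengths.\<close>

lemma distr_of_wo: "distr lborel borel (of_wo :: real^('n::finite wo) \<Rightarrow> real^'n) = lborel"
proof (rule lborel_eqI[symmetric])
  fix l u :: "real^'n"
  assume le: "\<And>b. b \<in> Basis \<Longrightarrow> l \<bullet> b \<le> u \<bullet> b"
  have lei: "l $ i \<le> u $ i" for i
    using le[of "axis i 1"] by (simp add: inner_axis axis_in_Basis_iff)
  have "of_wo -` box l u = box (to_wo l) (to_wo u)"
  proof -
    have "y \<in> of_wo -` box l u \<longleftrightarrow> y \<in> box (to_wo l) (to_wo u)" for y
    proof -
      have "(\<forall>i. l $ i < y $ mk_wo i \<and> y $ mk_wo i < u $ i) \<longleftrightarrow> (\<forall>j. l $ un_wo j < y $ j \<and> y $ j < u $ un_wo j)"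
        by (metis un_wo_inverse mk_wo_inverse UNIV_I)
      then show ?thesis by (simp add: mem_box_cart of_wo_def to_wo_def)
    qed
    then show ?thesis by blast
  qed
  then have "emeasure (distr lborel borel of_wo) (box l u) = emeasure lborel (box (to_wo l) (to_wo u))"
    by (simp add: emeasure_distr)
  also have "\<dots> = (\<Prod>b\<in>Basis. (to_wo u - to_wo l) \<bullet> b)"
    using lei by (intro emeasure_lborel_box) (auto simp: Basis_vec_def inner_axis to_wo_def)
  also have "(\<Prod>b\<in>Basis. (to_wo u - to_wo l) \<bullet> b) = (\<Prod>j\<in>UNIV. (u - l) $ un_wo j)"
    by (simp add: prod_Basis_vec inner_axis to_wo_def)
  also have "\<dots> = (\<Prod>i\<in>UNIV. (u - l) $ i)"
    by (rule prod.reindex_bij_betw[OF bij_un_wo])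
  also have "\<dots> = (\<Prod>b\<in>Basis. (u - l) \<bullet> b)"
    by (simp add: prod_Basis_vec inner_axis)
  finally show "emeasure (distr lborel borel (of_wo :: real^('n::finite wo) \<Rightarrow> real^'n)) (box l u) = (\<Prod>b\<in>Basis. (u - l) \<bullet> b)" .
qed simp

lemma hyp_integral_of_wo:
  fixes f :: "real^'n::finite \<Rightarrow> real"
  assumes [measurable]: "f \<in> borel_measurable borel"
  shows "hyp_integral (\<lambda>y. f (of_wo y)) = hyp_integral f"
proof -
  have [measurable]: "hball \<in> sets (borel :: (real^'n) measure)" by (simp add: hball_def)
  have "hyp_integral f = (\<integral>x. indicator hball x *\<^sub>R ((2 / (1 - (norm x)\<^sup>2)) ^ CARD('n) * f x)
      \<partial>distr lborel borel (of_wo :: real^('n::finite wo) \<Rightarrow> real^'n))"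
    by (simp add: hyp_integral_def set_lebesgue_integral_def distr_of_wo)
  also have "\<dots> = (\<integral>y. indicator hball (of_wo y) *\<^sub>R ((2 / (1 - (norm (of_wo y))\<^sup>2)) ^ CARD('n) * f (of_wo y)) \<partial>lborel)"
    by (rule integral_distr) measurable
  also have "\<dots> = hyp_integral (\<lambda>y. f (of_wo y))"
    by (simp add: hyp_integral_def set_lebesgue_integral_def CARD_wo indicator_def mem_hball)
  finally show ?thesis by simp
qed

lemma invr_measurable [measurable]: "invr p \<in> borel_measurable borel"
  unfolding invr_def[abs_def] by measurable

lemma invr_of_wo: "invr p (of_wo y) = of_wo (invr (to_wo p) y)"
proof -
  have d: "of_wo y - p = of_wo (y - to_wo p)"
    using linear_diff[OF linear_of_wo, of y "to_wo p"] by simp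
  have n: "norm p = norm (to_wo p)"
    using norm_of_wo[of "to_wo p"] by simp
  show ?thesis
    unfolding invr_def d n norm_of_wo
    by (simp add: linear_add[OF linear_of_wo] linear_scale[OF linear_of_wo])
qed

lemma hyp_integral_invr:
  fixes f :: "real^'n \<Rightarrow> real"
  assumes p: "norm p > 1" and f [measurable]: "f \<in> borel_measurable borel"
  shows "hyp_integral (\<lambda>x. f (invr p x)) = hyp_integral f"
proof -
  have n: "norm (to_wo p) > 1"
    using p norm_of_wo[of "to_wo p"] by simp
  have "hyp_integral (\<lambda>x. f (invr p x)) = hyp_integral (\<lambda>y. f (of_wo (invr (to_wo p) y)))"
    by (subst hyp_integral_of_wo[symmetric]) (simp_all add: invr_of_wo)
  also have "\<dots> = hyp_integral (\<lambda>y. f (of_wo y))"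
    by (rule hyp_integral_invr_wellorder[OF n]) measurable
  also have "\<dots> = hyp_integral f" by (rule hyp_integral_of_wo) simp
  finally show ?thesis .
qed

lemma smooth_on_invr:
  assumes "norm p > 1"
  shows "smooth_on hball (\<lambda>x. invr p x $ j)"
proof -
  have "smooth_on hball (\<lambda>x. p $ j + ((norm p)\<^sup>2 - 1) * (inverse (\<Sum>i\<in>UNIV. (x $ i - p $ i)\<^sup>2) * (x $ j - p $ j)))"
  proof (intro smooth_on_add smooth_on_mult smooth_on_const smooth_on_diff smooth_on_nth smooth_on_inverse smooth_on_sum smooth_on_power open_hball)
    fix x :: "real^'a" assume "x \<in> hball"
    then have "x \<noteq> p" using assms by (auto simp: mem_hball)
    then have "(norm (x - p))\<^sup>2 \<noteq> 0" by simp
    then show "(\<Sum>i\<in>UNIV. (x $ i - p $ i)\<^sup>2) \<noteq> 0" by (simp add: norm_sq_sum)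
  qed
  then show ?thesis by (simp add: invr_def norm_sq_sum[of "_ - p"] divide_inverse mult.assoc)
qed

lemma Cc_inf_H_invr:
  assumes u: "u \<in> Cc_inf_H" and p: "norm p > 1"
  shows "(\<lambda>x. u (invr p x)) \<in> Cc_inf_H"
proof -
  obtain K where K: "compact K" "K \<subseteq> hball" "\<And>x. x \<notin> K \<Longrightarrow> u x = 0"
    using u by (auto simp: Cc_inf_H_def)
  have np: "x \<noteq> p" if "x \<in> hball" for x using that p by (auto simp: mem_hball)
  have ct: "continuous_on K (invr p)"
  proof (rule has_derivative_continuous_on)
    show "(invr p has_derivative invr_deriv p x) (at x within K)" if "x \<in> K" for x
      by (rule has_derivative_at_withinI[OF invr_has_derivative]) (use K(2) np that in blast)
  qed
  have "smooth_on hball (\<lambda>x. u (invr p x))"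
    by (rule smooth_on_compose[OF open_hball open_hball _ smooth_on_invr[OF p] Cc_inf_H_smooth[OF u]])
      (use invr_mem_hball[OF p] in auto)
  moreover have "compact (invr p ` K)" by (rule compact_continuous_image[OF ct K(1)])
  moreover have "invr p ` K \<subseteq> hball" using K(2) invr_mem_hball[OF p] by auto
  moreover have "u (invr p x) = 0" if "x \<notin> invr p ` K" for x
  proof (rule K(3))
    show "invr p x \<notin> K"
    proof
      assume k: "invr p x \<in> K"
      then have "x \<in> hball" using K(2) invr_mem_hball[OF p, of x] by auto
      then have "x = invr p (invr p x)" using invr_invr[OF p np] by simp
      with k that show False by blast
    qed
  qed
  ultimately show ?thesis unfolding Cc_inf_H_def by blast
qed

text \<open>Isometry invariance by direct computation. The Jacobian is a multiple of an orthogonal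
  matrix, so the Hessian contributes only through the Laplacian; the first-order terms left by the
  second derivatives of the inversion combine with the drift of
  \<open>hyp_laplacian\<close>.\<close>

lemma hyp_laplacian_invr:
  fixes u :: "real^'n \<Rightarrow> real"
  assumes u: "u \<in> Cc_inf_H" and p: "norm p > 1" and x: "x \<in> hball"
  shows "hyp_laplacian (\<lambda>x. u (invr p x)) x = hyp_laplacian u (invr p x)"
proof -
  define k where "k = (norm p)\<^sup>2 - 1"
  \<comment> \<open>Entry of the Jacobian: the derivative of component \<open>j\<close> in direction
    \<open>i\<close>.\<close>
  define A where "A j i y = k * ((if i = j then 1 else 0) / (norm (y - p))\<^sup>2
    - 2 * (y - p) $ i * (y - p) $ j / ((norm (y - p))\<^sup>2)\<^sup>2)" for i j :: 'n and y
  have np: "y \<noteq> p" if "y \<in> hball" for y using that p by (auto simp: mem_hball)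
  have dA: "invr_deriv p y (axis i 1) $ j = A j i y" for i j y
  proof -
    have "invr_deriv p y (axis i 1) $ j = k / (norm (y - p))\<^sup>2 * (axis i 1 $ j - 2 * (y - p) $ i / (norm (y - p))\<^sup>2 * (y - p) $ j)"
      unfolding invr_deriv_def k_def[symmetric] inner_axis by simp
    also have "axis i 1 $ j = (if i = j then 1 else 0 :: real)" by (simp add: axis_def)
    finally show ?thesis
      unfolding A_def by (simp only: right_diff_distrib times_divide_eq_right times_divide_eq_left power2_eq_square[of "_\<^sup>2"] divide_divide_eq_left mult_ac)
  qed
  have pc: "partial i (\<lambda>x. f (invr p x)) y = (\<Sum>j\<in>UNIV. A j i y * partial j f (invr p y))"
    if "f \<in> Cc_inf_H" "y \<in> hball" for f i y
    using partial_has_derivative[OF has_derivative_compose[OF invr_has_derivative[OF np[OF that(2)]] Cc_inf_H_has_derivative[OF that(1)]]]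
    by (simp add: dA)
  define z Q where "z = x - p" and "Q = (norm z)\<^sup>2"
  have Q: "Q > 0" using np[OF x] by (simp add: Q_def z_def)
  have Qs: "Q = (\<Sum>i\<in>UNIV. z $ i * z $ i)" unfolding Q_def norm_sq_sum by (simp add: power2_eq_square)
  define v where "v j = partial j u (invr p x)" for j
  define H where "H l j = partial l (partial j u) (invr p x)" for l j
  define a where "a j i = A j i x" for i j
  have a: "a j i = k * ((if i = j then 1 else 0) / Q - 2 * z $ i * z $ j / Q\<^sup>2)" for i j
    by (simp add: a_def A_def z_def Q_def)
  \<comment> \<open>The second derivative of component \<open>j\<close> in direction
    \<open>i\<close>, at \<open>x\<close>. Summed over \<open>i\<close> in \<open>sb\<close>, it
    gives the Euclidean Laplacian of component \<open>j\<close>.\<close>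
  define b where "b j i = k * (- 4 * (if i = j then z $ i else 0) / Q\<^sup>2 - 2 * z $ j / Q\<^sup>2 + 8 * (z $ i)\<^sup>2 * z $ j / Q ^ 3)" for i j
  have DA: "((\<lambda>t. A j i (x + t *\<^sub>R axis i 1)) has_real_derivative b j i) (at 0)" for i j
  proof -
    have n: "(norm (x + t *\<^sub>R axis i 1 - p))\<^sup>2 = Q + 2 * z $ i * t + t\<^sup>2" for t
    proof -
      have eq: "x + t *\<^sub>R axis i 1 - p = z + t *\<^sub>R axis i 1" by (simp add: z_def)
      show ?thesis
        unfolding Q_def power2_norm_eq_inner eq
        by (simp add: inner_add_left inner_add_right inner_axis inner_axis_axis inner_commute[of "axis _ _"] power2_eq_square distrib_left)
    qed
    have e: "A j i (x + t *\<^sub>R axis i 1) = k * ((if i = j then 1 else 0) / (Q + 2 * z $ i * t + t\<^sup>2)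
        - 2 * (z $ i + t) * (z $ j + (if i = j then t else 0)) / (Q + 2 * z $ i * t + t\<^sup>2)\<^sup>2)" for t
      unfolding A_def n by (auto simp: z_def axis_def algebra_simps)
    show ?thesis
    proof (cases "i = j")
      case True
      have "((\<lambda>t. k * (1 / (Q + 2 * z $ j * t + t\<^sup>2) - 2 * (z $ j + t) * (z $ j + t) / (Q + 2 * z $ j * t + t\<^sup>2)\<^sup>2))
        has_real_derivative b j j) (at 0)"
        using Q by (auto intro!: derivative_eq_intros) (simp add: b_def field_simps power2_eq_square power3_eq_cube power4_eq_xxxx)
      then show ?thesis unfolding e using True by simp
    next
      case False
      have "((\<lambda>t. k * (0 / (Q + 2 * z $ i * t + t\<^sup>2) - 2 * (z $ i + t) * (z $ j + 0) / (Q + 2 * z $ i * t + t\<^sup>2)\<^sup>2))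
        has_real_derivative b j i) (at 0)"
        using Q False by (auto intro!: derivative_eq_intros) (simp add: b_def field_simps power2_eq_square power3_eq_cube power4_eq_xxxx)
      then show ?thesis unfolding e using False by simp
    qed
  qed
  have D2: "partial i (partial i (\<lambda>x. u (invr p x))) x = (\<Sum>j\<in>UNIV. b j i * v j + a j i * (\<Sum>l\<in>UNIV. a l i * H l j))" for i
  proof -
    have "partial i (partial i (\<lambda>x. u (invr p x))) x = partial i (\<lambda>y. \<Sum>j\<in>UNIV. A j i y * partial j u (invr p y)) x"
      by (rule partial_cong_open[OF open_hball x]) (rule pc[OF u])
    also have "\<dots> = (\<Sum>j\<in>UNIV. b j i * v j + a j i * (\<Sum>l\<in>UNIV. a l i * H l j))"
    proof -
      have "((\<lambda>t. A j i (x + t *\<^sub>R axis i 1) * partial j u (invr p (x + t *\<^sub>R axis i 1)))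
         has_real_derivative b j i * v j + a j i * (\<Sum>l\<in>UNIV. a l i * H l j)) (at 0)" for j
      proof -
        have C: "(\<lambda>y. partial j u (invr p y)) \<in> Cc_inf_H"
          by (intro Cc_inf_H_invr Cc_inf_H_partial u p)
        have "((\<lambda>t. partial j u (invr p (x + t *\<^sub>R axis i 1))) has_real_derivative (\<Sum>l\<in>UNIV. a l i * H l j)) (at 0)"
          using partial_DERIV[of "\<lambda>y. partial j u (invr p y)" x 0 i] Cc_inf_H_has_derivative[OF C]
            pc[OF Cc_inf_H_partial[OF u] x, of i j]
          by (auto simp: differentiable_def a_def H_def)
        from DERIV_mult[OF DA[of j i] this] show ?thesis
          by (simp add: a_def v_def algebra_simps)
      qed
      then have "((\<lambda>t. \<Sum>j\<in>UNIV. A j i (x + t *\<^sub>R axis i 1) * partial j u (invr p (x + t *\<^sub>R axis i 1)))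
         has_real_derivative (\<Sum>j\<in>UNIV. b j i * v j + a j i * (\<Sum>l\<in>UNIV. a l i * H l j))) (at 0)"
        by (intro DERIV_sum)
      then show ?thesis
        unfolding partial_def by (rule DERIV_imp_deriv)
    qed
    finally show ?thesis .
  qed
  define N where "N = real CARD('n)"
  define G where "G = (\<Sum>j\<in>UNIV. z $ j * v j)"
  have sb: "(\<Sum>i\<in>UNIV. b j i) = k * (4 - 2 * N) * z $ j / Q\<^sup>2" for j
  proof -
    have "b j i = (if i = j then - 4 * k * z $ j / Q\<^sup>2 else 0) - 2 * k * z $ j / Q\<^sup>2 + (8 * k * z $ j / Q ^ 3) * (z $ i * z $ i)" for i
      by (auto simp: b_def algebra_simps power2_eq_square)
    then have "(\<Sum>i\<in>UNIV. b j i) = - 4 * k * z $ j / Q\<^sup>2 - N * (2 * k * z $ j / Q\<^sup>2) + (8 * k * z $ j / Q ^ 3) * Q"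
      by (simp only: sum.distrib sum_subtractf sum_distrib_left[symmetric] Qs[symmetric] N_def) simp
    also have "\<dots> = k * (4 - 2 * N) * z $ j / Q\<^sup>2"
      using Q by (simp add: field_simps power2_eq_square power3_eq_cube)
    finally show ?thesis .
  qed
  \<comment> \<open>Orthogonality of the Jacobian up to the scale factor \<open>k / Q\<close>; it
    removes the mixed second derivatives of \<open>u\<close>.\<close>
  have sa: "(\<Sum>i\<in>UNIV. a j i * a l i) = (if l = j then (k / Q)\<^sup>2 else 0)" for j l
  proof -
    have "(\<Sum>i\<in>UNIV. a j i * a l i) = (\<Sum>i\<in>UNIV. k\<^sup>2 * ((if i = j then (if l = j then 1 else 0) / Q\<^sup>2 else 0)
       - (if i = j then 2 * z $ j * z $ l / Q ^ 3 else 0) - (if i = l then 2 * z $ j * z $ l / Q ^ 3 else 0)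
       + (4 * z $ j * z $ l / Q ^ 4) * (z $ i * z $ i)))"
      by (rule sum.cong) (auto simp: a power2_eq_square power3_eq_cube power4_eq_xxxx algebra_simps add_divide_distrib diff_divide_distrib)
    also have "\<dots> = k\<^sup>2 * ((if l = j then 1 else 0) / Q\<^sup>2 - 2 * z $ j * z $ l / Q ^ 3 - 2 * z $ j * z $ l / Q ^ 3 + 4 * z $ j * z $ l / Q ^ 4 * Q)"
      unfolding sum_distrib_left[symmetric] sum.distrib sum_subtractf Qs[symmetric] by simp
    also have "4 * z $ j * z $ l / Q ^ 4 * Q = 4 * z $ j * z $ l / Q ^ 3"
      using Q by (simp add: power4_eq_xxxx power3_eq_cube)
    finally show ?thesis by (simp add: power_divide)
  qed
  have L: "eucl_laplacian (\<lambda>x. u (invr p x)) x = k * (4 - 2 * N) / Q\<^sup>2 * G + (k / Q)\<^sup>2 * eucl_laplacian u (invr p x)"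
  proof -
    have "eucl_laplacian (\<lambda>x. u (invr p x)) x
      = (\<Sum>i\<in>UNIV. \<Sum>j\<in>UNIV. b j i * v j) + (\<Sum>i\<in>UNIV. \<Sum>j\<in>UNIV. \<Sum>l\<in>UNIV. a j i * a l i * H l j)"
      unfolding eucl_laplacian_def D2 by (simp add: sum.distrib sum_distrib_left mult.assoc)
    also have "(\<Sum>i\<in>UNIV. \<Sum>j\<in>UNIV. b j i * v j) = (\<Sum>j\<in>UNIV. (\<Sum>i\<in>UNIV. b j i) * v j)"
      by (subst sum.swap) (simp add: sum_distrib_right)
    also have "\<dots> = k * (4 - 2 * N) / Q\<^sup>2 * G"
      unfolding sb G_def sum_distrib_left by (rule sum.cong) simp_all
    also have "(\<Sum>i\<in>UNIV. \<Sum>j\<in>UNIV. \<Sum>l\<in>UNIV. a j i * a l i * H l j) = (\<Sum>j\<in>UNIV. \<Sum>l\<in>UNIV. (\<Sum>i\<in>UNIV. a j i * a l i) * H l j)"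
      unfolding sum_distrib_right by (rule trans[OF sum.swap]) (rule sum.cong[OF refl], rule sum.swap)
    also have "\<dots> = (\<Sum>j\<in>UNIV. \<Sum>l\<in>UNIV. if l = j then (k / Q)\<^sup>2 * H j j else 0)"
      unfolding sa by (intro sum.cong) auto
    also have "\<dots> = (k / Q)\<^sup>2 * eucl_laplacian u (invr p x)"
      by (simp add: eucl_laplacian_def H_def sum_distrib_left)
    finally show ?thesis .
  qed
  define X where "X = (\<Sum>j\<in>UNIV. x $ j * v j)"
  have E: "(\<Sum>i\<in>UNIV. x $ i * partial i (\<lambda>x. u (invr p x)) x) = k / Q * X - 2 * k / Q\<^sup>2 * (x \<bullet> z) * G"
  proof -
    have "(\<Sum>i\<in>UNIV. x $ i * partial i (\<lambda>x. u (invr p x)) x) = (\<Sum>i\<in>UNIV. \<Sum>j\<in>UNIV. x $ i * (a j i * v j))"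
      unfolding pc[OF u x] by (simp add: a_def v_def sum_distrib_left)
    also have "\<dots> = (\<Sum>i\<in>UNIV. \<Sum>j\<in>UNIV. (if i = j then k / Q * (x $ i * v i) else 0) - (2 * k / Q\<^sup>2) * ((x $ i * z $ i) * (z $ j * v j)))"
      by (intro sum.cong) (auto simp: a algebra_simps diff_divide_distrib)
    also have "\<dots> = k / Q * X - (2 * k / Q\<^sup>2) * ((x \<bullet> z) * G)"
      unfolding sum_subtractf sum_distrib_left[symmetric]
      by (simp add: X_def G_def inner_vec_def sum_distrib_left[symmetric] sum_product flip: sum_divide_distrib)
    finally show ?thesis by simp
  qed
  have F: "(\<Sum>i\<in>UNIV. invr p x $ i * partial i u (invr p x)) = X - G + k / Q * G"
  proof -
    have e: "invr p x $ i * v i = x $ i * v i - z $ i * v i + k / Q * (z $ i * v i)" for i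
    proof -
      have "invr p x $ i = x $ i - z $ i + k / Q * z $ i"
        by (simp add: invr_def k_def Q_def z_def)
      then show ?thesis by (simp only: distrib_right left_diff_distrib mult.assoc)
    qed
    show ?thesis
      unfolding v_def[symmetric] e X_def G_def sum.distrib sum_subtractf sum_distrib_left ..
  qed
  \<comment> \<open>This relation eliminates \<open>x \<bullet> z\<close> in favour of
    \<open>Q\<close>, \<open>k\<close> and the conformal factor.\<close>
  have rel: "Q = 1 - (norm x)\<^sup>2 + 2 * (x \<bullet> z) + k"
    unfolding Q_def k_def z_def power2_norm_eq_inner by (simp add: inner_diff_left inner_diff_right inner_commute)
  define d where "d = (1 - (norm x)\<^sup>2) / 2"
  have nT: "(1 - (norm (invr p x))\<^sup>2) / 2 = k / Q * d"
    unfolding invr_norm[OF np[OF x]] by (simp add: d_def k_def Q_def z_def)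
  have "1 - (norm x)\<^sup>2 = 2 * d" unfolding d_def by simp
  then have xz: "2 * (x \<bullet> z) = Q - 2 * d - k" unfolding rel by simp
  have "hyp_laplacian (\<lambda>x. u (invr p x)) x = d\<^sup>2 * (k * (4 - 2 * N) / Q\<^sup>2 * G + (k / Q)\<^sup>2 * eucl_laplacian u (invr p x))
     + (N - 2) * d * (k / Q * X - k / Q\<^sup>2 * (Q - 2 * d - k) * G)"
    unfolding hyp_laplacian_def L E xz[symmetric] by (simp add: d_def N_def)
  also have "\<dots> = (k / Q * d)\<^sup>2 * eucl_laplacian u (invr p x) + (N - 2) * (k / Q * d) * (X - G + k / Q * G)"
  proof -
    define m where "m = k / Q"
    have m: "k = m * Q" using Q by (simp add: m_def)
    have 1: "k * (4 - 2 * N) / Q\<^sup>2 = m * (4 - 2 * N) / Q" "k / Q\<^sup>2 * (Q - 2 * d - k) = m * (1 - 2 * d / Q - m)"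
      using Q unfolding m by (simp_all add: power2_eq_square field_simps)
    show ?thesis
      unfolding 1 m_def[symmetric] by (simp add: algebra_simps power2_eq_square diff_divide_distrib)
  qed
  also have "\<dots> = hyp_laplacian u (invr p x)"
    unfolding hyp_laplacian_def nT F N_def by simp
  finally show ?thesis .
qed


section \<open>Transfer of the inequality to an arbitrary pole\<close>

lemma hyp_integral_cong:
  assumes "\<And>x. x \<in> hball \<Longrightarrow> f x = g x"
  shows "hyp_integral f = hyp_integral g"
  unfolding hyp_integral_def set_lebesgue_integral_def
  by (intro Bochner_Integration.integral_cong) (auto simp: indicator_def assms)

lemma hyp_dist_measurable [measurable]: "(\<lambda>x. hyp_dist x y) \<in> borel_measurable borel"
  unfolding hyp_dist_def arcosh_def by measurable

lemma rellich_inequality: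
  fixes u :: "real^'n \<Rightarrow> real"
  assumes u: "u \<in> Cc_inf_H" and N5: "CARD('n) \<ge> 5" and x0: "x0 \<in> hball"
  defines "N \<equiv> real CARD('n)"
  shows "hyp_integral (\<lambda>x. (hyp_laplacian u x)\<^sup>2) - (N - 1)^4 / 16 * hyp_integral (\<lambda>x. (u x)\<^sup>2)
            \<ge> (N - 1)\<^sup>2 / 8 * hyp_integral (\<lambda>x. (u x)\<^sup>2 / (hyp_dist x x0)\<^sup>2)
              + 9 / 16 * hyp_integral (\<lambda>x. (u x)\<^sup>2 / (hyp_dist x x0) ^ 4)
              + (N\<^sup>2 - 1) * (N - 3)\<^sup>2 / 8 * hyp_integral (\<lambda>x. (u x)\<^sup>2 / (sinh (hyp_dist x x0))\<^sup>2)
              + (N - 1) * (N - 3) * (N\<^sup>2 - 4 * N - 3) / 16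
                  * hyp_integral (\<lambda>x. (u x)\<^sup>2 / (sinh (hyp_dist x x0)) ^ 4)"
proof (cases "x0 = 0")
  case True
  then show ?thesis using rellich_centre[OF u N5] by (simp add: N_def)
next
  case False
  \<comment> \<open>The mirror image of \<open>x0\<close> in the unit sphere: the inversion centred
    there exchanges \<open>x0\<close> with the origin.\<close>
  define p where "p = (1 / (norm x0)\<^sup>2) *\<^sub>R x0"
  have np: "norm p = 1 / norm x0" using False by (simp add: p_def power2_eq_square)
  have p: "norm p > 1" using False x0 by (simp add: np mem_hball)
  have i0: "invr p 0 = x0"
    using False unfolding invr_0[OF p] np by (simp add: p_def power_divide)
  define w where "w x = u (invr p x)" for x
  have w: "w \<in> Cc_inf_H" unfolding w_def[abs_def] by (rule Cc_inf_H_invr[OF u p])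
  have [measurable]: "u \<in> borel_measurable borel" "hyp_laplacian u \<in> borel_measurable borel"
    by (intro Cc_inf_H_measurable u Cc_inf_H_hyp_laplacian)+
  have [measurable]: "(sinh :: real \<Rightarrow> real) \<in> borel_measurable borel"
    by (intro borel_measurable_continuous_onI continuous_intros)
  have tr: "hyp_integral f = hyp_integral g"
    if "f \<in> borel_measurable borel" "\<And>x. x \<in> hball \<Longrightarrow> f (invr p x) = g x" for f g :: "real^'n \<Rightarrow> real"
    using hyp_integral_invr[OF p that(1)] hyp_integral_cong[of "\<lambda>x. f (invr p x)" g] that(2) by simp
  have d: "hyp_dist (invr p x) x0 = hyp_dist x 0" if "x \<in> hball" for x
    using invr_hyp_dist[OF p that] by (simp add: i0)
  have 1: "hyp_integral (\<lambda>x. (hyp_laplacian u x)\<^sup>2) = hyp_integral (\<lambda>x. (hyp_laplacian w x)\<^sup>2)"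
    by (rule tr) (simp_all add: w_def[abs_def] hyp_laplacian_invr[OF u p])
  have 2: "hyp_integral (\<lambda>x. (u x)\<^sup>2) = hyp_integral (\<lambda>x. (w x)\<^sup>2)"
    by (rule tr) (simp_all add: w_def)
  have 3: "hyp_integral (\<lambda>x. (u x)\<^sup>2 / (hyp_dist x x0) ^ k) = hyp_integral (\<lambda>x. (w x)\<^sup>2 / (hyp_dist x 0) ^ k)" for k
    by (rule tr) (simp_all add: w_def d)
  have 4: "hyp_integral (\<lambda>x. (u x)\<^sup>2 / (sinh (hyp_dist x x0)) ^ k) = hyp_integral (\<lambda>x. (w x)\<^sup>2 / (sinh (hyp_dist x 0)) ^ k)" for k
    by (rule tr) (simp_all add: w_def d)
  show ?thesis
    unfolding 1 2 3 4 N_def by (rule rellich_centre[OF w N5])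
qed

section \<open>Radial test functions\<close>

text \<open>Used to glue a function that is smooth off the origin to one that vanishes near
  it.\<close>

lemma smooth_on_Un:
  assumes "open S" "open T" "smooth_on S f" "smooth_on T f"
  shows "smooth_on (S \<union> T) f"
proof -
  have "Ck_on k (S \<union> T) f" if "Ck_on k S f" "Ck_on k T f" for k
    using that
  proof (induction k arbitrary: f)
    case 0
    then show ?case using assms(1,2) by (simp add: continuous_on_open_Un)
  next
    case (Suc k)
    have "f differentiable (at x)" if "x \<in> S \<union> T" for x
      using that Ck_on_has_derivative[OF assms(1) Suc.prems(1)] Ck_on_has_derivative[OF assms(2) Suc.prems(2)]
      by (auto simp: differentiable_def)
    then have "f differentiable_on (S \<union> T)"
      by (intro differentiable_at_imp_differentiable_on) auto
    moreover have "Ck_on k (S \<union> T) (partial i f)" for i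
      using Suc.prems by (intro Suc.IH) auto
    ultimately show ?case by simp
  qed
  then show ?thesis using assms(3,4) by (simp add: smooth_on_def)
qed

lemma smooth_on_powr:
  assumes "open S" "smooth_on S f" "\<And>x. x \<in> S \<Longrightarrow> f x > 0"
  shows "smooth_on S (\<lambda>x. f x powr a)"
proof -
  define G where "G = {g. \<exists>c b. g = (\<lambda>t::real. c * t powr b)}"
  have "(\<lambda>t. 1 * t powr a) \<in> G" unfolding G_def by blast
  then have "(\<lambda>t. t powr a) \<in> G" by simp
  moreover have "\<exists>g'\<in>G. \<forall>t\<in>{0<..}. (g has_real_derivative g' t) (at t)" if "g \<in> G" for g
  proof -
    from that obtain c b where g: "g = (\<lambda>t. c * t powr b)" by (auto simp: G_def)
    have "(g has_real_derivative (c * b) * t powr (b - 1)) (at t)" if "t > 0" for t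
      unfolding g using that by (auto intro!: derivative_eq_intros)
    moreover have "(\<lambda>t. (c * b) * t powr (b - 1)) \<in> G"
      unfolding G_def by blast
    ultimately show ?thesis by (intro bexI[of _ "\<lambda>t. (c * b) * t powr (b - 1)"]) auto
  qed
  ultimately show ?thesis
    by (rule smooth_on_compose_real[OF assms(1,2), where U = "{0<..}", rotated]) (use assms(3) in auto)
qed

lemma smooth_on_ln:
  assumes "open S" "smooth_on S f" "\<And>x. x \<in> S \<Longrightarrow> f x > 0"
  shows "smooth_on S (\<lambda>x. ln (f x))"
proof -
  define G where "G = insert ln {g. \<exists>c b. g = (\<lambda>t::real. c * t powr b)}"
  have "ln \<in> G" unfolding G_def by blast
  moreover have "\<exists>g'\<in>G. \<forall>t\<in>{0<..}. (g has_real_derivative g' t) (at t)" if "g \<in> G" for g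
  proof -
    from that consider "g = ln" | c b where "g = (\<lambda>t. c * t powr b)" by (auto simp: G_def)
    then show ?thesis
    proof cases
      case 1
      have "(g has_real_derivative 1 * t powr (- 1)) (at t)" if "t > 0" for t
        unfolding 1 using that by (auto intro!: derivative_eq_intros simp: powr_minus divide_inverse)
      moreover have "(\<lambda>t. 1 * t powr (- 1)) \<in> G"
        unfolding G_def by blast
      ultimately show ?thesis by (intro bexI[of _ "\<lambda>t. 1 * t powr (- 1)"]) auto
    next
      case g: (2 c b)
      have "(g has_real_derivative (c * b) * t powr (b - 1)) (at t)" if "t > 0" for t
        unfolding g using that by (auto intro!: derivative_eq_intros)
      moreover have "(\<lambda>t. (c * b) * t powr (b - 1)) \<in> G"
        unfolding G_def by blast
      ultimately show ?thesis by (intro bexI[of _ "\<lambda>t. (c * b) * t powr (b - 1)"]) auto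
    qed
  qed
  ultimately show ?thesis
    by (rule smooth_on_compose_real[OF assms(1,2), where U = "{0<..}", rotated]) (use assms(3) in auto)
qed

text \<open>Allowing a polynomial in \<open>1 / t\<close> as a factor of
  \<open>exp (- 1 / t)\<close> makes the family closed under differentiation, as
  \<open>smooth_on_compose_real\<close> requires.\<close>

definition flat :: "real poly \<Rightarrow> real \<Rightarrow> real" where
  "flat p t = (if t > 0 then poly p (1 / t) * exp (- (1 / t)) else 0)"

text \<open>With \<open>y = 1 / t\<close> one has \<open>d/dt = - y\<^sup>2 d/dy\<close>, hence the
  factor \<open>monom 1 2\<close> and the difference \<open>p - pderiv p\<close>.\<close>

definition flat_deriv :: "real poly \<Rightarrow> real poly" where
  "flat_deriv p = monom 1 2 * (p - pderiv p)"

lemma poly_times_exp_tendsto_0: "((\<lambda>y::real. poly p y * exp (- y)) \<longlongrightarrow> 0) at_top"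
proof -
  have "((\<lambda>y. \<Sum>i\<le>degree p. coeff p i * (y ^ i / exp y)) \<longlongrightarrow> (\<Sum>i\<le>degree p. coeff p i * 0)) at_top"
    by (intro tendsto_intros tendsto_power_div_exp_0)
  moreover have "(\<lambda>y. \<Sum>i\<le>degree p. coeff p i * (y ^ i / exp y)) = (\<lambda>y. poly p y * exp (- y))"
    by (simp add: fun_eq_iff poly_altdef sum_distrib_right exp_minus divide_inverse mult.assoc)
  ultimately show ?thesis by simp
qed

lemma flat_has_derivative: "(flat p has_real_derivative flat (flat_deriv p) t) (at t)"
proof -
  consider "t > 0" | "t < 0" | "t = 0" by linarith
  then show ?thesis
  proof cases
    case 1
    have "((\<lambda>t. poly p (1 / t) * exp (- (1 / t))) has_real_derivative
      poly (pderiv p) (1 / t) * (- 1 / t\<^sup>2) * exp (- (1 / t)) + poly p (1 / t) * (exp (- (1 / t)) * (1 / t\<^sup>2))) (at t)"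
      using 1 by (auto intro!: derivative_eq_intros DERIV_chain2[OF poly_DERIV] simp: power2_eq_square)
    moreover have "poly (pderiv p) (1 / t) * (- 1 / t\<^sup>2) * exp (- (1 / t)) + poly p (1 / t) * (exp (- (1 / t)) * (1 / t\<^sup>2))
      = flat (flat_deriv p) t"
      using 1 by (simp add: flat_def flat_deriv_def poly_monom power_one_over algebra_simps)
    ultimately have "((\<lambda>t. poly p (1 / t) * exp (- (1 / t))) has_real_derivative flat (flat_deriv p) t) (at t)"
      by simp
    then show ?thesis
      by (rule has_field_derivative_transform_within_open[where S = "{0<..}"]) (use 1 in \<open>auto simp: flat_def\<close>)
  next
    case 2
    have "((\<lambda>t::real. 0::real) has_real_derivative flat (flat_deriv p) t) (at t)"
      using 2 by (simp add: flat_def)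
    then show ?thesis
      by (rule has_field_derivative_transform_within_open[where S = "{..<0}"]) (use 2 in \<open>auto simp: flat_def\<close>)
  next
    case 3
    have "((\<lambda>h. flat p h / h) \<longlongrightarrow> 0) (at 0)"
    proof (rule filterlim_split_at)
      show "((\<lambda>h. flat p h / h) \<longlongrightarrow> 0) (at_left 0)"
        by (rule tendsto_eventually) (auto simp: flat_def eventually_at_filter)
      \<comment> \<open>Dividing by \<open>h\<close> multiplies the polynomial by its variable, so
        exponential decay still wins.\<close>
      have "((\<lambda>h::real. poly (p * monom 1 1) (1 / h) * exp (- (1 / h))) \<longlongrightarrow> 0) (at_right 0)"
        using filterlim_compose[OF poly_times_exp_tendsto_0 filterlim_inverse_at_top_right, of "p * monom 1 1"]
        by (simp add: inverse_eq_divide)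
      then show "((\<lambda>h. flat p h / h) \<longlongrightarrow> 0) (at_right 0)"
      proof (rule Lim_transform_eventually)
        show "\<forall>\<^sub>F h in at_right 0. poly (p * monom 1 1) (1 / h) * exp (- (1 / h)) = flat p h / h"
          by (auto simp: eventually_at_filter flat_def poly_monom)
      qed
    qed
    then show ?thesis
      unfolding DERIV_def 3 by (simp add: flat_def)
  qed
qed

lemma smooth_on_flat:
  assumes "open S" "smooth_on S f"
  shows "smooth_on S (\<lambda>x. flat p (f x))"
  by (rule smooth_on_compose_real[OF assms, where U = UNIV and G = "range flat"])
    (auto intro: flat_has_derivative)

definition bump :: "real \<Rightarrow> real" where
  "bump t = flat 1 (t - 1) * flat 1 (2 - t)"
definition bump1 :: "real \<Rightarrow> real" where
  "bump1 t = flat (flat_deriv 1) (t - 1) * flat 1 (2 - t) - flat 1 (t - 1) * flat (flat_deriv 1) (2 - t)"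
definition bump2 :: "real \<Rightarrow> real" where
  "bump2 t = flat (flat_deriv (flat_deriv 1)) (t - 1) * flat 1 (2 - t)
    - 2 * (flat (flat_deriv 1) (t - 1) * flat (flat_deriv 1) (2 - t))
    + flat 1 (t - 1) * flat (flat_deriv (flat_deriv 1)) (2 - t)"

lemma flat_DERIV_chain: "(f has_real_derivative D) (at t) \<Longrightarrow> ((\<lambda>t. flat p (f t)) has_real_derivative flat (flat_deriv p) (f t) * D) (at t)"
  by (rule DERIV_chain2[OF flat_has_derivative])

lemma bump_DERIV: "(bump has_real_derivative bump1 t) (at t)" and bump1_DERIV: "(bump1 has_real_derivative bump2 t) (at t)"
  unfolding bump_def[abs_def] bump1_def[abs_def] bump2_def
  by (auto intro!: derivative_eq_intros flat_DERIV_chain)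

lemma bump_outside: "t \<le> 1 \<or> t \<ge> 2 \<Longrightarrow> bump t = 0" and bump2_outside: "t \<le> 1 \<or> t \<ge> 2 \<Longrightarrow> bump2 t = 0"
  by (auto simp: bump_def bump2_def flat_def)

lemma bump_pos: "1 < t \<Longrightarrow> t < 2 \<Longrightarrow> bump t > 0"
  by (simp add: bump_def flat_def)

lemma continuous_flat: "continuous_on UNIV (flat p)"
  by (rule DERIV_continuous_on[OF has_field_derivative_at_within[OF flat_has_derivative]])

lemma continuous_bump: "continuous_on UNIV bump" and continuous_bump2: "continuous_on UNIV bump2"
  unfolding bump_def[abs_def] bump2_def[abs_def]
  by (intro continuous_intros continuous_on_compose2[OF continuous_flat]; simp)+

definition vfun :: "real \<Rightarrow> real \<Rightarrow> real" where "vfun R r = sqrt r * bump (ln r / R)"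
definition vfun1 :: "real \<Rightarrow> real \<Rightarrow> real" where "vfun1 R r = (bump (ln r / R) / 2 + bump1 (ln r / R) / R) / sqrt r"
text \<open>The second derivative of \<open>vfun R\<close>. The \<open>bump1\<close> terms cancel,
  and \<open>- 1/4\<close> appears because \<open>sqrt\<close> solves
  \<open>v'' + v / (4 r\<^sup>2) = 0\<close>, the Euler equation of the Hardy inequality.\<close>

definition vfun2 :: "real \<Rightarrow> real \<Rightarrow> real" where "vfun2 R r = (bump2 (ln r / R) / R\<^sup>2 - bump (ln r / R) / 4) / (r * sqrt r)"

lemma DERIV_bump_ln:
  assumes "r > 0" "R > 0"
  shows "((\<lambda>r. bump (ln r / R)) has_real_derivative bump1 (ln r / R) / (R * r)) (at r)"
    and "((\<lambda>r. bump1 (ln r / R)) has_real_derivative bump2 (ln r / R) / (R * r)) (at r)"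
proof -
  have "((\<lambda>r. ln r / R) has_real_derivative 1 / (R * r)) (at r)"
    using assms by (auto intro!: derivative_eq_intros)
  from DERIV_chain2[OF bump_DERIV this] DERIV_chain2[OF bump1_DERIV this]
  show "((\<lambda>r. bump (ln r / R)) has_real_derivative bump1 (ln r / R) / (R * r)) (at r)"
    "((\<lambda>r. bump1 (ln r / R)) has_real_derivative bump2 (ln r / R) / (R * r)) (at r)" by simp_all
qed

lemma vfun_DERIV:
  assumes "r > 0" "R > 0"
  shows "(vfun R has_real_derivative vfun1 R r) (at r)"
    and "(vfun1 R has_real_derivative vfun2 R r) (at r)"
proof -
  have s: "((\<lambda>r. sqrt r) has_real_derivative 1 / (2 * sqrt r)) (at r)"
    using assms DERIV_real_sqrt[of r] by (simp add: field_simps)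
  have q: "sqrt r > 0" "sqrt r * sqrt r = r" using assms by auto
  define w where "w = sqrt r"
  have w: "w > 0" "r = w * w" using q by (auto simp: w_def)
  show "(vfun R has_real_derivative vfun1 R r) (at r)"
    unfolding vfun_def[abs_def] vfun1_def
    by (rule DERIV_cong[OF DERIV_mult[OF s DERIV_bump_ln(1)[OF assms]]])
      (use w assms(2) in \<open>simp add: w_def[symmetric] field_simps\<close>)
  have d: "((\<lambda>r. bump (ln r / R) / 2 + bump1 (ln r / R) / R) has_real_derivative
      bump1 (ln r / R) / (R * r) / 2 + bump2 (ln r / R) / (R * r) / R) (at r)"
    by (intro DERIV_add DERIV_cdivide DERIV_bump_ln assms)
  show "(vfun1 R has_real_derivative vfun2 R r) (at r)"
    unfolding vfun1_def[abs_def] vfun2_def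
    by (rule DERIV_cong[OF DERIV_divide[OF d s]])
      (use w assms(2) in \<open>simp_all add: w_def[symmetric], simp add: field_simps power2_eq_square\<close>)
qed

definition tfun :: "real \<Rightarrow> real^'n \<Rightarrow> real" where
  "tfun R x = (if x \<in> hball \<and> x \<noteq> 0 then sh x powr (- ((real CARD('n) - 1) / 2)) * vfun R (rd x) else 0)"

text \<open>For \<open>norm x < 1/3\<close> one has \<open>sinh r < 1\<close>, hence
  \<open>r < 1\<close>. This keeps the test functions away from the origin.\<close>

lemma rd_ge_1_imp: "x \<in> hball \<Longrightarrow> rd x \<ge> 1 \<Longrightarrow> norm x \<ge> 1 / 3"
proof (rule ccontr)
  assume x: "x \<in> hball" "rd x \<ge> 1" "\<not> norm x \<ge> 1 / 3"
  then have "(norm x)\<^sup>2 \<le> (1/3)\<^sup>2" by (intro power_mono) auto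
  then have "1 - (norm x)\<^sup>2 \<ge> 8 / 9" by (simp add: power2_eq_square)
  moreover have "2 * norm x < 2 / 3" using x by simp
  ultimately have "sh x < 1" unfolding sh_def by (subst divide_less_eq_1_pos) linarith+
  then show False using rd_le_sh[OF x(1)] x(2) by linarith
qed

lemma vfun_support:
  assumes "r > 0" "R > 0" "vfun R r \<noteq> 0"
  shows "exp R < r" "r < exp (2 * R)"
proof -
  have "bump (ln r / R) \<noteq> 0" using assms by (simp add: vfun_def)
  then have "\<not> (ln r / R \<le> 1 \<or> ln r / R \<ge> 2)" using bump_outside by metis
  then have "1 < ln r / R" "ln r / R < 2" by auto
  then have "R < ln r" "ln r < 2 * R" using assms by (simp_all add: field_simps)
  then show "exp R < r" "r < exp (2 * R)"
    using assms(1) by (metis exp_less_mono exp_ln)+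
qed

text \<open>From \<open>1 / (1 - |x|\<^sup>2) \<le> cosh r\<close>: a bounded hyperbolic distance
  confines \<open>x\<close> to a compact part of the ball.\<close>

lemma rd_bounded_imp:
  assumes "x \<in> hball" "rd x \<le> b" "b \<ge> 0"
  shows "(norm x)\<^sup>2 \<le> 1 - 1 / cosh b"
proof -
  have q: "1 - (norm x)\<^sup>2 > 0" using assms by (simp add: mem_hball abs_square_less_1)
  have "1 / (1 - (norm x)\<^sup>2) \<le> ch x"
    unfolding ch_def using q by (intro divide_right_mono) auto
  also have "\<dots> \<le> cosh b"
    using assms cosh_rd[OF assms(1)] rd_nonneg[OF assms(1)] cosh_real_nonneg_le_iff[of "rd x" b] by simp
  finally show ?thesis
    using q cosh_real_pos[of b] by (simp add: field_simps)
qed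

lemma tfun_in_Cc:
  assumes R: "R > 0"
  shows "tfun R \<in> (Cc_inf_H :: (real^'n \<Rightarrow> real) set)"
proof -
  let ?S = "hball - {0} :: (real^'n) set"
  have S: "open ?S" by (intro open_Diff) auto
  have q1: "1 - (norm x)\<^sup>2 > 0" if "x \<in> hball" for x :: "real^'n"
    using that by (simp add: mem_hball abs_square_less_1)
  have si: "smooth_on ?S (\<lambda>x. inverse (1 - (norm x)\<^sup>2))"
    by (intro smooth_on_inverse smooth_on_diff smooth_on_const smooth_on_norm_sq S) (use q1 in force)
  have "smooth_on ?S (\<lambda>x. ((norm x)\<^sup>2) powr (1/2))"
    by (intro smooth_on_powr smooth_on_norm_sq S) auto
  then have sn: "smooth_on ?S norm"
    by (rule smooth_on_cong[OF S, rotated]) (simp add: powr_half_sqrt)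
  have "smooth_on ?S (\<lambda>x. 2 * norm x * inverse (1 - (norm x)\<^sup>2))"
    by (intro smooth_on_mult smooth_on_const si sn S)
  then have ssh: "smooth_on ?S sh" by (simp add: sh_def[abs_def] divide_inverse)
  have "smooth_on ?S (\<lambda>x. (1 + (norm x)\<^sup>2) * inverse (1 - (norm x)\<^sup>2))"
    by (intro smooth_on_mult smooth_on_add smooth_on_const smooth_on_norm_sq si S)
  then have sch: "smooth_on ?S ch" by (simp add: ch_def[abs_def] divide_inverse)
  \<comment> \<open>Since \<open>r = ln (cosh r + sinh r)\<close>, smoothness of the distance off
    the centre reduces to that of a logarithm.\<close>
  have "smooth_on ?S (\<lambda>x. ln (ch x + sh x))"
    by (intro smooth_on_ln smooth_on_add ssh sch S) (metis DiffE add_nonneg_pos ch_ge_1 insertI1 le_numeral_extra(1) order_trans sh_pos)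
  then have srd: "smooth_on ?S rd"
  proof (rule smooth_on_cong[OF S, rotated])
    fix x assume "x \<in> ?S"
    then have x: "x \<in> hball" by simp
    show "ln (ch x + sh x) = rd x"
      using ch_sq[OF x] sh_nonneg[OF x] by (simp add: rd_def arcosh_real_def ch_ge_1[OF x])
  qed
  have sln: "smooth_on ?S (\<lambda>x. ln (rd x) * (1 / R))"
    by (intro smooth_on_mult smooth_on_const smooth_on_ln srd S) (auto simp: rd_pos)
  have "smooth_on ?S (\<lambda>x. sh x powr (- ((real CARD('n) - 1) / 2)) * (rd x powr (1/2) *
      (flat 1 (ln (rd x) * (1 / R) - 1) * flat 1 (2 - ln (rd x) * (1 / R)))))"
    by (intro smooth_on_mult smooth_on_powr smooth_on_flat smooth_on_diff smooth_on_const sln srd ssh S)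
      (auto simp: rd_pos sh_pos)
  then have 1: "smooth_on ?S (tfun R)"
    by (rule smooth_on_cong[OF S, rotated]) (simp add: tfun_def vfun_def bump_def powr_half_sqrt rd_nonneg)
  have z: "tfun R x = 0" if "norm x < 1 / 3" for x :: "real^'n"
  proof (rule ccontr)
    assume "tfun R x \<noteq> 0"
    then have x: "x \<in> hball" "x \<noteq> 0" "vfun R (rd x) \<noteq> 0" by (auto simp: tfun_def split: if_splits)
    then have "rd x > exp R" using vfun_support[OF rd_pos R] by blast
    moreover have "exp R \<ge> 1" using R by simp
    ultimately have "rd x \<ge> 1" by linarith
    then show False using rd_ge_1_imp[OF x(1)] that by linarith
  qed
  have 2: "smooth_on (ball 0 (1/3)) (tfun R :: real^'n \<Rightarrow> real)"
    by (rule smooth_on_cong[OF open_ball _ smooth_on_const[of _ 0]]) (simp add: z)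
  have "?S \<union> ball 0 (1/3) = hball" by (auto simp: mem_hball)
  with smooth_on_Un[OF S open_ball 1 2] have sm: "smooth_on hball (tfun R :: real^'n \<Rightarrow> real)" by simp
  have c: "1 - 1 / cosh (exp (2 * R)) < 1" "1 - 1 / cosh (exp (2 * R)) \<ge> 0"
    using cosh_real_ge_1[of "exp (2 * R)"] by auto
  show ?thesis
  proof (rule Cc_inf_HI[OF sm])
    show "sqrt (1 - 1 / cosh (exp (2 * R))) < 1" using c by simp
    show "tfun R x = 0" if "norm x > sqrt (1 - 1 / cosh (exp (2 * R)))" for x :: "real^'n"
    proof (rule ccontr)
      assume "tfun R x \<noteq> 0"
      then have x: "x \<in> hball" "x \<noteq> 0" "vfun R (rd x) \<noteq> 0" by (auto simp: tfun_def split: if_splits)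
      then have "rd x < exp (2 * R)" using vfun_support[OF rd_pos R] by blast
      then have "(norm x)\<^sup>2 \<le> 1 - 1 / cosh (exp (2 * R))"
        by (intro rd_bounded_imp x) auto
      then have "norm x \<le> sqrt (1 - 1 / cosh (exp (2 * R)))"
        by (simp add: real_le_rsqrt)
      then show False using that by linarith
    qed
  qed
qed

text \<open>The direction \<open>h\<close> of rotation is orthogonal to \<open>x\<close>, so
  \<open>x + t *\<^sub>R h\<close> and \<open>x - t *\<^sub>R h\<close> have the same norm. Along
  this line \<open>u\<close> is even in \<open>t\<close>, and its derivative at 0 vanishes.\<close>

lemma rot_radial_eq_0:
  fixes u :: "real^'n \<Rightarrow> real"
  assumes u: "u \<in> Cc_inf_H" and rad: "\<And>x y. norm x = norm y \<Longrightarrow> u x = u y"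
  shows "rot i j u x = 0"
proof -
  define h where "h = x $ i *\<^sub>R axis j 1 - x $ j *\<^sub>R axis i (1::real)"
  define D where "D = (\<Sum>k\<in>UNIV. h $ k * partial k u x)"
  have xh: "x \<bullet> h = 0" by (simp add: h_def inner_diff_right inner_axis)
  have rD: "rot i j u x = D"
    unfolding rot_has_derivative[OF Cc_inf_H_has_derivative[OF u]] D_def h_def ..
  have "((\<lambda>t. x + t *\<^sub>R h) has_derivative (\<lambda>t. t *\<^sub>R h)) (at 0)"
    by (auto intro!: derivative_eq_intros)
  moreover have "(u has_derivative (\<lambda>h. \<Sum>k\<in>UNIV. h $ k * partial k u x)) (at (x + 0 *\<^sub>R h))"
    using Cc_inf_H_has_derivative[OF u, of x] by simp
  ultimately have "((\<lambda>t. u (x + t *\<^sub>R h)) has_derivative (\<lambda>t. \<Sum>k\<in>UNIV. (t *\<^sub>R h) $ k * partial k u x)) (at 0)"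
    by (rule has_derivative_compose)
  moreover have "(\<lambda>t. \<Sum>k\<in>UNIV. (t *\<^sub>R h) $ k * partial k u x) = (*) D"
    by (simp add: fun_eq_iff D_def sum_distrib_left sum_distrib_right mult_ac)
  ultimately have 1: "((\<lambda>t. u (x + t *\<^sub>R h)) has_real_derivative D) (at 0)"
    by (simp add: has_field_derivative_def)
  have "((\<lambda>t::real. - t) has_real_derivative - 1) (at 0)" by (auto intro!: derivative_eq_intros)
  with 1 have "((\<lambda>t. u (x + (- t) *\<^sub>R h)) has_real_derivative D * - 1) (at 0)"
    using DERIV_chain2[of "\<lambda>t. u (x + t *\<^sub>R h)" D uminus 0 "-1" UNIV] by simp
  moreover have "u (x + (- t) *\<^sub>R h) = u (x + t *\<^sub>R h)" for t
  proof (rule rad)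
    have "(norm (x + s *\<^sub>R h))\<^sup>2 = (norm x)\<^sup>2 + s\<^sup>2 * (norm h)\<^sup>2" for s
      unfolding power2_norm_eq_inner
      by (simp add: inner_add_left inner_add_right xh inner_commute[of h x] power2_eq_square)
    from this[of t] this[of "- t"] show "norm (x + (- t) *\<^sub>R h) = norm (x + t *\<^sub>R h)"
      by (metis norm_ge_zero power2_eq_iff_nonneg power2_minus)
  qed
  ultimately have "((\<lambda>t. u (x + t *\<^sub>R h)) has_real_derivative D * - 1) (at 0)" by simp
  with 1 have "D = D * - 1" by (rule DERIV_unique)
  then show ?thesis using rD by simp
qed

lemma euler_radial:
  fixes u :: "real^'n \<Rightarrow> real"
  assumes u: "u \<in> Cc_inf_H" and F: "\<And>y. y \<in> hball \<Longrightarrow> y \<noteq> 0 \<Longrightarrow> u y = F (rd y)"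
    and x: "x \<in> hball" "x \<noteq> 0" and D: "(F has_real_derivative D) (at (rd x))"
  shows "euler u x = sh x * D"
proof -
  have "((\<lambda>k. F (rd (k *\<^sub>R x))) has_real_derivative D * sh x) (at 1)"
    using DERIV_chain2[of F D "\<lambda>k. rd (k *\<^sub>R x)" 1, OF _ dilation_DERIV_rd[OF x]] D by simp
  then have "((\<lambda>k. u (k *\<^sub>R x)) has_real_derivative D * sh x) (at 1)"
  proof (rule has_field_derivative_transform_within_open)
    show "open {k. k *\<^sub>R x \<in> hball - {0}}"
    proof -
      have "open ((\<lambda>k. k *\<^sub>R x) -` (hball - {0}))"
        by (intro continuous_open_vimage continuous_intros open_Diff open_hball closed_singleton)
      then show ?thesis by (simp add: vimage_def)
    qed
  qed (use x F in auto)
  from DERIV_unique[OF euler_DERIV[OF u one_neq_zero] this] show ?thesis by simp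
qed

text \<open>Conjugation with \<open>sinh\<^sup>-\<^sup>n r\<close> removes the first-order term of
  the radial Laplacian; \<open>cosh\<^sup>2 r = 1 + sinh\<^sup>2 r\<close> splits the resulting
  potential into \<open>n\<^sup>2\<close> and \<open>n (n - 1) / sinh\<^sup>2 r\<close>.\<close>

lemma tfun_laplacian:
  fixes x :: "real^'n"
  assumes R: "R > 0" and x: "x \<in> hball" "x \<noteq> 0"
  defines "n \<equiv> (real CARD('n) - 1) / 2"
  shows "hyp_laplacian (tfun R) x = sh x powr (- n) * (vfun2 R (rd x) - n\<^sup>2 * vfun R (rd x) - n * (n - 1) * (vfun R (rd x) / (sh x)\<^sup>2))"
proof -
  let ?u = "tfun R :: real^'n \<Rightarrow> real"
  have u: "?u \<in> Cc_inf_H" by (rule tfun_in_Cc[OF R])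
  define P where "P r = sinh r powr (- n)" for r :: real
  define F where "F r = P r * vfun R r" for r
  define F1 where "F1 r = P r * (vfun1 R r - n * (cosh r / sinh r) * vfun R r)" for r
  \<comment> \<open>\<open>F2 r\<close> is \<open>sinh r * F1 r\<close>, the profile of
    \<open>E u\<close> free of division in the bracket; \<open>F3\<close> is its derivative.\<close>
  define F2 where "F2 r = P r * (sinh r * vfun1 R r - n * cosh r * vfun R r)" for r
  define F3 where "F3 r = P r * (- n * (cosh r / sinh r)) * (sinh r * vfun1 R r - n * cosh r * vfun R r)
      + P r * (cosh r * vfun1 R r + sinh r * vfun2 R r - n * (sinh r * vfun R r + cosh r * vfun1 R r))" for r
  have DP: "(P has_real_derivative P r * (- n * (cosh r / sinh r))) (at r)" if "r > 0" for r
  proof -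
    have s: "sinh r > 0" using that by simp
    have "((\<lambda>r. sinh r powr (- n)) has_real_derivative (- n) * sinh r powr (- n - 1) * cosh r) (at r)"
      using s by (auto intro!: derivative_eq_intros simp: powr_diff)
    moreover have "(- n) * sinh r powr (- n - 1) * cosh r = P r * (- n * (cosh r / sinh r))"
      using s by (simp add: P_def powr_diff)
    ultimately show ?thesis unfolding P_def[abs_def] by simp
  qed
  have DF: "(F has_real_derivative F1 r) (at r)" if "r > 0" for r
    unfolding F_def[abs_def] F1_def
    by (rule DERIV_cong[OF DERIV_mult[OF DP[OF that] vfun_DERIV(1)[OF that R]]]) (simp add: algebra_simps)
  have DF2: "(F2 has_real_derivative F3 r) (at r)" if "r > 0" for r
  proof -
    have s: "(sinh has_real_derivative cosh r) (at r)" and c: "(cosh has_real_derivative sinh r) (at r)"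
      by (auto intro!: derivative_eq_intros)
    have "((\<lambda>r. sinh r * vfun1 R r - n * cosh r * vfun R r) has_real_derivative
      cosh r * vfun1 R r + sinh r * vfun2 R r - n * (sinh r * vfun R r + cosh r * vfun1 R r)) (at r)"
      by (rule DERIV_cong[OF DERIV_diff[OF DERIV_mult[OF s vfun_DERIV(2)[OF that R]]
              DERIV_mult[OF DERIV_cmult[OF c] vfun_DERIV(1)[OF that R]]]]) (simp add: algebra_simps)
    from DERIV_mult[OF DP[OF that] this] show ?thesis
      unfolding F2_def[abs_def] F3_def by (simp add: mult_ac)
  qed
  have uF: "?u y = F (rd y)" if "y \<in> hball" "y \<noteq> 0" for y
    using that by (simp add: tfun_def F_def P_def n_def sinh_rd)
  have e1: "euler ?u y = F2 (rd y)" if "y \<in> hball" "y \<noteq> 0" for y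
  proof -
    have "euler ?u y = sh y * F1 (rd y)"
      by (rule euler_radial[OF u uF that DF[OF rd_pos[OF that]]])
    also have "\<dots> = P (rd y) * (sh y * (vfun1 R (rd y) - n * (ch y / sh y) * vfun R (rd y)))"
      by (simp add: F1_def sinh_rd[OF that(1)] cosh_rd[OF that(1)])
    also have "sh y * (vfun1 R (rd y) - n * (ch y / sh y) * vfun R (rd y)) = sh y * vfun1 R (rd y) - n * ch y * vfun R (rd y)"
      using sh_pos[OF that] by (simp add: right_diff_distrib)
    finally show ?thesis
      by (simp add: F2_def sinh_rd[OF that(1)] cosh_rd[OF that(1)])
  qed
  have e2: "euler (euler ?u) x = sh x * F3 (rd x)"
    by (rule euler_radial[OF Cc_inf_H_euler[OF u] e1 x DF2[OF rd_pos[OF x]]])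
  have r: "norm y = norm z \<Longrightarrow> ?u y = ?u z" for y z
  proof -
    assume *: "norm y = norm z"
    have "y = 0 \<longleftrightarrow> z = 0" using * by (metis norm_eq_zero)
    moreover have "sh y = sh z" "rd y = rd z" "y \<in> hball \<longleftrightarrow> z \<in> hball"
      unfolding sh_def rd_def ch_def mem_hball * by simp_all
    ultimately show ?thesis by (simp add: tfun_def)
  qed
  have "rot i j ?u = (\<lambda>x. 0)" for i j
    by (rule ext) (rule rot_radial_eq_0[OF u r])
  then have z: "rot i j (rot i j ?u) x = 0" for i j
    by (simp add: rot_def partial_def)
  define s c v v1 v2 where "s = sh x" and "c = ch x" and "v = vfun R (rd x)" and "v1 = vfun1 R (rd x)" and "v2 = vfun2 R (rd x)"
  have s: "s > 0" using sh_pos[OF x] by (simp add: s_def)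
  have cs: "c\<^sup>2 = 1 + s\<^sup>2" using ch_sq[OF x(1)] by (simp add: s_def c_def)
  have Pr: "P (rd x) = s powr (- n)" by (simp add: P_def sinh_rd[OF x(1)] s_def)
  have N: "real CARD('n) - 2 = 2 * n - 1"
  proof -
    have "2 * n = real CARD('n) - 1" by (simp add: n_def)
    then show ?thesis by linarith
  qed
  have "s\<^sup>2 * hyp_laplacian ?u x = s * F3 (rd x) + (2 * n - 1) * c * F2 (rd x)"
    using hyp_laplacian_decomposition[OF u x(1)] unfolding z N e1[OF x] e2
    by (simp add: s_def c_def sh_def ch_def)
  also have "\<dots> = s powr (- n) * (s * ((- n * (c / s)) * (s * v1 - n * c * v)
      + (c * v1 + s * v2 - n * (s * v + c * v1))) + (2 * n - 1) * c * (s * v1 - n * c * v))"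
    unfolding F2_def F3_def Pr v_def[symmetric] v1_def[symmetric] v2_def[symmetric] sinh_rd[OF x(1)] cosh_rd[OF x(1)] s_def[symmetric] c_def[symmetric]
    by (simp only: distrib_left mult.assoc mult.left_commute[of _ "s powr (- n)"] mult.commute[of _ "s powr (- n)"])
  also have "s * ((- n * (c / s)) * (s * v1 - n * c * v)
      + (c * v1 + s * v2 - n * (s * v + c * v1))) + (2 * n - 1) * c * (s * v1 - n * c * v)
      = - n * c * (s * v1 - n * c * v) + s * (c * v1 + s * v2 - n * (s * v + c * v1)) + (2 * n - 1) * c * (s * v1 - n * c * v)"
    using s by (simp add: distrib_left right_diff_distrib)
  also have "\<dots> = s\<^sup>2 * v2 - n\<^sup>2 * s\<^sup>2 * v - n * (n - 1) * v"
    using cs by algebra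
  also have "\<dots> = s\<^sup>2 * (v2 - n\<^sup>2 * v - n * (n - 1) * (v / s\<^sup>2))"
    using s by (simp add: right_diff_distrib[of "s\<^sup>2"])
  finally have "s\<^sup>2 * hyp_laplacian ?u x = s\<^sup>2 * (s powr (- n) * (v2 - n\<^sup>2 * v - n * (n - 1) * (v / s\<^sup>2)))"
    by (simp add: mult_ac)
  then show ?thesis using s by (simp add: s_def v_def v2_def)
qed

text \<open>Since \<open>dx / |x|\<^sup>N\<close> is \<open>dr / sinh r\<close> times the surface
  measure of the unit sphere, the integral against it is a fixed multiple of that of
  \<open>\<psi> (ln r / R) / r\<close>, hence of \<open>R\<close> times the integral of
  \<open>\<psi>\<close>.\<close>

definition annulus :: "real \<Rightarrow> (real \<Rightarrow> real) \<Rightarrow> real^'n \<Rightarrow> real" where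
  "annulus R \<psi> x = (if x \<in> hball \<and> x \<noteq> 0 then sh x / rd x * \<psi> (ln (rd x) / R) else 0)"

lemma annulus_facts:
  fixes \<psi> :: "real \<Rightarrow> real"
  assumes R: "R > 0" and ct: "continuous_on UNIV \<psi>" and z: "\<And>t. t \<le> 1 \<or> t \<ge> 2 \<Longrightarrow> \<psi> t = 0"
  shows annulus_measurable: "(annulus R \<psi> :: real^'n \<Rightarrow> real) \<in> borel_measurable borel"
    and annulus_bound: "\<exists>C\<ge>0. \<forall>x::real^'n. \<bar>annulus R \<psi> x\<bar> \<le> C * norm x"
    and annulus_vanish: "norm (x::real^'n) \<ge> 1 \<Longrightarrow> annulus R \<psi> x = 0"
    and annulus_integrable: "integrable lborel (\<lambda>x::real^'n. annulus R \<psi> x / norm x ^ CARD('n))"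
proof -
  have [measurable]: "\<psi> \<in> borel_measurable borel" by (rule borel_measurable_continuous_onI[OF ct])
  have [measurable]: "hball \<in> sets (borel :: (real^'n) measure)" by (simp add: hball_def)
  show m: "(annulus R \<psi> :: real^'n \<Rightarrow> real) \<in> borel_measurable borel"
    unfolding annulus_def[abs_def] by measurable
  have "compact (\<psi> ` {1..2})"
    by (intro compact_continuous_image continuous_on_subset[OF ct]) auto
  then obtain B where B: "B > 0" "\<And>y. y \<in> \<psi> ` {1..2} \<Longrightarrow> norm y \<le> B"
    using compact_imp_bounded[of "\<psi> ` {1..2}"] unfolding bounded_pos by blast
  have Bb: "\<bar>\<psi> t\<bar> \<le> B" for t
    using B(2)[of "\<psi> t"] z[of t] B(1) by (cases "1 \<le> t \<and> t \<le> 2") auto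
  define S where "S = sinh (exp (2 * R))"
  have S: "S \<ge> 0" by (simp add: S_def)
  have b: "\<bar>annulus R \<psi> x\<bar> \<le> 3 * S * B * norm x" for x :: "real^'n"
  proof (cases "annulus R \<psi> x = 0")
    case True
    then show ?thesis using S B by simp
  next
    case False
    then have x: "x \<in> hball" "x \<noteq> 0" "\<psi> (ln (rd x) / R) \<noteq> 0" by (auto simp: annulus_def split: if_splits)
    note r = rd_pos[OF x(1,2)]
    have "\<not> (ln (rd x) / R \<le> 1 \<or> ln (rd x) / R \<ge> 2)" using z x(3) by metis
    then have "R < ln (rd x)" "ln (rd x) < 2 * R" using R by (auto simp: field_simps)
    then have r2: "exp R < rd x" "rd x < exp (2 * R)" using r by (metis exp_less_mono exp_ln)+
    have "exp R \<ge> 1" using R by simp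
    with r2 have r1: "rd x \<ge> 1" by linarith
    have n3: "norm x \<ge> 1 / 3" by (rule rd_ge_1_imp[OF x(1) r1])
    have "sh x \<le> S" using r2 sinh_rd[OF x(1)] by (simp add: S_def flip: sinh_rd[OF x(1)])
    have "\<bar>annulus R \<psi> x\<bar> = sh x / rd x * \<bar>\<psi> (ln (rd x) / R)\<bar>"
      using x r sh_pos[OF x(1,2)] by (simp add: annulus_def abs_mult)
    also have "\<dots> \<le> sh x / 1 * B"
      using sh_pos[OF x(1,2)] r1 Bb B by (intro mult_mono divide_left_mono) auto
    also have "\<dots> \<le> S * B * 1" using \<open>sh x \<le> S\<close> B by simp
    also have "\<dots> \<le> S * B * (3 * norm x)" using n3 S B by (intro mult_left_mono) auto
    finally show ?thesis by simp
  qed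
  then show "\<exists>C\<ge>0. \<forall>x::real^'n. \<bar>annulus R \<psi> x\<bar> \<le> C * norm x"
    using S B by (intro exI[of _ "3 * S * B"]) auto
  have v: "annulus R \<psi> x = 0" if "norm x \<ge> 1" for x :: "real^'n"
    using that by (simp add: annulus_def mem_hball)
  then show "norm (x::real^'n) \<ge> 1 \<Longrightarrow> annulus R \<psi> x = 0" .
  show "integrable lborel (\<lambda>x::real^'n. annulus R \<psi> x / norm x ^ CARD('n))"
    by (rule integrable_over_norm_power[OF m b v])
qed

text \<open>A profile of mean zero has a compactly supported primitive, so that its radial integral vanishes.\<close>

lemma annulus_integral_eq_0:
  fixes \<psi> :: "real \<Rightarrow> real"
  assumes R: "R > 0" and ct: "continuous_on UNIV \<psi>" and z: "\<And>t. t \<le> 1 \<or> t \<ge> 2 \<Longrightarrow> \<psi> t = 0"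
    and i0: "integral {0..2} \<psi> = 0"
  shows "(\<integral>x. annulus R \<psi> (x::real^'n) / norm x ^ CARD('n) \<partial>lborel) = 0"
proof -
  \<comment> \<open>The factor \<open>R\<close> cancels the inner derivative of
    \<open>ln r / R\<close>, so \<open>E\<close> maps \<open>h (ln r / R)\<close> to
    \<open>annulus R \<psi>\<close>.\<close>
  define h where "h t = R * integral {0..t} \<psi>" for t
  have io: "\<psi> integrable_on {a..b}" for a b
    by (intro integrable_continuous_real continuous_on_subset[OF ct]) auto
  have h1: "h t = 0" if "t < 1" for t
  proof -
    have "integral {0..t} \<psi> = integral {0..t} (\<lambda>_. 0)" by (rule integral_cong) (use that z in auto)
    then show ?thesis by (simp add: h_def)
  qed
  have h2: "h t = 0" if "t \<ge> 2" for t
  proof -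
    have "integral {2..t} \<psi> = integral {2..t} (\<lambda>_. 0)" by (rule integral_cong) (use that z in auto)
    moreover have "integral {0..2} \<psi> + integral {2..t} \<psi> = integral {0..t} \<psi>"
      using that by (intro Henstock_Kurzweil_Integration.integral_combine io) auto
    ultimately show ?thesis using i0 by (simp add: h_def)
  qed
  have hD: "(h has_real_derivative R * \<psi> t) (at t)" for t
  proof (cases "t < 1")
    case True
    have "((\<lambda>t::real. 0::real) has_real_derivative R * \<psi> t) (at t)" using z[of t] True by simp
    then show ?thesis
      by (rule has_field_derivative_transform_within_open[where S = "{..<1}"]) (use True h1 in auto)
  next
    case False
    have "((\<lambda>x. integral {0..x} \<psi>) has_real_derivative \<psi> t) (at t within {0..t + 1})"
      using False by (intro integral_has_real_derivative continuous_on_subset[OF ct]) auto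
    then have "((\<lambda>x. integral {0..x} \<psi>) has_real_derivative \<psi> t) (at t)"
      using False by (simp add: at_within_Icc_at)
    then show ?thesis unfolding h_def[abs_def] by (rule DERIV_cmult)
  qed
  have hct: "continuous_on UNIV h"
    by (rule DERIV_continuous_on[OF has_field_derivative_at_within[OF hD]])
  have [measurable]: "h \<in> borel_measurable borel" by (rule borel_measurable_continuous_onI[OF hct])
  have [measurable]: "hball \<in> sets (borel :: (real^'n) measure)" by (simp add: hball_def)
  have "compact (h ` {1..2})"
    by (intro compact_continuous_image continuous_on_subset[OF hct]) auto
  then obtain B where B: "B > 0" "\<And>y. y \<in> h ` {1..2} \<Longrightarrow> norm y \<le> B"
    using compact_imp_bounded[of "h ` {1..2}"] unfolding bounded_pos by blast
  have Bb: "\<bar>h t\<bar> \<le> B" for t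
    using B(2)[of "h t"] h1[of t] h2[of t] B(1) by (cases "1 \<le> t \<and> t \<le> 2") auto
  define G where "G x = (if x \<in> hball \<and> x \<noteq> 0 then h (ln (rd x) / R) else 0)" for x :: "real^'n"
  have Gm: "G \<in> borel_measurable borel" unfolding G_def[abs_def] by measurable
  obtain C where C: "C \<ge> 0" "\<And>x::real^'n. \<bar>annulus R \<psi> x\<bar> \<le> C * norm x"
    using annulus_bound[OF R ct z] by blast
  have Gs: "exp R \<le> rd x" "rd x \<le> exp (2 * R)" "x \<in> hball" if "G x \<noteq> 0" for x
  proof -
    have x: "x \<in> hball" "x \<noteq> 0" "h (ln (rd x) / R) \<noteq> 0" using that by (auto simp: G_def split: if_splits)
    note r = rd_pos[OF x(1,2)]
    have "1 \<le> ln (rd x) / R" "ln (rd x) / R \<le> 2" using h1 h2 x(3) by (meson linorder_not_less less_imp_le)+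
    then have "R \<le> ln (rd x)" "ln (rd x) \<le> 2 * R" using R by (auto simp: field_simps)
    then show "exp R \<le> rd x" "rd x \<le> exp (2 * R)" "x \<in> hball" using r x by (metis exp_le_cancel_iff exp_ln)+
  qed
  have Gb: "\<bar>G x\<bar> \<le> 3 * B * norm x" for x
  proof (cases "G x = 0")
    case True
    then show ?thesis using B by simp
  next
    case False
    have "exp R \<ge> 1" using R by simp
    then have "rd x \<ge> 1" using Gs(1)[OF False] by linarith
    then have "norm x \<ge> 1 / 3" by (rule rd_ge_1_imp[OF Gs(3)[OF False]])
    then have "B * 1 \<le> B * (3 * norm x)" using B by (intro mult_left_mono) auto
    moreover have "\<bar>G x\<bar> \<le> B" using Bb B by (simp add: G_def)
    ultimately show ?thesis by simp
  qed
  have GD: "((\<lambda>k. G (k *\<^sub>R x)) has_real_derivative annulus R \<psi> x) (at 1)" if "x \<noteq> 0" for x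
  proof (cases "x \<in> hball")
    case True
    have r: "rd x > 0" by (rule rd_pos[OF True that])
    have "((\<lambda>k. ln (rd (k *\<^sub>R x)) / R) has_real_derivative sh x / rd x / R) (at 1)"
      using r R DERIV_ln[of "rd x"] by (auto intro!: derivative_eq_intros dilation_DERIV_rd[OF True that] simp: field_simps)
    from DERIV_chain2[OF hD this]
    have "((\<lambda>k. h (ln (rd (k *\<^sub>R x)) / R)) has_real_derivative annulus R \<psi> x) (at 1)"
      using R True that by (simp add: annulus_def mult_ac)
    then show ?thesis
    proof (rule has_field_derivative_transform_within_open)
      show "open {k. k *\<^sub>R x \<in> hball - {0}}"
      proof -
        have "open ((\<lambda>k. k *\<^sub>R x) -` (hball - {0}))"
          by (intro continuous_open_vimage continuous_intros open_Diff open_hball closed_singleton)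
        then show ?thesis by (simp add: vimage_def)
      qed
    qed (use that True in \<open>auto simp: G_def\<close>)
  next
    case False
    define q where "q = 1 - 1 / cosh (exp (2 * R))"
    have q: "q < 1" by (simp add: q_def)
    have "((\<lambda>k::real. 0::real) has_real_derivative annulus R \<psi> x) (at 1)"
      using False by (simp add: annulus_def)
    then show ?thesis
    proof (rule has_field_derivative_transform_within_open[where S = "{k. q < (norm (k *\<^sub>R x))\<^sup>2}"])
      show "open {k. q < (norm (k *\<^sub>R x))\<^sup>2}"
        by (intro open_Collect_less continuous_intros)
      have "norm x \<ge> 1" using False by (simp add: mem_hball)
      then have "(norm x)\<^sup>2 \<ge> 1" by (simp add: one_le_power)
      then show "1 \<in> {k. q < (norm (k *\<^sub>R x))\<^sup>2}" using q by simp
      show "0 = G (k *\<^sub>R x)" if "k \<in> {k. q < (norm (k *\<^sub>R x))\<^sup>2}" for k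
      proof (rule ccontr)
        assume "0 \<noteq> G (k *\<^sub>R x)"
        then have "G (k *\<^sub>R x) \<noteq> 0" by simp
        from rd_bounded_imp[OF Gs(3)[OF this] Gs(2)[OF this]] that show False by (simp add: q_def)
      qed
    qed
  qed
  define C' where "C' = C + 3 * B"
  show ?thesis
  proof (rule integral_radial_derivative[OF Gm annulus_measurable[OF R ct z] GD])
    show "\<bar>G x\<bar> \<le> C' * norm x" for x
    proof -
      have "3 * B * norm x \<le> C' * norm x" using C by (intro mult_right_mono) (auto simp: C'_def)
      then show ?thesis using Gb[of x] by linarith
    qed
    show "\<bar>annulus R \<psi> x\<bar> \<le> C' * norm x" for x :: "real^'n"
    proof -
      have "C * norm x \<le> C' * norm x" using B by (intro mult_right_mono) (auto simp: C'_def)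
      then show ?thesis using C(2)[of x] by linarith
    qed
    show "G x = 0" if "norm x \<ge> 1" for x using that by (simp add: G_def mem_hball)
  qed
qed

section \<open>Sharpness\<close>

text \<open>Quadratic growth is all that is needed to make the terms with \<open>1 / sinh r\<close>
  of lower order.\<close>

lemma sinh_ge_square:
  fixes r :: real assumes "r > 0" shows "sinh r \<ge> r\<^sup>2 / 2"
proof -
  have a: "sinh (r / 2) \<ge> r / 2" using sinh_bounds(1)[of "r / 2"] assms by simp
  have "cosh (r / 2) \<ge> sinh (r / 2)" by (simp add: sinh_le_cosh_real)
  then have b: "cosh (r / 2) \<ge> r / 2" using a by linarith
  have "sinh r = 2 * sinh (r / 2) * cosh (r / 2)" using sinh_double[of "r / 2"] by simp
  also have "\<dots> \<ge> 2 * (r / 2) * (r / 2)" using a b assms by (intro mult_mono) auto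
  finally show ?thesis by (simp add: power2_eq_square)
qed

text \<open>Here \<open>f\<close>, \<open>g\<close> are the values of \<open>bump\<close> and
  \<open>bump2\<close>, \<open>v\<close> is the profile and \<open>w\<close> its second derivative.
  After \<open>A\<^sup>2 v\<^sup>2\<close> cancels, the leading terms are
  \<open>A / 2 * f\<^sup>2 / r\<close> from \<open>- 2 A w v\<close> and
  \<open>- c f\<^sup>2 / r\<close> from the Hardy term. The rest is a constant times
  \<open>E\<close>, smaller by \<open>1 / R\<close>: the constant collects \<open>w\<^sup>2\<close>,
  the terms with \<open>1 / s\<^sup>2\<close>, the product \<open>f * g\<close> and the displacement
  \<open>K\<close> of the pole.\<close>

lemma profile_bound:
  fixes A B c K R r s d f g :: real
  assumes "A \<ge> 0" "B \<ge> 0" "c \<ge> 0" "K \<ge> 0" "R \<ge> 1" "r \<ge> R" "s \<ge> r\<^sup>2 / 2" "s \<ge> r" "0 < d" "d \<le> r + K"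
  defines "v \<equiv> sqrt r * f" and "w \<equiv> (g / R\<^sup>2 - f / 4) / (r * sqrt r)"
  shows "(w - A * v - B * (v / s\<^sup>2))\<^sup>2 - A\<^sup>2 * v\<^sup>2 - c * (v\<^sup>2 / d\<^sup>2)
    \<le> ((A / 2 - c) * f\<^sup>2 + (2 * (1 + B) + 4 * (B\<^sup>2 + B + 2 * A * B) + A + 2 * c * K) / R * (f\<^sup>2 + g\<^sup>2)) / r"
proof -
  define E where "E = (f\<^sup>2 + g\<^sup>2) / (R * r)"
  have r: "r > 0" "r \<ge> 1" and s: "s \<ge> 1" "s > 0" using assms by auto
  have E0: "E \<ge> 0" using r assms by (simp add: E_def)
  have q: "sqrt r * sqrt r = r" "sqrt r > 0" using r by auto
  have "r * r \<ge> R * 1" using assms by (intro mult_mono) auto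
  then have rR: "r * r \<ge> R" by simp
  have g4: "(g / R\<^sup>2 - f / 4)\<^sup>2 \<le> 2 * (f\<^sup>2 + g\<^sup>2)"
  proof -
    have "(a - b)\<^sup>2 \<le> 2 * a\<^sup>2 + 2 * b\<^sup>2" for a b :: real
      using sum_squares_ge_zero[of "a + b" 0] by (simp add: power2_eq_square algebra_simps)
    then have 1: "(g / R\<^sup>2 - f / 4)\<^sup>2 \<le> 2 * (g / R\<^sup>2)\<^sup>2 + 2 * (f / 4)\<^sup>2" .
    have 2: "(g / R\<^sup>2)\<^sup>2 \<le> g\<^sup>2"
    proof -
      have "1 \<le> (R\<^sup>2)\<^sup>2" using assms by (simp add: one_le_power)
      then have "g\<^sup>2 / (R\<^sup>2)\<^sup>2 \<le> g\<^sup>2 / 1" by (intro divide_left_mono) auto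
      then show ?thesis by (simp add: power_divide)
    qed
    have 3: "(f / 4)\<^sup>2 \<le> f\<^sup>2" by (simp add: power_divide)
    have "2 * (g / R\<^sup>2)\<^sup>2 + 2 * (f / 4)\<^sup>2 \<le> 2 * g\<^sup>2 + 2 * f\<^sup>2"
      by (intro add_mono mult_left_mono 2 3) auto
    with 1 show ?thesis by (simp only: distrib_left add.commute)
  qed
  have w2: "w\<^sup>2 \<le> 2 * E"
  proof -
    have "w\<^sup>2 = (g / R\<^sup>2 - f / 4)\<^sup>2 / (r * r * r)"
      using r by (simp add: w_def power_divide power_mult_distrib) (simp add: power2_eq_square)
    also have "\<dots> \<le> 2 * (f\<^sup>2 + g\<^sup>2) / (r * r * r)" using g4 r by (intro divide_right_mono) auto
    also have "\<dots> \<le> 2 * (f\<^sup>2 + g\<^sup>2) / (R * r)"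
      using rR r assms by (intro divide_left_mono mult_right_mono mult_pos_pos) auto
    finally show ?thesis by (simp add: E_def)
  qed
  have v2: "v\<^sup>2 = r * f\<^sup>2" using r by (simp add: v_def power_mult_distrib)
  have vs: "v\<^sup>2 / s\<^sup>2 \<le> 4 * E"
  proof -
    have "(r\<^sup>2 / 2)\<^sup>2 \<le> s\<^sup>2" using assms by (intro power_mono) auto
    then have "v\<^sup>2 / s\<^sup>2 \<le> r * f\<^sup>2 / (r\<^sup>2 / 2)\<^sup>2" unfolding v2 using r s by (intro divide_left_mono) auto
    also have "\<dots> = 4 * f\<^sup>2 / (r * r * r)" using r by (simp add: power2_eq_square field_simps)
    also have "\<dots> \<le> 4 * f\<^sup>2 / (R * r)"
      using rR r assms by (intro divide_left_mono mult_right_mono mult_pos_pos) auto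
    also have "\<dots> \<le> 4 * (f\<^sup>2 + g\<^sup>2) / (R * r)" using r assms by (intro divide_right_mono) auto
    finally show ?thesis by (simp add: E_def)
  qed
  have ys: "(v / s\<^sup>2)\<^sup>2 \<le> 4 * E"
  proof -
    have "(v / s\<^sup>2)\<^sup>2 = v\<^sup>2 / s\<^sup>2 / s\<^sup>2" by (simp add: power_divide power2_eq_square)
    also have "\<dots> \<le> v\<^sup>2 / s\<^sup>2 / 1" using s by (intro divide_left_mono) (auto simp: one_le_power)
    finally show ?thesis using vs by simp
  qed
  have wv: "w * v = (f * g / R\<^sup>2 - f\<^sup>2 / 4) / r"
    using q r by (simp add: w_def v_def field_simps power2_eq_square)
  have fg: "- 2 * A * (w * v) \<le> A / 2 * f\<^sup>2 / r + A * E"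
  proof -
    have "- (2 * (f * g)) \<le> f\<^sup>2 + g\<^sup>2" using sum_squares_ge_zero[of "f + g" 0] by (simp add: power2_eq_square algebra_simps)
    then have "- (2 * (f * g)) / (R\<^sup>2 * r) \<le> (f\<^sup>2 + g\<^sup>2) / (R\<^sup>2 * r)" using r by (intro divide_right_mono) auto
    also have "\<dots> \<le> E"
      unfolding E_def using r assms by (intro divide_left_mono mult_right_mono mult_pos_pos) (auto simp: power2_eq_square)
    finally have "A * (- (2 * (f * g)) / (R\<^sup>2 * r)) \<le> A * E" using assms by (intro mult_left_mono) auto
    moreover have "- 2 * A * (w * v) = A / 2 * f\<^sup>2 / r + A * (- (2 * (f * g)) / (R\<^sup>2 * r))"
      unfolding wv using r assms by (simp add: field_simps)
    ultimately show ?thesis by linarith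
  qed
  have cd: "- c * (v\<^sup>2 / d\<^sup>2) \<le> - c * f\<^sup>2 / r + 2 * c * K * E"
  proof -
    have "d\<^sup>2 \<le> (r + K)\<^sup>2" using assms by (intro power_mono) auto
    then have 1: "v\<^sup>2 / d\<^sup>2 \<ge> v\<^sup>2 / (r + K)\<^sup>2" using assms r by (intro divide_left_mono) auto
    \<comment> \<open>This is \<open>1 / (1 + y)\<^sup>2 \<ge> 1 - 2 y\<close> at
      \<open>y = K / r\<close>, cleared of denominators.\<close>
    have "(r - 2 * K) * (r + K)\<^sup>2 \<le> r * r * r"
    proof -
      have "r * r * r - (r - 2 * K) * (r + K)\<^sup>2 = 3 * K\<^sup>2 * r + 2 * K ^ 3"
        by (simp add: power2_eq_square power3_eq_cube algebra_simps)
      moreover have "\<dots> \<ge> 0" using assms r by simp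
      ultimately show ?thesis by linarith
    qed
    then have "(r - 2 * K) / (r * r) \<le> r / (r + K)\<^sup>2"
      using r assms by (simp add: divide_le_eq le_divide_eq mult_ac)
    then have "f\<^sup>2 * ((r - 2 * K) / (r * r)) \<le> f\<^sup>2 * (r / (r + K)\<^sup>2)" by (intro mult_left_mono) auto
    then have 2: "f\<^sup>2 / r - 2 * K * f\<^sup>2 / (r * r) \<le> v\<^sup>2 / (r + K)\<^sup>2"
      using r by (simp add: v2 field_simps)
    have "2 * K * f\<^sup>2 / (r * r) \<le> 2 * K * (f\<^sup>2 + g\<^sup>2) / (R * r)"
      using r assms by (intro frac_le mult_left_mono mult_right_mono mult_pos_pos) auto
    then have "f\<^sup>2 / r - 2 * K * E \<le> v\<^sup>2 / d\<^sup>2" using 1 2 by (simp add: E_def)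
    from mult_left_mono[OF this assms(3)] show ?thesis by (simp add: algebra_simps)
  qed
  have xy: "- 2 * (w * (v / s\<^sup>2)) \<le> w\<^sup>2 + (v / s\<^sup>2)\<^sup>2"
    using sum_squares_ge_zero[of "w + v / s\<^sup>2" 0] by (simp add: power2_eq_square algebra_simps)
  have "(w - A * v - B * (v / s\<^sup>2))\<^sup>2 - A\<^sup>2 * v\<^sup>2
     = w\<^sup>2 + B\<^sup>2 * (v / s\<^sup>2)\<^sup>2 - 2 * A * (w * v) + 2 * A * B * (v * (v / s\<^sup>2)) + B * (- 2 * (w * (v / s\<^sup>2)))"
    by (simp add: power2_eq_square[of "_ - _"] power_mult_distrib algebra_simps power2_eq_square[of A] power2_eq_square[of B] power2_eq_square[of w] power2_eq_square[of v] power2_eq_square[of "v / s\<^sup>2"])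
  also have "\<dots> \<le> w\<^sup>2 + B\<^sup>2 * (v / s\<^sup>2)\<^sup>2 - 2 * A * (w * v) + 2 * A * B * (v * (v / s\<^sup>2)) + B * (w\<^sup>2 + (v / s\<^sup>2)\<^sup>2)"
    using mult_left_mono[OF xy assms(2)] by simp
  also have "\<dots> = (1 + B) * w\<^sup>2 + (B\<^sup>2 + B) * (v / s\<^sup>2)\<^sup>2 + 2 * A * B * (v\<^sup>2 / s\<^sup>2) + (- 2 * A * (w * v))"
    by (simp add: algebra_simps power2_eq_square[of v])
  also have "\<dots> \<le> (1 + B) * (2 * E) + (B\<^sup>2 + B) * (4 * E) + 2 * A * B * (4 * E) + (A / 2 * f\<^sup>2 / r + A * E)"
    using assms by (intro add_mono mult_left_mono w2 ys vs fg) auto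
  finally have "(w - A * v - B * (v / s\<^sup>2))\<^sup>2 - A\<^sup>2 * v\<^sup>2 - c * (v\<^sup>2 / d\<^sup>2)
    \<le> (1 + B) * (2 * E) + (B\<^sup>2 + B) * (4 * E) + 2 * A * B * (4 * E) + (A / 2 * f\<^sup>2 / r + A * E) + (- c * f\<^sup>2 / r + 2 * c * K * E)"
    using cd by linarith
  also have "\<dots> = (A / 2 - c) * f\<^sup>2 / r + (2 * (1 + B) + 4 * (B\<^sup>2 + B + 2 * A * B) + A + 2 * c * K) * E"
    by (simp add: algebra_simps diff_divide_distrib)
  also have "\<dots> = ((A / 2 - c) * f\<^sup>2 + (2 * (1 + B) + 4 * (B\<^sup>2 + B + 2 * A * B) + A + 2 * c * K) / R * (f\<^sup>2 + g\<^sup>2)) / r"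
  proof -
    have "k * E = k / R * (f\<^sup>2 + g\<^sup>2) / r" for k by (simp add: E_def)
    then show ?thesis by (simp only: add_divide_distrib)
  qed
  finally show ?thesis .
qed

text \<open>A crude substitute for the triangle inequality: the hyperbolic cosine of the distance is
  at most \<open>M * ch x\<close>, and \<open>exp (arcosh X) \<le> 2 * X\<close>. Any constant
  \<open>K\<close> will do, as the test functions live at large \<open>r\<close>.\<close>

lemma hyp_dist_upper:
  fixes x0 :: "real^'n"
  assumes x0: "x0 \<in> hball"
  obtains K where "K \<ge> 0" "\<And>x. x \<in> hball \<Longrightarrow> hyp_dist x x0 \<le> rd x + K"
proof -
  define a where "a = 1 - (norm x0)\<^sup>2"
  \<comment> \<open>The 8 is twice the square of 2, the bound on the Euclidean distance within the
    ball.\<close>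
  define M where "M = 1 + 8 / a"
  have a: "a > 0" using x0 by (simp add: a_def mem_hball abs_square_less_1)
  have M: "M \<ge> 1" using a by (simp add: M_def)
  have "hyp_dist x x0 \<le> rd x + ln (2 * M)" if x: "x \<in> hball" for x
  proof -
    define b where "b = 1 - (norm x)\<^sup>2"
    have b: "b > 0" "b \<le> 1" using x by (auto simp: b_def mem_hball abs_square_less_1)
    define X where "X = 1 + 2 * (norm (x - x0))\<^sup>2 / (b * a)"
    have X: "X \<ge> 1" using a b by (simp add: X_def)
    have "norm (x - x0) \<le> 2" using norm_triangle_ineq4[of x x0] x x0 by (simp add: mem_hball)
    then have "(norm (x - x0))\<^sup>2 \<le> 2\<^sup>2" by (intro power_mono) auto
    then have "2 * (norm (x - x0))\<^sup>2 / (b * a) \<le> 8 / (b * a)" using a b by (intro divide_right_mono) auto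
    moreover have "1 \<le> 1 / b" using b by simp
    ultimately have "X \<le> 1 / b + 8 / (b * a)" by (simp add: X_def)
    also have "\<dots> = M * (1 / b)" by (simp add: M_def add_divide_distrib mult.commute)
    also have "\<dots> \<le> M * ch x"
      using M b by (intro mult_left_mono) (auto simp: ch_def b_def divide_right_mono)
    also have "ch x \<le> exp (rd x)"
      using rd_nonneg[OF x] by (simp add: cosh_rd[OF x, symmetric] cosh_def)
    finally have "X \<le> M * exp (rd x)" using M by (simp add: mult_left_mono)
    moreover have "exp (arcosh X) \<le> 2 * X"
    proof -
      have "exp (arcosh X) / 2 \<le> cosh (arcosh X)" by (simp add: cosh_def)
      then show ?thesis using X by simp
    qed
    ultimately have "exp (arcosh X) \<le> 2 * (M * exp (rd x))" by linarith
    also have "\<dots> = exp (rd x + ln (2 * M))" using M by (simp add: exp_add)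
    finally have "exp (arcosh X) \<le> exp (rd x + ln (2 * M))" .
    then show ?thesis by (simp add: hyp_dist_def X_def a_def b_def)
  qed
  moreover have "ln (2 * M) \<ge> 0" using M by simp
  ultimately show thesis using that by blast
qed

text \<open>Near the sphere the pole stays at positive distance, so there the weight
  \<open>1 / d\<^sup>2\<close> is bounded.\<close>

lemma hyp_dist_lower:
  fixes x0 :: "real^'n"
  assumes x0: "x0 \<in> hball"
  obtains e where "e > 0" "\<And>x. x \<in> hball \<Longrightarrow> norm x \<ge> (1 + norm x0) / 2 \<Longrightarrow> hyp_dist x x0 \<ge> e"
proof -
  define t where "t = (1 - norm x0) / 2"
  have t: "t > 0" using x0 by (simp add: t_def mem_hball)
  have "hyp_dist x x0 \<ge> arcosh (1 + 2 * t\<^sup>2)" if x: "x \<in> hball" "norm x \<ge> (1 + norm x0) / 2" for x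
  proof -
    have ab: "1 - (norm x)\<^sup>2 > 0" "1 - (norm x0)\<^sup>2 > 0" using x x0 by (auto simp: mem_hball abs_square_less_1)
    have "norm (x - x0) \<ge> t" using norm_triangle_ineq2[of x x0] x(2) by (simp add: t_def field_simps)
    then have "t\<^sup>2 \<le> (norm (x - x0))\<^sup>2" using t by (intro power_mono) auto
    moreover have "(1 - (norm x)\<^sup>2) * (1 - (norm x0)\<^sup>2) \<le> 1 * 1" using ab by (intro mult_mono) auto
    ultimately have "2 * t\<^sup>2 / 1 \<le> 2 * (norm (x - x0))\<^sup>2 / ((1 - (norm x)\<^sup>2) * (1 - (norm x0)\<^sup>2))"
      using ab by (intro frac_le) auto
    then have "1 + 2 * t\<^sup>2 \<le> 1 + 2 * (norm (x - x0))\<^sup>2 / ((1 - (norm x)\<^sup>2) * (1 - (norm x0)\<^sup>2))" by simp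
    moreover have "1 \<le> 1 + 2 * t\<^sup>2" by simp
    ultimately show ?thesis
      unfolding hyp_dist_def by (metis arcosh_real_strict_mono order.order_iff_strict)
  qed
  moreover have "arcosh (1 + 2 * t\<^sup>2) > 0" using t by simp
  ultimately show thesis using that by blast
qed

text \<open>The point is taken at Euclidean radius \<open>tanh (r / 2)\<close>; the double-angle
  formula for \<open>cosh\<close> does the rest.\<close>

lemma ex_rd:
  assumes "r > 0"
  shows "\<exists>x::real^'n. x \<in> hball \<and> x \<noteq> 0 \<and> rd x = r"
proof -
  define C S where "C = cosh (r / 2)" and "S = sinh (r / 2)"
  have CS: "C\<^sup>2 = 1 + S\<^sup>2" "C > 0" "S > 0" using assms by (auto simp: C_def S_def cosh_square_eq)
  define x :: "real^'n" where "x = (S / C) *\<^sub>R axis undefined 1"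
  have n: "norm x = S / C" using CS by (simp add: x_def)
  have "S\<^sup>2 < C\<^sup>2" using CS by simp
  then have "S < C" using CS by (simp add: power2_less_imp_less)
  then have x: "x \<in> hball" "x \<noteq> 0" using n CS by (auto simp: mem_hball)
  have "ch x = (C\<^sup>2 + S\<^sup>2) / (C\<^sup>2 - S\<^sup>2)"
  proof -
    have "1 + (S / C)\<^sup>2 = (C\<^sup>2 + S\<^sup>2) / C\<^sup>2" "1 - (S / C)\<^sup>2 = (C\<^sup>2 - S\<^sup>2) / C\<^sup>2"
      using CS(2) by (simp_all add: power_divide add_divide_distrib diff_divide_distrib)
    then show ?thesis unfolding ch_def n using CS(2) by simp
  qed
  also have "\<dots> = cosh r" using cosh_double[of "r / 2"] CS by (simp add: C_def S_def)
  finally show ?thesis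
    using x assms by (intro exI[of _ x]) (simp add: rd_def arcosh_cosh_real)
qed

lemma annulus_bump_integral_pos:
  assumes R: "R > 0"
  shows "(\<integral>x. annulus R (\<lambda>t. (bump t)\<^sup>2) (x::real^'n) / norm x ^ CARD('n) \<partial>lborel) > 0"
proof -
  let ?f = "\<lambda>x::real^'n. annulus R (\<lambda>t. (bump t)\<^sup>2) x / norm x ^ CARD('n)"
  have i: "integrable lborel ?f"
    by (intro annulus_integrable R continuous_intros continuous_bump) (auto simp: bump_outside)
  have nn: "?f x \<ge> 0" for x
    by (auto simp: annulus_def intro!: mult_nonneg_nonneg divide_nonneg_nonneg sh_nonneg rd_nonneg)
  have "(\<integral>x. ?f x \<partial>lborel) \<noteq> 0"
  proof
    assume "(\<integral>x. ?f x \<partial>lborel) = 0"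
    then have ae: "AE x in lborel. ?f x = 0"
      using integral_nonneg_eq_0_iff_AE[OF i] nn by auto
    \<comment> \<open>\<open>tfun R\<close> is nonzero only where the integrand is, and it is known
      to be continuous; this yields an open set of positive measure.\<close>
    let ?U = "{x::real^'n. tfun R x \<noteq> 0}"
    have "open ?U"
      using Cc_inf_H_continuous[OF tfun_in_Cc[OF R]] by (intro open_Collect_neq) auto
    \<comment> \<open>The middle of the support on the logarithmic scale,
      \<open>ln r / R = 3 / 2\<close>.\<close>
    obtain x :: "real^'n" where x: "x \<in> hball" "x \<noteq> 0" "rd x = exp (3 / 2 * R)"
      using ex_rd[of "exp (3 / 2 * R)"] by auto
    then have "bump (ln (rd x) / R) > 0" using R by (intro bump_pos) (auto simp: field_simps)
    then have "x \<in> ?U" using x sh_pos[OF x(1,2)] by (simp add: tfun_def vfun_def)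
    with \<open>open ?U\<close> obtain e where e: "e > 0" "ball x e \<subseteq> ?U" by (meson openE)
    have "AE y in lborel. y \<notin> ball x e"
      using ae
    proof eventually_elim
      case (elim y)
      show ?case
      proof
        assume "y \<in> ball x e"
        then have "tfun R y \<noteq> 0" using e by auto
        then have "y \<in> hball" "y \<noteq> 0" "bump (ln (rd y) / R) \<noteq> 0"
          by (auto simp: tfun_def vfun_def split: if_splits)
        then have "?f y \<noteq> 0" using sh_pos[of y] rd_pos[of y] by (simp add: annulus_def)
        with elim show False by simp
      qed
    qed
    then have "emeasure lborel (ball x e) = 0"
      by (subst (asm) AE_iff_measurable[of "ball x e"]) auto
    then show False using e unit_ball_vol_pos[of "real CARD('n)"] by (simp add: emeasure_ball)
  qed
  moreover have "(\<integral>x. ?f x \<partial>lborel) \<ge> 0" using nn by simp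
  ultimately show ?thesis by linarith
qed


text \<open>By \<open>profile_bound\<close> the difference of the two sides is at most the integral
  of \<open>annulus R \<psi>\<close>, whose sign is that of
  \<open>(A / 2 - c) * P + C / R * (P + P2)\<close>, negative for large \<open>R\<close>. The
  parameter \<open>T\<close>, which sends the support to infinity, serves the sharpness of the
  spectral constant.\<close>

lemma sharp_test_function:
  fixes x0 :: "real^'n"
  assumes N5: "CARD('n) \<ge> 5" and x0: "x0 \<in> hball"
  defines "N \<equiv> real CARD('n)"
  assumes c: "c > (N - 1)\<^sup>2 / 8"
  obtains u :: "real^'n \<Rightarrow> real" where "u \<in> Cc_inf_H" "\<And>x. u x \<noteq> 0 \<Longrightarrow> x \<in> hball \<and> rd x \<ge> T"
    "hyp_integral (\<lambda>x. (hyp_laplacian u x)\<^sup>2) - (N - 1)^4 / 16 * hyp_integral (\<lambda>x. (u x)\<^sup>2)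
      < c * hyp_integral (\<lambda>x. (u x)\<^sup>2 / (hyp_dist x x0)\<^sup>2)"
proof -
  define n A B where "n = (N - 1) / 2" and "A = n\<^sup>2" and "B = n * (n - 1)"
  have n: "n \<ge> 2" using N5 by (simp add: n_def N_def)
  have A: "A \<ge> 0" and B: "B \<ge> 0" using n by (auto simp: A_def B_def)
  have A8: "(N - 1)\<^sup>2 / 8 = A / 2" "(N - 1)^4 / 16 = A\<^sup>2"
    by (simp_all add: A_def n_def power_divide power_mult[symmetric])
  have c0: "c \<ge> 0" "c > A / 2" using c A by (auto simp: A8)
  obtain K where K: "K \<ge> 0" "\<And>x. x \<in> hball \<Longrightarrow> hyp_dist x x0 \<le> rd x + K"
    using hyp_dist_upper[OF x0] by blast
  obtain e where e: "e > 0" "\<And>x. x \<in> hball \<Longrightarrow> norm x \<ge> (1 + norm x0) / 2 \<Longrightarrow> hyp_dist x x0 \<ge> e"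
    using hyp_dist_lower[OF x0] by blast
  define C where "C = 2 * (1 + B) + 4 * (B\<^sup>2 + B + 2 * A * B) + A + 2 * c * K"
  have C: "C \<ge> 0" using A B c0 K by (simp add: C_def)
  define P P2 where "P = integral {0..2} (\<lambda>t. (bump t)\<^sup>2)" and "P2 = integral {0..2} (\<lambda>t. (bump2 t)\<^sup>2)"
  have ctb: "continuous_on S (\<lambda>t. (bump t)\<^sup>2)" and ctb2: "continuous_on S (\<lambda>t. (bump2 t)\<^sup>2)" for S
    by (intro continuous_intros continuous_on_subset[OF continuous_bump] continuous_on_subset[OF continuous_bump2] subset_UNIV)+
  have bi: "(\<lambda>t. (bump t)\<^sup>2) integrable_on {0..2}" "(\<lambda>t. (bump2 t)\<^sup>2) integrable_on {0..2}"
    by (intro integrable_continuous_real ctb ctb2)+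
  have "P \<ge> 0" "P2 \<ge> 0" unfolding P_def P2_def by (intro integral_nonneg bi; simp)+
  moreover have "P \<noteq> 0"
  proof
    assume "P = 0"
    then have "\<forall>t\<in>{0..2}. (bump t)\<^sup>2 = 0"
      unfolding P_def by (subst (asm) integral_eq_0_iff) (auto intro: ctb)
    then have "(bump (3 / 2))\<^sup>2 = 0" by (rule bspec) auto
    then show False using bump_pos[of "3 / 2"] by simp
  qed
  ultimately have P: "P > 0" "P2 \<ge> 0" by auto
  define t where "t = (1 + norm x0) / 2"
  have t: "0 < t" "t < 1" using x0 by (auto simp: t_def mem_hball add_pos_nonneg)
  have t2: "1 - t\<^sup>2 > 0" using t by (simp add: abs_square_less_1)
  \<comment> \<open>Besides \<open>R \<ge> 1\<close> and \<open>R \<ge> T\<close>, the third bound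
    gives the negative sign, and \<open>2 / (1 - t\<^sup>2)\<close> forces
    \<open>norm x \<ge> t\<close> on the support, as \<open>rd x \<le> sh x\<close>.\<close>
  define R where "R = max (max 1 T) (max (C * (P + P2) / ((c - A / 2) * P) + 1) (2 / (1 - t\<^sup>2)))"
  have R: "R \<ge> 1" "R \<ge> T" "R > C * (P + P2) / ((c - A / 2) * P)" "R \<ge> 2 / (1 - t\<^sup>2)"
    by (auto simp: R_def)
  have R0: "R > 0" using R by simp
  define u :: "real^'n \<Rightarrow> real" where "u = tfun R"
  have u: "u \<in> Cc_inf_H" unfolding u_def by (rule tfun_in_Cc[OF R0])
  have L: "hyp_laplacian u \<in> Cc_inf_H" by (rule Cc_inf_H_hyp_laplacian[OF u])
  have [measurable]: "u \<in> borel_measurable borel" "hyp_laplacian u \<in> borel_measurable borel"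
    by (intro Cc_inf_H_measurable u L)+
  have supp: "x \<in> hball" "x \<noteq> 0" "rd x \<ge> R" "norm x \<ge> t" if "u x \<noteq> 0" for x
  proof -
    show x: "x \<in> hball" "x \<noteq> 0" using that by (auto simp: u_def tfun_def split: if_splits)
    have "vfun R (rd x) \<noteq> 0" using that by (auto simp: u_def tfun_def split: if_splits)
    then have "exp R < rd x" by (rule vfun_support[OF rd_pos[OF x] R0])
    then have r: "rd x > R" using exp_ge_add_one_self[of R] by linarith
    then show "rd x \<ge> R" by simp
    show "norm x \<ge> t"
    proof (rule ccontr)
      assume "\<not> norm x \<ge> t"
      then have "norm x < t" by simp
      then have "(norm x)\<^sup>2 \<le> t\<^sup>2" by (intro power_mono) auto
      then have "sh x \<le> 2 / (1 - t\<^sup>2)"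
        unfolding sh_def using t t2 \<open>norm x < t\<close> by (intro frac_le) auto
      then show False using rd_le_sh[OF x(1)] r R(4) by linarith
    qed
  qed
  define \<psi> where "\<psi> s = (A / 2 - c) * (bump s)\<^sup>2 + C / R * ((bump s)\<^sup>2 + (bump2 s)\<^sup>2)" for s
  have ct: "continuous_on UNIV \<psi>" unfolding \<psi>_def[abs_def] by (intro continuous_intros ctb ctb2)
  have z: "\<psi> s = 0" if "s \<le> 1 \<or> s \<ge> 2" for s using that by (simp add: \<psi>_def bump_outside bump2_outside)
  have pw: "sh x ^ CARD('n) * (hyp_laplacian u x)\<^sup>2 - A\<^sup>2 * (sh x ^ CARD('n) * (u x)\<^sup>2)
      - c * (sh x ^ CARD('n) * ((u x)\<^sup>2 / (hyp_dist x x0)\<^sup>2)) \<le> annulus R \<psi> x" for x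
  proof (cases "x \<in> hball \<and> x \<noteq> 0")
    case True
    then have x: "x \<in> hball" "x \<noteq> 0" by auto
    define s r d v w where "s = sh x" and "r = rd x" and "d = hyp_dist x x0" and "v = vfun R (rd x)" and "w = vfun2 R (rd x)"
    have s: "s > 0" and r: "r > 0" using sh_pos[OF x] rd_pos[OF x] by (auto simp: s_def r_def)
    have ux: "u x = s powr (- n) * v" using x by (simp add: u_def tfun_def s_def v_def n_def N_def)
    have Lx: "hyp_laplacian u x = s powr (- n) * (w - A * v - B * (v / s\<^sup>2))"
      using tfun_laplacian[OF R0 x] by (simp add: u_def s_def v_def w_def n_def N_def A_def B_def)
    \<comment> \<open>As \<open>N = 2 n + 1\<close>, exactly one factor \<open>s\<close> remains,
      the one built into \<open>annulus\<close>.\<close>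
    have "s ^ CARD('n) * (s powr (- n))\<^sup>2 = s powr N * (s powr (- n) * s powr (- n))"
      using s by (simp add: powr_realpow N_def power2_eq_square)
    also have "\<dots> = s powr (N + (- n + - n))" by (simp only: powr_add)
    also have "N + (- n + - n) = 1" by (simp add: n_def)
    finally have sN: "s ^ CARD('n) * (s powr (- n))\<^sup>2 = s" using s by simp
    have "sh x ^ CARD('n) * (hyp_laplacian u x)\<^sup>2 - A\<^sup>2 * (sh x ^ CARD('n) * (u x)\<^sup>2)
      - c * (sh x ^ CARD('n) * ((u x)\<^sup>2 / (hyp_dist x x0)\<^sup>2))
      = (s ^ CARD('n) * (s powr (- n))\<^sup>2) * ((w - A * v - B * (v / s\<^sup>2))\<^sup>2 - A\<^sup>2 * v\<^sup>2 - c * (v\<^sup>2 / d\<^sup>2))"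
    proof -
      define X where "X = w - A * v - B * (v / s\<^sup>2)"
      show ?thesis
        unfolding Lx ux power_mult_distrib s_def[symmetric] d_def[symmetric] X_def[symmetric]
        by (simp add: algebra_simps)
    qed
    also have "\<dots> = s * ((w - A * v - B * (v / s\<^sup>2))\<^sup>2 - A\<^sup>2 * v\<^sup>2 - c * (v\<^sup>2 / d\<^sup>2))"
      unfolding sN ..
    also have "\<dots> \<le> s * (\<psi> (ln r / R) / r)"
    proof (rule mult_left_mono)
      show "(w - A * v - B * (v / s\<^sup>2))\<^sup>2 - A\<^sup>2 * v\<^sup>2 - c * (v\<^sup>2 / d\<^sup>2) \<le> \<psi> (ln r / R) / r"
      proof (cases "ln r / R \<le> 1 \<or> ln r / R \<ge> 2")
        case True
        then have "v = 0" "w = 0" by (auto simp: v_def w_def vfun_def vfun2_def bump_outside bump2_outside r_def)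
        then show ?thesis by (simp add: z[OF True])
      next
        case False
        then have "bump (ln r / R) > 0" by (intro bump_pos) auto
        then have "u x \<noteq> 0" using s r by (simp add: ux v_def vfun_def r_def)
        note S = supp[OF this]
        have d: "0 < d" "d \<le> r + K" using e(1) e(2)[OF x(1)] S(4) K(2)[OF x(1)] by (auto simp: d_def r_def t_def)
        have "s \<ge> r\<^sup>2 / 2" "s \<ge> r"
          using sinh_ge_square[OF r] rd_le_sh[OF x(1)] by (simp_all add: s_def r_def sinh_rd[OF x(1)])
        from profile_bound[OF A B c0(1) K(1) R(1) S(3)[folded r_def] this d, of "bump2 (ln r / R)" "bump (ln r / R)"]
        show ?thesis
          by (simp add: \<psi>_def C_def v_def w_def vfun_def vfun2_def r_def)
      qed
    qed (use s in simp)
    also have "\<dots> = annulus R \<psi> x" using x by (simp add: annulus_def s_def r_def)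
    finally show ?thesis .
  next
    case False
    then consider "x = 0" | "norm x \<ge> 1" by (auto simp: mem_hball)
    then show ?thesis
    proof cases
      case 1
      then show ?thesis by (simp add: annulus_def sh_def zero_power)
    next
      case 2
      then show ?thesis using Cc_vanish[OF u] Cc_vanish[OF L] by (simp add: annulus_def mem_hball)
    qed
  qed
  have int: "integrable lborel (\<lambda>x. sh x ^ CARD('n) * (f x)\<^sup>2 / norm x ^ CARD('n))" if "f \<in> Cc_inf_H" for f :: "real^'n \<Rightarrow> real"
    using integrable_radmono[OF Cc_inf_H_mult[OF that that], of 0 "CARD('n)" 0] N5
    by (simp add: radmono_def power2_eq_square mult_ac)
  have int3: "integrable lborel (\<lambda>x. sh x ^ CARD('n) * ((u x)\<^sup>2 / (hyp_dist x x0)\<^sup>2) / norm x ^ CARD('n))"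
  proof (rule Bochner_Integration.integrable_bound)
    show "integrable lborel (\<lambda>x. (1 / e\<^sup>2) * (sh x ^ CARD('n) * (u x)\<^sup>2 / norm x ^ CARD('n)))"
      by (intro integrable_mult_right int u)
    have "norm (sh x ^ CARD('n) * ((u x)\<^sup>2 / (hyp_dist x x0)\<^sup>2) / norm x ^ CARD('n))
      \<le> norm ((1 / e\<^sup>2) * (sh x ^ CARD('n) * (u x)\<^sup>2 / norm x ^ CARD('n)))" for x
    proof (cases "u x = 0")
      case False
      have "hyp_dist x x0 \<ge> e" using e(2) supp[OF False] by (simp add: t_def)
      then have "e\<^sup>2 \<le> (hyp_dist x x0)\<^sup>2" using e(1) by (intro power_mono) auto
      then have "1 / (hyp_dist x x0)\<^sup>2 \<le> 1 / e\<^sup>2" using e(1) by (intro divide_left_mono) (auto simp: zero_less_mult_iff)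
      moreover have "sh x ^ CARD('n) * (u x)\<^sup>2 / norm x ^ CARD('n) \<ge> 0" using sh_nonneg[OF supp(1)[OF False]] by simp
      ultimately have "1 / (hyp_dist x x0)\<^sup>2 * (sh x ^ CARD('n) * (u x)\<^sup>2 / norm x ^ CARD('n))
        \<le> 1 / e\<^sup>2 * (sh x ^ CARD('n) * (u x)\<^sup>2 / norm x ^ CARD('n))" by (rule mult_right_mono)
      then show ?thesis using sh_nonneg[OF supp(1)[OF False]] by (simp add: mult_ac)
    qed simp
    then show "AE x in lborel. norm (sh x ^ CARD('n) * ((u x)\<^sup>2 / (hyp_dist x x0)\<^sup>2) / norm x ^ CARD('n))
      \<le> norm ((1 / e\<^sup>2) * (sh x ^ CARD('n) * (u x)\<^sup>2 / norm x ^ CARD('n)))" by simp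
  qed measurable
  have h1: "hyp_integral (\<lambda>x. (hyp_laplacian u x)\<^sup>2) = (\<integral>x. sh x ^ CARD('n) * (hyp_laplacian u x)\<^sup>2 / norm x ^ CARD('n) \<partial>lborel)"
    by (rule hyp_integral_radial) (auto simp: Cc_vanish[OF L])
  have h2: "hyp_integral (\<lambda>x. (u x)\<^sup>2) = (\<integral>x. sh x ^ CARD('n) * (u x)\<^sup>2 / norm x ^ CARD('n) \<partial>lborel)"
    by (rule hyp_integral_radial) (auto simp: Cc_vanish[OF u])
  have h3: "hyp_integral (\<lambda>x. (u x)\<^sup>2 / (hyp_dist x x0)\<^sup>2) = (\<integral>x. sh x ^ CARD('n) * ((u x)\<^sup>2 / (hyp_dist x x0)\<^sup>2) / norm x ^ CARD('n) \<partial>lborel)"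
    by (rule hyp_integral_radial) (auto simp: Cc_vanish[OF u])
  let ?D = "\<lambda>x. sh x ^ CARD('n) * (hyp_laplacian u x)\<^sup>2 / norm x ^ CARD('n) - A\<^sup>2 * (sh x ^ CARD('n) * (u x)\<^sup>2 / norm x ^ CARD('n))
      - c * (sh x ^ CARD('n) * ((u x)\<^sup>2 / (hyp_dist x x0)\<^sup>2) / norm x ^ CARD('n))"
  have hD: "has_bochner_integral lborel ?D (hyp_integral (\<lambda>x. (hyp_laplacian u x)\<^sup>2) - A\<^sup>2 * hyp_integral (\<lambda>x. (u x)\<^sup>2)
      - c * hyp_integral (\<lambda>x. (u x)\<^sup>2 / (hyp_dist x x0)\<^sup>2))"
    unfolding h1 h2 h3
    by (intro has_bochner_integral_diff has_bochner_integral_mult_right has_bochner_integral_integrable int int3 u L)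
  have "integral\<^sup>L lborel ?D \<le> (\<integral>x. annulus R \<psi> (x::real^'n) / norm x ^ CARD('n) \<partial>lborel)"
  proof (rule integral_mono)
    show "integrable lborel ?D" using hD by (rule integrable.intros)
    show "integrable lborel (\<lambda>x::real^'n. annulus R \<psi> x / norm x ^ CARD('n))"
      by (rule annulus_integrable[OF R0 ct z])
    show "?D x \<le> annulus R \<psi> x / norm x ^ CARD('n)" for x
      using divide_right_mono[OF pw[of x], of "norm x ^ CARD('n)"] by (simp add: diff_divide_distrib)
  qed
  then have le: "hyp_integral (\<lambda>x. (hyp_laplacian u x)\<^sup>2) - A\<^sup>2 * hyp_integral (\<lambda>x. (u x)\<^sup>2)
      - c * hyp_integral (\<lambda>x. (u x)\<^sup>2 / (hyp_dist x x0)\<^sup>2) \<le> (\<integral>x. annulus R \<psi> (x::real^'n) / norm x ^ CARD('n) \<partial>lborel)"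
    unfolding has_bochner_integral_integral_eq[OF hD] .
  \<comment> \<open>The mean of \<open>\<psi>\<close> relative to \<open>(bump s)\<^sup>2\<close>:
    subtracting \<open>m * (bump s)\<^sup>2\<close> leaves a profile of mean zero, so only the sign
    of \<open>m\<close> matters and no integral over the sphere has to be evaluated.\<close>
  define m where "m = ((A / 2 - c) * P + C / R * (P + P2)) / P"
  have m: "m < 0"
  proof -
    have "C * (P + P2) < R * ((c - A / 2) * P)"
      using R(3) c0(2) P(1) by (subst (asm) divide_less_eq) auto
    then have "C / R * (P + P2) < (c - A / 2) * P" using R0 by (simp add: field_simps)
    then have "(A / 2 - c) * P + C / R * (P + P2) < 0" by (simp add: algebra_simps)
    then show ?thesis using P by (simp add: m_def divide_neg_pos)
  qed
  have i\<psi>: "integral {0..2} (\<lambda>s. \<psi> s - m * (bump s)\<^sup>2) = 0"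
  proof -
    have "((\<lambda>s. \<psi> s - m * (bump s)\<^sup>2) has_integral (((A / 2 - c) * P + C / R * (P + P2)) - m * P)) {0..2}"
      unfolding \<psi>_def[abs_def] P_def P2_def
      by (intro has_integral_diff has_integral_add has_integral_mult_right integrable_integral bi)
    then show ?thesis using P by (simp add: m_def integral_unique)
  qed
  have "(\<integral>x. annulus R \<psi> (x::real^'n) / norm x ^ CARD('n) \<partial>lborel)
     = (\<integral>x. annulus R (\<lambda>s. \<psi> s - m * (bump s)\<^sup>2) (x::real^'n) / norm x ^ CARD('n)
         + m * (annulus R (\<lambda>s. (bump s)\<^sup>2) x / norm x ^ CARD('n)) \<partial>lborel)"
    by (rule Bochner_Integration.integral_cong) (auto simp: annulus_def right_diff_distrib diff_divide_distrib mult_ac)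
  also have "\<dots> = 0 + m * (\<integral>x. annulus R (\<lambda>s. (bump s)\<^sup>2) (x::real^'n) / norm x ^ CARD('n) \<partial>lborel)"
  proof -
    have ct': "continuous_on UNIV (\<lambda>s. \<psi> s - m * (bump s)\<^sup>2)" by (intro continuous_intros ct ctb)
    have z': "\<psi> s - m * (bump s)\<^sup>2 = 0" if "s \<le> 1 \<or> s \<ge> 2" for s using z[OF that] that by (simp add: bump_outside)
    have i1: "integrable lborel (\<lambda>x::real^'n. annulus R (\<lambda>s. \<psi> s - m * (bump s)\<^sup>2) x / norm x ^ CARD('n))"
      by (rule annulus_integrable[OF R0 ct' z'])
    have i2: "integrable lborel (\<lambda>x::real^'n. annulus R (\<lambda>s. (bump s)\<^sup>2) x / norm x ^ CARD('n))"
      by (rule annulus_integrable[OF R0 ctb]) (simp add: bump_outside)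
    have i3: "(\<integral>x. annulus R (\<lambda>s. \<psi> s - m * (bump s)\<^sup>2) (x::real^'n) / norm x ^ CARD('n) \<partial>lborel) = 0"
      by (rule annulus_integral_eq_0[OF R0 ct' z' i\<psi>])
    show ?thesis
      unfolding Bochner_Integration.integral_add[OF i1 integrable_mult_right[OF i2]] i3 integral_mult_right_zero ..
  qed
  also have "\<dots> < 0" using m annulus_bump_integral_pos[OF R0, where 'n = 'n] by (simp add: mult_neg_pos)
  finally have "hyp_integral (\<lambda>x. (hyp_laplacian u x)\<^sup>2) - (N - 1)^4 / 16 * hyp_integral (\<lambda>x. (u x)\<^sup>2)
      < c * hyp_integral (\<lambda>x. (u x)\<^sup>2 / (hyp_dist x x0)\<^sup>2)"
    using le unfolding A8 by linarith
  moreover have "x \<in> hball \<and> rd x \<ge> T" if "u x \<noteq> 0" for x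
    using supp[OF that] R(2) by linarith
  ultimately show thesis using that[OF u] by blast
qed

text \<open>On a support with \<open>r \<ge> T\<close> the Hardy term is at most
  \<open>c / T\<^sup>2\<close> times the integral of \<open>u\<^sup>2\<close>, so any excess of
  \<open>C\<close> absorbs it for large \<open>T\<close>.\<close>

lemma sharp_poincare:
  fixes C :: real
  assumes N5: "CARD('n) \<ge> 5"
  defines "N \<equiv> real CARD('n)"
  assumes C: "C > (N - 1)^4 / 16"
  shows "\<exists>u \<in> (Cc_inf_H :: (real^'n \<Rightarrow> real) set).
    hyp_integral (\<lambda>x. (hyp_laplacian u x)\<^sup>2) - C * hyp_integral (\<lambda>x. (u x)\<^sup>2) < 0"
proof -
  \<comment> \<open>Any constant above the Hardy threshold would serve.\<close>
  define c where "c = (N - 1)\<^sup>2 / 8 + 1"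
  define \<delta> where "\<delta> = C - (N - 1)^4 / 16"
  have c: "c > (N - 1)\<^sup>2 / 8" "c > 0" and \<delta>: "\<delta> > 0" using C by (auto simp: c_def \<delta>_def add_nonneg_pos)
  \<comment> \<open>With \<open>T \<ge> 1\<close> the bound \<open>c \<le> \<delta> * T\<close>
    already gives \<open>c \<le> \<delta> * r\<^sup>2\<close> for \<open>r \<ge> T\<close>.\<close>
  define T where "T = max 1 (c / \<delta>)"
  have "(0::real^'n) \<in> hball" by (simp add: mem_hball)
  from sharp_test_function[OF N5 this c(1)[unfolded N_def], of T]
  obtain u :: "real^'n \<Rightarrow> real" where u: "u \<in> Cc_inf_H" "\<And>x. u x \<noteq> 0 \<Longrightarrow> x \<in> hball \<and> rd x \<ge> T"
    and lt: "hyp_integral (\<lambda>x. (hyp_laplacian u x)\<^sup>2) - (N - 1)^4 / 16 * hyp_integral (\<lambda>x. (u x)\<^sup>2)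
      < c * hyp_integral (\<lambda>x. (u x)\<^sup>2 / (hyp_dist x 0)\<^sup>2)"
    unfolding N_def by blast
  have [measurable]: "u \<in> borel_measurable borel" by (rule Cc_inf_H_measurable[OF u(1)])
  have T: "T \<ge> 1" "T \<ge> c / \<delta>" by (auto simp: T_def)
  have h2: "hyp_integral (\<lambda>x. (u x)\<^sup>2) = (\<integral>x. sh x ^ CARD('n) * (u x)\<^sup>2 / norm x ^ CARD('n) \<partial>lborel)"
    by (rule hyp_integral_radial) (auto simp: Cc_vanish[OF u(1)])
  have h3: "hyp_integral (\<lambda>x. (u x)\<^sup>2 / (hyp_dist x 0)\<^sup>2) = (\<integral>x. sh x ^ CARD('n) * ((u x)\<^sup>2 / (hyp_dist x 0)\<^sup>2) / norm x ^ CARD('n) \<partial>lborel)"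
    by (rule hyp_integral_radial) (auto simp: Cc_vanish[OF u(1)])
  have "c * hyp_integral (\<lambda>x. (u x)\<^sup>2 / (hyp_dist x 0)\<^sup>2) = (\<integral>x. c * (sh x ^ CARD('n) * ((u x)\<^sup>2 / (hyp_dist x 0)\<^sup>2) / norm x ^ CARD('n)) \<partial>lborel)"
    unfolding h3 by (rule integral_mult_right_zero[symmetric])
  also have "\<dots> \<le> (\<integral>x. \<delta> * (sh x ^ CARD('n) * (u x)\<^sup>2 / norm x ^ CARD('n)) \<partial>lborel)"
  proof (rule integral_mono')
    show "integrable lborel (\<lambda>x. \<delta> * (sh x ^ CARD('n) * (u x)\<^sup>2 / norm x ^ CARD('n)))"
      using integrable_radmono[OF Cc_inf_H_mult[OF u(1) u(1)], of 0 "CARD('n)" 0] N5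
      by (intro integrable_mult_right) (simp add: radmono_def power2_eq_square mult_ac)
    fix x
    have nn: "sh x ^ CARD('n) * (u x)\<^sup>2 / norm x ^ CARD('n) \<ge> 0"
    proof (cases "u x = 0")
      case False
      then show ?thesis using sh_nonneg[of x] u(2)[of x] by simp
    qed simp
    then show "0 \<le> \<delta> * (sh x ^ CARD('n) * (u x)\<^sup>2 / norm x ^ CARD('n))" using \<delta> by (intro mult_nonneg_nonneg) auto
    show "c * (sh x ^ CARD('n) * ((u x)\<^sup>2 / (hyp_dist x 0)\<^sup>2) / norm x ^ CARD('n)) \<le> \<delta> * (sh x ^ CARD('n) * (u x)\<^sup>2 / norm x ^ CARD('n))"
    proof (cases "u x = 0")
      case False
      then have x: "x \<in> hball" "rd x \<ge> T" using u(2) by auto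
      have "c \<le> \<delta> * T" using T(2) \<delta> by (simp add: field_simps)
      also have "\<dots> \<le> \<delta> * (rd x)\<^sup>2"
      proof -
        have "T * 1 \<le> rd x * rd x" using x T by (intro mult_mono) auto
        then show ?thesis using \<delta> by (simp add: power2_eq_square)
      qed
      finally have "c / (rd x)\<^sup>2 \<le> \<delta>" using x T by (simp add: divide_le_eq)
      from mult_right_mono[OF this nn] show ?thesis by (simp add: hyp_dist_0[OF x(1)] mult_ac)
    qed simp
  qed
  also have "\<dots> = \<delta> * hyp_integral (\<lambda>x. (u x)\<^sup>2)" unfolding h2 by (rule integral_mult_right_zero)
  finally have "hyp_integral (\<lambda>x. (hyp_laplacian u x)\<^sup>2) - C * hyp_integral (\<lambda>x. (u x)\<^sup>2) < 0"
    using lt by (simp add: \<delta>_def algebra_simps)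
  then show ?thesis using u(1) by blast
qed

theorem theorem3p1:
  fixes x0 :: "real^'n"
  defines "N \<equiv> real CARD('n)"
  assumes "CARD('n) \<ge> 5" and "x0 \<in> hball"
  shows "(\<forall>u \<in> Cc_inf_H.
            hyp_integral (\<lambda>x. (hyp_laplacian u x)\<^sup>2) - (N - 1)^4 / 16 * hyp_integral (\<lambda>x. (u x)\<^sup>2)
            \<ge> (N - 1)\<^sup>2 / 8 * hyp_integral (\<lambda>x. (u x)\<^sup>2 / (hyp_dist x x0)\<^sup>2)
              + 9 / 16 * hyp_integral (\<lambda>x. (u x)\<^sup>2 / (hyp_dist x x0) ^ 4)
              + (N\<^sup>2 - 1) * (N - 3)\<^sup>2 / 8 * hyp_integral (\<lambda>x. (u x)\<^sup>2 / (sinh (hyp_dist x x0))\<^sup>2)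
              + (N - 1) * (N - 3) * (N\<^sup>2 - 4 * N - 3) / 16
                  * hyp_integral (\<lambda>x. (u x)\<^sup>2 / (sinh (hyp_dist x x0)) ^ 4))
       \<and> (\<forall>C > (N - 1)^4 / 16. \<exists>u \<in> (Cc_inf_H :: (real^'n \<Rightarrow> real) set).
            hyp_integral (\<lambda>x. (hyp_laplacian u x)\<^sup>2) - C * hyp_integral (\<lambda>x. (u x)\<^sup>2) < 0)
       \<and> (\<forall>c > (N - 1)\<^sup>2 / 8. \<exists>u \<in> Cc_inf_H.
            hyp_integral (\<lambda>x. (hyp_laplacian u x)\<^sup>2) - (N - 1)^4 / 16 * hyp_integral (\<lambda>x. (u x)\<^sup>2)
            < c * hyp_integral (\<lambda>x. (u x)\<^sup>2 / (hyp_dist x x0)\<^sup>2))"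
proof (intro conjI allI ballI impI)
  fix u :: "real^'n \<Rightarrow> real"
  assume "u \<in> Cc_inf_H"
  from rellich_inequality[OF this assms(2,3)]
  show "hyp_integral (\<lambda>x. (hyp_laplacian u x)\<^sup>2) - (N - 1)^4 / 16 * hyp_integral (\<lambda>x. (u x)\<^sup>2)
            \<ge> (N - 1)\<^sup>2 / 8 * hyp_integral (\<lambda>x. (u x)\<^sup>2 / (hyp_dist x x0)\<^sup>2)
              + 9 / 16 * hyp_integral (\<lambda>x. (u x)\<^sup>2 / (hyp_dist x x0) ^ 4)
              + (N\<^sup>2 - 1) * (N - 3)\<^sup>2 / 8 * hyp_integral (\<lambda>x. (u x)\<^sup>2 / (sinh (hyp_dist x x0))\<^sup>2)
              + (N - 1) * (N - 3) * (N\<^sup>2 - 4 * N - 3) / 16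
                  * hyp_integral (\<lambda>x. (u x)\<^sup>2 / (sinh (hyp_dist x x0)) ^ 4)"
    unfolding N_def .
next
  fix C assume "C > (N - 1)^4 / 16"
  from sharp_poincare[OF assms(2) this[unfolded N_def]]
  show "\<exists>u \<in> (Cc_inf_H :: (real^'n \<Rightarrow> real) set).
    hyp_integral (\<lambda>x. (hyp_laplacian u x)\<^sup>2) - C * hyp_integral (\<lambda>x. (u x)\<^sup>2) < 0" .
next
  fix c assume "c > (N - 1)\<^sup>2 / 8"
  from sharp_test_function[OF assms(2,3) this[unfolded N_def]]
  show "\<exists>u \<in> Cc_inf_H.
    hyp_integral (\<lambda>x. (hyp_laplacian u x)\<^sup>2) - (N - 1)^4 / 16 * hyp_integral (\<lambda>x. (u x)\<^sup>2)
      < c * hyp_integral (\<lambda>x. (u x)\<^sup>2 / (hyp_dist x x0)\<^sup>2)"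
    unfolding N_def by blast
qed

end
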